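(* Let $\psi_{ABC}$ be a state on the $L_x\times L_y$ cylinder (periodic in $x$, open in $y$), partitioned into three rectangular regions $A$, $B$, $C$ each of size $L_x/3\times L_y$, prepared by a sequential circuit of depth $L_y<L_x/6$. 1. If the initial state is a trivial product state, then $\psi_{ABC}$ is a triangle state. 2. If the initial state on the bottom edge is a cat state $\sum_i|ii\cdots i\rangle$ (up to normalization), with the bulk initialized in a product state, then $\psi_{ABC}$ is a sum of triangle states. In either case, the output state cannot have an ungappable edge.
   Context: **Sequential circuit.** Finite-dimensional qudits sit at positions $(x,y)$, with $x\in\mathbb{Z}/L_x\mathbb{Z}$ ($L_x$ even and divisible by $3$). The circuit has $L_y$ layers. Layer $t=1,\dots,L_y$ is a product of commuting unitary gates in a brick-wall pattern: for $t$ odd the gates act on column pairs $(2j-1,2j)$, for $t$ even on column pairs $(2j,2j+1)$; each gate is an arbitrary unitary on the four qudits at columns $\{x,x+1\}$ and rows $\{t,t+1\}$. Thus after layer $t$ row $t$ is never acted on again, and the row $t+1$ carries the "virtual" degrees of freedom to the next layer; the row left over after the last layer is counted as part of the top edge. No translation invariance is assumed. Initially all qudits in rows $\ge2$ are in a fixed product state $|0\rangle$, and row $1$ (the bottom edge) is in the specified 1D state: a product state in case 1; in case 2, the state proportional to $\sum_i|i\rangle^{\otimes L_x}$, $i$ running over an orthonormal basis of the local space. Regions $A,B,C$ consist of all qudits in three consecutive blocks of $L_x/3$ columns. **Triangle state.** A pure state $\psi_{ABC}\in\mathcal H_A\otimes\mathcal H_B\otimes\mathcal H_C$ is a triangle state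 if there exist decompositions (unitary identifications) $\mathcal H_A=\mathcal H_{A_0}\oplus(\mathcal H_{A_L}\otimes\mathcal H_{A_R})$, $\mathcal H_B=\mathcal H_{B_0}\oplus(\mathcal H_{B_L}\otimes\mathcal H_{B_R})$, $\mathcal H_C=\mathcal H_{C_0}\oplus(\mathcal H_{C_L}\otimes\mathcal H_{C_R})$ such that $\psi_{ABC}=\psi_{A_RB_L}\otimes\psi_{B_RC_L}\otimes\psi_{C_RA_L}$ with $\psi_{A_RB_L}\in\mathcal H_{A_R}\otimes\mathcal H_{B_L}$, $\psi_{B_RC_L}\in\mathcal H_{B_R}\otimes\mathcal H_{C_L}$, $\psi_{C_RA_L}\in\mathcal H_{C_R}\otimes\mathcal H_{A_L}$. **Sum of triangle states.** $\psi_{ABC}$ is a sum of triangle states if there exist orthogonal decompositions $\mathcal H_A=\mathcal H_{A_0}\oplus\bigoplus_j(\mathcal H_{A_L^j}\otimes\mathcal H_{A_R^j})$, and likewise for $B$ and $C$, such that $\psi_{ABC}=\sum_j\sqrt{p_j}\,\psi_{A_R^jB_L^j}\otimes\psi_{B_R^jC_L^j}\otimes\psi_{C_R^jA_L^j}$, with $p_j\ge0$, $\sum_jp_j=1$, and normalized vectors $\psi_{A_R^jB_L^j}\in\mathcal H_{A_R^j}\otimes\mathcal H_{B_L^j}$, $\psi_{B_R^jC_L^j}\in\mathcal H_{B_R^j}\otimes\mathcal H_{C_L^j}$, $\psi_{C_R^jA_L^j}\in\mathcal H_{C_R^j}\otimes\mathcal H_{A_L^j}$. **Ungappable edge.** The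 signature used is the Markov gap $h(A:B)=S_R(A:B)-I(A:B)$, where $I(A:B)$ is the mutual information and the reflected entropy $S_R(A:B)$ is the von Neumann entropy of $AA^*$ in the canonical purification $|\sqrt{\rho_{AB}}\rangle\in\mathcal H_A\otimes\mathcal H_B\otimes\mathcal H_{A}^*\otimes\mathcal H_{B}^*$. A state with an ungappable edge described by a conformal field theory of central charge $c>0$ has $h(A:B)=\frac c3\log2>0$ (in the limit of large system size). *)

theory Defs
  imports Complex_Main "HOL-Library.FuncSet"
begin

text \<open>
  The finite-dimensional Hilbert space with orthonormal basis labelled by a finite set \<open>X\<close> is
  modelled by functions \<open>X \<Rightarrow> complex\<close>; only the values on \<open>X\<close> matter. A linear map is given by its
  matrix \<open>U x y\<close> (row \<open>x\<close>, column \<open>y\<close>), and tensor products and direct sums of spaces correspond to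
  products and disjoint sums of the label sets.
\<close>

definition unit_vector :: "'a set \<Rightarrow> ('a \<Rightarrow> complex) \<Rightarrow> bool" where
  "unit_vector X v \<longleftrightarrow> (\<Sum>x\<in>X. (cmod (v x))\<^sup>2) = 1"

definition unitary_on :: "'a set \<Rightarrow> 'b set \<Rightarrow> ('a \<Rightarrow> 'b \<Rightarrow> complex) \<Rightarrow> bool" where
  "unitary_on X Y U \<longleftrightarrow>
     (\<forall>y\<in>Y. \<forall>y'\<in>Y. (\<Sum>x\<in>X. cnj (U x y) * U x y') = (if y = y' then 1 else 0)) \<and>
     (\<forall>x\<in>X. \<forall>x'\<in>X. (\<Sum>y\<in>Y. U x y * cnj (U x' y)) = (if x = x' then 1 else 0))"


section \<open>Triangle states\<close>

text \<open>
  A tripartite vector is a function \<open>\<psi> a b c\<close> of basis labels \<open>a \<in> X\<close>, \<open>b \<in> Y\<close>, \<open>c \<in> Z\<close> of the three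
  parties. The abstract factor spaces are \<open>\<complex>\<^sup>n\<close> for suitable dimensions \<open>n\<close> (possibly \<open>0\<close>).
\<close>

definition tripartite_state ::
  "'a set \<Rightarrow> 'b set \<Rightarrow> 'c set \<Rightarrow> ('a \<Rightarrow> 'b \<Rightarrow> 'c \<Rightarrow> complex) \<Rightarrow> bool" where
  "tripartite_state X Y Z \<psi> \<longleftrightarrow> unit_vector (X \<times> Y \<times> Z) (\<lambda>(a, b, c). \<psi> a b c)"

text \<open>Label set of \<open>\<complex>\<^bsup>n0\<^esup> \<oplus> (\<complex>\<^bsup>nL\<^esup> \<otimes> \<complex>\<^bsup>nR\<^esup>)\<close>.\<close>

definition split_labels :: "nat \<Rightarrow> nat \<Rightarrow> nat \<Rightarrow> (nat + nat \<times> nat) set" where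
  "split_labels n0 nL nR = {..<n0} <+> ({..<nL} \<times> {..<nR})"

definition triangle_state ::
  "'a set \<Rightarrow> 'b set \<Rightarrow> 'c set \<Rightarrow> ('a \<Rightarrow> 'b \<Rightarrow> 'c \<Rightarrow> complex) \<Rightarrow> bool" where
  "triangle_state X Y Z \<psi> \<longleftrightarrow> tripartite_state X Y Z \<psi> \<and>
    (\<exists>(a0::nat) aL aR UA (b0::nat) bL bR UB (c0::nat) cL cR UC
       (\<psi>AB :: nat \<Rightarrow> nat \<Rightarrow> complex) (\<psi>BC :: nat \<Rightarrow> nat \<Rightarrow> complex) (\<psi>CA :: nat \<Rightarrow> nat \<Rightarrow> complex).
       unitary_on X (split_labels a0 aL aR) UA \<and>
       unitary_on Y (split_labels b0 bL bR) UB \<and>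
       unitary_on Z (split_labels c0 cL cR) UC \<and>
       (\<forall>a\<in>X. \<forall>b\<in>Y. \<forall>c\<in>Z. \<psi> a b c =
          (\<Sum>(lA, rA) \<in> {..<aL} \<times> {..<aR}. \<Sum>(lB, rB) \<in> {..<bL} \<times> {..<bR}.
           \<Sum>(lC, rC) \<in> {..<cL} \<times> {..<cR}.
             UA a (Inr (lA, rA)) * UB b (Inr (lB, rB)) * UC c (Inr (lC, rC)) *
             (\<psi>AB rA lB * \<psi>BC rB lC * \<psi>CA rC lA))))"

text \<open>Label set of \<open>\<complex>\<^bsup>n0\<^esup> \<oplus> (\<Oplus>j<m. \<complex>\<^bsup>nL j\<^esup> \<otimes> \<complex>\<^bsup>nR j\<^esup>)\<close>.\<close>

definition sum_split_labels ::
  "nat \<Rightarrow> nat \<Rightarrow> (nat \<Rightarrow> nat) \<Rightarrow> (nat \<Rightarrow> nat) \<Rightarrow> (nat + nat \<times> nat \<times> nat) set" where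
  "sum_split_labels m n0 nL nR = {..<n0} <+> (SIGMA j:{..<m}. {..<nL j} \<times> {..<nR j})"

definition sum_of_triangle_states ::
  "'a set \<Rightarrow> 'b set \<Rightarrow> 'c set \<Rightarrow> ('a \<Rightarrow> 'b \<Rightarrow> 'c \<Rightarrow> complex) \<Rightarrow> bool" where
  "sum_of_triangle_states X Y Z \<psi> \<longleftrightarrow> tripartite_state X Y Z \<psi> \<and>
    (\<exists>(m::nat) (p :: nat \<Rightarrow> real) (a0::nat) aL aR UA (b0::nat) bL bR UB (c0::nat) cL cR UC
       (\<psi>AB :: nat \<Rightarrow> nat \<Rightarrow> nat \<Rightarrow> complex) (\<psi>BC :: nat \<Rightarrow> nat \<Rightarrow> nat \<Rightarrow> complex)
       (\<psi>CA :: nat \<Rightarrow> nat \<Rightarrow> nat \<Rightarrow> complex).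
       unitary_on X (sum_split_labels m a0 aL aR) UA \<and>
       unitary_on Y (sum_split_labels m b0 bL bR) UB \<and>
       unitary_on Z (sum_split_labels m c0 cL cR) UC \<and>
       (\<forall>j<m. p j \<ge> 0) \<and> (\<Sum>j<m. p j) = 1 \<and>
       (\<forall>j<m. unit_vector ({..<aR j} \<times> {..<bL j}) (\<lambda>(r, l). \<psi>AB j r l) \<and>
              unit_vector ({..<bR j} \<times> {..<cL j}) (\<lambda>(r, l). \<psi>BC j r l) \<and>
              unit_vector ({..<cR j} \<times> {..<aL j}) (\<lambda>(r, l). \<psi>CA j r l)) \<and>
       (\<forall>a\<in>X. \<forall>b\<in>Y. \<forall>c\<in>Z. \<psi> a b c =
          (\<Sum>j<m. complex_of_real (sqrt (p j)) *
            (\<Sum>(lA, rA) \<in> {..<aL j} \<times> {..<aR j}. \<Sum>(lB, rB) \<in> {..<bL j} \<times> {..<bR j}.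
             \<Sum>(lC, rC) \<in> {..<cL j} \<times> {..<cR j}.
               UA a (Inr (j, lA, rA)) * UB b (Inr (j, lB, rB)) * UC c (Inr (j, lC, rC)) *
               (\<psi>AB j rA lB * \<psi>BC j rB lC * \<psi>CA j rC lA)))))"


section \<open>Markov gap\<close>

text \<open>
  Functional calculus of a Hermitian matrix: \<open>f(\<rho>) = \<Sum>\<^sub>k f(p\<^sub>k) |e\<^sub>k\<rangle>\<langle>e\<^sub>k|\<close> for an orthonormal
  eigenbasis \<open>e\<^sub>k = U _ k\<close> with eigenvalues \<open>p\<^sub>k\<close>. The eigenbasis is labelled by \<open>X\<close> itself;
  on \<open>X \<times> X\<close> the result does not depend on the chosen eigenbasis.
\<close>

definition matrix_fun ::
  "'a set \<Rightarrow> (real \<Rightarrow> real) \<Rightarrow> ('a \<Rightarrow> 'a \<Rightarrow> complex) \<Rightarrow> 'a \<Rightarrow> 'a \<Rightarrow> complex" where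
  "matrix_fun X f \<rho> = (SOME \<sigma>. \<exists>U p. unitary_on X X U \<and>
     (\<forall>x\<in>X. \<forall>y\<in>X. \<rho> x y = (\<Sum>k\<in>X. U x k * complex_of_real (p k) * cnj (U y k))) \<and>
     \<sigma> = (\<lambda>x y. \<Sum>k\<in>X. U x k * complex_of_real (f (p k)) * cnj (U y k)))"

text \<open>\<open>S(\<rho>) = - Tr (\<rho> ln \<rho>)\<close>; the convention \<open>0 ln 0 = 0\<close> holds automatically.\<close>

definition von_Neumann_entropy :: "'a set \<Rightarrow> ('a \<Rightarrow> 'a \<Rightarrow> complex) \<Rightarrow> real" where
  "von_Neumann_entropy X \<rho> = - Re (\<Sum>x\<in>X. matrix_fun X (\<lambda>t. t * ln t) \<rho> x x)"

definition rho_AB ::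
  "'c set \<Rightarrow> ('a \<Rightarrow> 'b \<Rightarrow> 'c \<Rightarrow> complex) \<Rightarrow> 'a \<times> 'b \<Rightarrow> 'a \<times> 'b \<Rightarrow> complex" where
  "rho_AB Z \<psi> = (\<lambda>(a, b) (a', b'). \<Sum>c\<in>Z. \<psi> a b c * cnj (\<psi> a' b' c))"

definition rho_A ::
  "'b set \<Rightarrow> 'c set \<Rightarrow> ('a \<Rightarrow> 'b \<Rightarrow> 'c \<Rightarrow> complex) \<Rightarrow> 'a \<Rightarrow> 'a \<Rightarrow> complex" where
  "rho_A Y Z \<psi> = (\<lambda>a a'. \<Sum>b\<in>Y. rho_AB Z \<psi> (a, b) (a', b))"

definition rho_B ::
  "'a set \<Rightarrow> 'c set \<Rightarrow> ('a \<Rightarrow> 'b \<Rightarrow> 'c \<Rightarrow> complex) \<Rightarrow> 'b \<Rightarrow> 'b \<Rightarrow> complex" where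
  "rho_B X Z \<psi> = (\<lambda>b b'. \<Sum>a\<in>X. rho_AB Z \<psi> (a, b) (a, b'))"

definition mutual_information ::
  "'a set \<Rightarrow> 'b set \<Rightarrow> 'c set \<Rightarrow> ('a \<Rightarrow> 'b \<Rightarrow> 'c \<Rightarrow> complex) \<Rightarrow> real" where
  "mutual_information X Y Z \<psi> =
     von_Neumann_entropy X (rho_A Y Z \<psi>) + von_Neumann_entropy Y (rho_B X Z \<psi>)
     - von_Neumann_entropy (X \<times> Y) (rho_AB Z \<psi>)"

text \<open>
  Under \<open>\<H>\<^sub>A \<otimes> \<H>\<^sub>B \<otimes> \<H>\<^sub>A\<^sup>* \<otimes> \<H>\<^sub>B\<^sup>*\<close>, the vector \<open>|\<surd>\<rho>\<^sub>A\<^sub>B\<rangle>\<close> has the matrix entries of \<open>\<surd>\<rho>\<^sub>A\<^sub>B\<close> as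
  components; the primed labels are those of the dual factors.
\<close>

definition canonical_purification ::
  "'a set \<Rightarrow> 'b set \<Rightarrow> 'c set \<Rightarrow> ('a \<Rightarrow> 'b \<Rightarrow> 'c \<Rightarrow> complex) \<Rightarrow> 'a \<Rightarrow> 'b \<Rightarrow> 'a \<Rightarrow> 'b \<Rightarrow> complex" where
  "canonical_purification X Y Z \<psi> a b a' b' =
     matrix_fun (X \<times> Y) sqrt (rho_AB Z \<psi>) (a, b) (a', b')"

definition reflected_entropy ::
  "'a set \<Rightarrow> 'b set \<Rightarrow> 'c set \<Rightarrow> ('a \<Rightarrow> 'b \<Rightarrow> 'c \<Rightarrow> complex) \<Rightarrow> real" where
  "reflected_entropy X Y Z \<psi> =
     von_Neumann_entropy (X \<times> X) (\<lambda>(a1, a1') (a2, a2'). \<Sum>b\<in>Y. \<Sum>b'\<in>Y.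
        canonical_purification X Y Z \<psi> a1 b a1' b' *
        cnj (canonical_purification X Y Z \<psi> a2 b a2' b'))"

definition markov_gap ::
  "'a set \<Rightarrow> 'b set \<Rightarrow> 'c set \<Rightarrow> ('a \<Rightarrow> 'b \<Rightarrow> 'c \<Rightarrow> complex) \<Rightarrow> real" where
  "markov_gap X Y Z \<psi> = reflected_entropy X Y Z \<psi> - mutual_information X Y Z \<psi>"

text \<open>
  The Markov-gap signature of an ungappable edge is asymptotic in the system size, so it is a property
  of a sequence of tripartite states. No growth of the system is imposed; in particular a constant
  sequence carries the signature iff its single member has Markov gap \<open>(c / 3) ln 2\<close> for some \<open>c > 0\<close>.
\<close>

definition ungappable_edge ::
  "(nat \<Rightarrow> 'a set) \<Rightarrow> (nat \<Rightarrow> 'b set) \<Rightarrow> (nat \<Rightarrow> 'c set) \<Rightarrow>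
   (nat \<Rightarrow> 'a \<Rightarrow> 'b \<Rightarrow> 'c \<Rightarrow> complex) \<Rightarrow> bool" where
  "ungappable_edge X Y Z \<psi> \<longleftrightarrow>
     (\<exists>c>0. (\<lambda>n. markov_gap (X n) (Y n) (Z n) (\<psi> n)) \<longlonglongrightarrow> c / 3 * ln 2)"


section \<open>Sequential circuits on the cylinder\<close>

text \<open>
  Sites are pairs (column, row). Columns are the residues \<open>0, \<dots>, Lx - 1\<close> modulo \<open>Lx\<close>; rows are
  \<open>1, \<dots>, Ly + 1\<close>, the last one being the row left over after layer \<open>Ly\<close>. The qudit at site \<open>s\<close> has
  dimension \<open>d s\<close>. Basis states of the qudits in a set \<open>S\<close> of sites are the elements of \<open>configs d S\<close>.
\<close>

type_synonym site = "nat \<times> nat"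
type_synonym config = "site \<Rightarrow> nat"

definition sites :: "nat \<Rightarrow> nat \<Rightarrow> site set" where
  "sites Lx Ly = {..<Lx} \<times> {1..Ly + 1}"

definition configs :: "(site \<Rightarrow> nat) \<Rightarrow> site set \<Rightarrow> config set" where
  "configs d S = (\<Pi>\<^sub>E s\<in>S. {..<d s})"

definition cylinder :: "nat \<Rightarrow> nat \<Rightarrow> (site \<Rightarrow> nat) \<Rightarrow> bool" where
  "cylinder Lx Ly d \<longleftrightarrow> even Lx \<and> 3 dvd Lx \<and> (\<forall>s\<in>sites Lx Ly. 0 < d s)"

text \<open>\<open>U \<otimes> 1\<close> applied to \<open>\<psi>\<close>, where \<open>U\<close> acts on the qudits in \<open>S\<close>.\<close>

definition apply_gate ::
  "(site \<Rightarrow> nat) \<Rightarrow> site set \<Rightarrow> (config \<Rightarrow> config \<Rightarrow> complex) \<Rightarrow> (config \<Rightarrow> complex) \<Rightarrow> config \<Rightarrow> complex"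
  where
  "apply_gate d S U \<psi> \<sigma> = (\<Sum>\<tau>\<in>configs d S. U (restrict \<sigma> S) \<tau> * \<psi> (override_on \<sigma> \<tau> S))"

definition gate_sites :: "nat \<Rightarrow> nat \<Rightarrow> nat \<Rightarrow> site set" where
  "gate_sites Lx t x = {x, (x + 1) mod Lx} \<times> {t, t + 1}"

text \<open>
  In layer \<open>t\<close> there is one gate for each column pair \<open>(x, x + 1)\<close> with \<open>x\<close> of the same parity as \<open>t\<close>.
  For even \<open>Lx\<close> these gates have disjoint supports, so the order of composition is immaterial.
\<close>

definition gate_columns :: "nat \<Rightarrow> nat \<Rightarrow> nat list" where
  "gate_columns Lx t = filter (\<lambda>x. even x = even t) [0..<Lx]"

definition apply_layer ::
  "nat \<Rightarrow> (site \<Rightarrow> nat) \<Rightarrow> (nat \<Rightarrow> nat \<Rightarrow> config \<Rightarrow> config \<Rightarrow> complex) \<Rightarrow> nat \<Rightarrow>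
   (config \<Rightarrow> complex) \<Rightarrow> config \<Rightarrow> complex" where
  "apply_layer Lx d G t = fold (\<lambda>x. apply_gate d (gate_sites Lx t x) (G t x)) (gate_columns Lx t)"

primrec run_circuit ::
  "nat \<Rightarrow> (site \<Rightarrow> nat) \<Rightarrow> (nat \<Rightarrow> nat \<Rightarrow> config \<Rightarrow> config \<Rightarrow> complex) \<Rightarrow> nat \<Rightarrow>
   (config \<Rightarrow> complex) \<Rightarrow> config \<Rightarrow> complex" where
  "run_circuit Lx d G 0 \<phi> = \<phi>"
| "run_circuit Lx d G (Suc t) \<phi> = apply_layer Lx d G (Suc t) (run_circuit Lx d G t \<phi>)"

text \<open>\<open>\<psi>\<close> is the output of some sequential circuit with \<open>Ly\<close> layers and input \<open>\<phi>\<close>.\<close>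

definition sequential_circuit ::
  "nat \<Rightarrow> nat \<Rightarrow> (site \<Rightarrow> nat) \<Rightarrow> (config \<Rightarrow> complex) \<Rightarrow> (config \<Rightarrow> complex) \<Rightarrow> bool" where
  "sequential_circuit Lx Ly d \<phi> \<psi> \<longleftrightarrow>
     (\<exists>G. (\<forall>t\<in>{1..Ly}. \<forall>x\<in>set (gate_columns Lx t).
             unitary_on (configs d (gate_sites Lx t x)) (configs d (gate_sites Lx t x)) (G t x)) \<and>
          \<psi> = run_circuit Lx d G Ly \<phi>)"

definition product_state ::
  "(site \<Rightarrow> nat) \<Rightarrow> site set \<Rightarrow> (config \<Rightarrow> complex) \<Rightarrow> bool" where
  "product_state d S \<phi> \<longleftrightarrow>
     (\<exists>v. (\<forall>s\<in>S. unit_vector {..<d s} (v s)) \<and> \<phi> = (\<lambda>\<sigma>. \<Prod>s\<in>S. v s (\<sigma> s)))"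

text \<open>
  The normalised state proportional to \<open>\<Sum>\<^sub>i |i\<rangle>\<^bsup>\<otimes>Lx\<^esup>\<close> on row 1, where \<open>|i\<rangle> = b _ i\<close> for \<open>i < q\<close> is an
  orthonormal basis of \<open>\<complex>\<^sup>q\<close>.
\<close>

definition cat_state :: "nat \<Rightarrow> (site \<Rightarrow> nat) \<Rightarrow> (config \<Rightarrow> complex) \<Rightarrow> bool" where
  "cat_state Lx d \<phi> \<longleftrightarrow>
     (\<exists>q b. (\<forall>x<Lx. d (x, 1) = q) \<and> unitary_on {..<q} {..<q} b \<and>
        \<phi> = (\<lambda>\<sigma>. complex_of_real (1 / sqrt (real q)) * (\<Sum>i<q. \<Prod>x<Lx. b (\<sigma> (x, 1)) i)))"

definition bottom_row :: "nat \<Rightarrow> site set" where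
  "bottom_row Lx = {..<Lx} \<times> {1}"

definition trivial_initial_state ::
  "nat \<Rightarrow> nat \<Rightarrow> (site \<Rightarrow> nat) \<Rightarrow> (config \<Rightarrow> complex) \<Rightarrow> bool" where
  "trivial_initial_state Lx Ly d \<phi> \<longleftrightarrow>
     (\<exists>\<phi>1 \<phi>2. product_state d (bottom_row Lx) \<phi>1 \<and>
        product_state d (sites Lx Ly - bottom_row Lx) \<phi>2 \<and> \<phi> = (\<lambda>\<sigma>. \<phi>1 \<sigma> * \<phi>2 \<sigma>))"

definition cat_initial_state ::
  "nat \<Rightarrow> nat \<Rightarrow> (site \<Rightarrow> nat) \<Rightarrow> (config \<Rightarrow> complex) \<Rightarrow> bool" where
  "cat_initial_state Lx Ly d \<phi> \<longleftrightarrow>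
     (\<exists>\<phi>1 \<phi>2. cat_state Lx d \<phi>1 \<and>
        product_state d (sites Lx Ly - bottom_row Lx) \<phi>2 \<and> \<phi> = (\<lambda>\<sigma>. \<phi>1 \<sigma> * \<phi>2 \<sigma>))"

text \<open>
  The \<open>k\<close>-th block of \<open>Lx / 3\<close> columns counted from column \<open>x0\<close>; \<open>A\<close>, \<open>B\<close>, \<open>C\<close> are the blocks
  \<open>k = 0, 1, 2\<close>. The position \<open>x0\<close> of the tripartition relative to the brick-wall pattern is arbitrary.
\<close>

definition region :: "nat \<Rightarrow> nat \<Rightarrow> nat \<Rightarrow> nat \<Rightarrow> site set" where
  "region Lx Ly x0 k = (\<lambda>i. (x0 + i) mod Lx) ` {k * (Lx div 3)..<(k + 1) * (Lx div 3)} \<times> {1..Ly + 1}"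

definition region_labels :: "nat \<Rightarrow> nat \<Rightarrow> (site \<Rightarrow> nat) \<Rightarrow> nat \<Rightarrow> nat \<Rightarrow> config set" where
  "region_labels Lx Ly d x0 k = configs d (region Lx Ly x0 k)"

text \<open>\<open>\<psi>\<close> regarded as a vector in \<open>\<H>\<^sub>A \<otimes> \<H>\<^sub>B \<otimes> \<H>\<^sub>C\<close>.\<close>

definition tripartition ::
  "nat \<Rightarrow> nat \<Rightarrow> nat \<Rightarrow> (config \<Rightarrow> complex) \<Rightarrow> config \<Rightarrow> config \<Rightarrow> config \<Rightarrow> complex" where
  "tripartition Lx Ly x0 \<psi> a b c =
     \<psi> (override_on (override_on c b (region Lx Ly x0 1)) a (region Lx Ly x0 0))"

end

theory Submission
  imports Defs "Jordan_Normal_Form.Spectral_Radius"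
begin

text \<open>
  Only the gates in the backward light cone of the gates that cross a cut between two regions are
  nonlocal: all other gates commute to the end of the circuit and become unitaries of the single
  regions. Since \<open>Ly < Lx / 6\<close>, the three light cones are disjoint and miss at least one
  column of each region.
  A product input is thus mapped to a triangle state. For the cat state this holds for every term of
  the sum, and the untouched site of the bottom row in each region makes the terms locally orthogonal.

  For a sum of triangle states, the Schmidt decompositions of the pair states diagonalise \<open>\<rho>\<^sub>A\<close>, \<open>\<rho>\<^sub>B\<close>,
  \<open>\<rho>\<^sub>A\<^sub>B\<close> and \<open>\<rho>\<^sub>A\<^sub>A\<^sub>*\<close>. With \<open>H(p)\<close> the Shannon entropy of the weights and \<open>S\<^sub>A\<^sub>B\<close> the averaged
  entanglement entropy of \<open>\<psi>\<^sub>A\<^sub>R\<^sub>B\<^sub>L\<close>, both \<open>S\<^sub>R(A:B)\<close> and \<open>I(A:B)\<close> equal \<open>H(p) + 2 S\<^sub>A\<^sub>B\<close>, so the Markov gap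
  vanishes.
\<close>

section \<open>Isometries and the spectral theorem\<close>

text \<open>Both cases run through one argument with q product terms: case 1 has q = 1 and no marker
  sites, case 2 has one marker site per region, whose q basis states separate the terms. A block has
  n = Lx / 3 columns and a cone reaches at most Ly columns to either side of its cut, so 2 * Ly < n
  leaves a column free; this is the origin of the bound 1/6. Cones are not traced gate by gate:
  layer t is compared with strips whose half-width Ly - t + 1 depends only on t. The obstacle on the
  entropy side is that \<open>matrix_fun\<close> picks an unspecified full eigenbasis, whereas
  Schmidt decompositions give orthonormal families that need not span. The functions concerned,
  \<open>sqrt\<close> and t ln t, vanish at 0, so the kernel contributes nothing and any isometric
  decomposition with real weights yields the same value. Schmidt weights of pair states are kept
  strictly positive so that logarithms of products split; sector weights may be 0.\<close>

text \<open>Only the columns are orthonormal: \<open>Y\<close> may be smaller than \<open>X\<close>,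
  as for a Schmidt family that omits the kernel.\<close>

definition isometry_on :: "'a set \<Rightarrow> 'b set \<Rightarrow> ('a \<Rightarrow> 'b \<Rightarrow> complex) \<Rightarrow> bool" where
  "isometry_on X Y U \<longleftrightarrow>
     (\<forall>y\<in>Y. \<forall>y'\<in>Y. (\<Sum>x\<in>X. cnj (U x y) * U x y') = (if y = y' then 1 else 0))"

lemma isometry_onD:
  "isometry_on X Y U \<Longrightarrow> y \<in> Y \<Longrightarrow> y' \<in> Y \<Longrightarrow>
     (\<Sum>x\<in>X. cnj (U x y) * U x y') = (if y = y' then 1 else 0)"
  by (simp add: isometry_on_def)

lemma isometry_on_subset: "isometry_on X Y U \<Longrightarrow> Y' \<subseteq> Y \<Longrightarrow> isometry_on X Y' U"
  by (auto simp: isometry_on_def subset_iff)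

lemma isometry_on_cnj:
  assumes "isometry_on X Y U"
  shows "isometry_on X Y (\<lambda>x y. cnj (U x y))"
  unfolding isometry_on_def
proof (intro ballI)
  fix y y' assume "y \<in> Y" "y' \<in> Y"
  then have "cnj (\<Sum>x\<in>X. cnj (U x y) * U x y') = (if y = y' then 1 else 0)"
    using assms by (simp add: isometry_onD)
  then show "(\<Sum>x\<in>X. cnj (cnj (U x y)) * cnj (U x y')) = (if y = y' then 1 else 0)"
    by simp
qed

lemma unitary_on_isometry: "unitary_on X Y U \<Longrightarrow> isometry_on X Y U"
  by (simp add: unitary_on_def isometry_on_def)

lemma unitary_on_card:
  assumes "unitary_on X Y U"
  shows "card X = card Y"
proof -
  have "(\<Sum>y\<in>Y. \<Sum>x\<in>X. cnj (U x y) * U x y) = (\<Sum>y\<in>Y. 1)"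
    using assms by (intro sum.cong) (auto simp: unitary_on_def)
  moreover have "(\<Sum>x\<in>X. \<Sum>y\<in>Y. U x y * cnj (U x y)) = (\<Sum>x\<in>X. 1)"
    using assms by (intro sum.cong) (auto simp: unitary_on_def)
  moreover have "(\<Sum>y\<in>Y. \<Sum>x\<in>X. cnj (U x y) * U x y) = (\<Sum>x\<in>X. \<Sum>y\<in>Y. U x y * cnj (U x y))"
    by (subst sum.swap) (simp add: mult.commute)
  ultimately have "complex_of_nat (card X) = of_nat (card Y)" by simp
  then show ?thesis by (simp only: of_nat_eq_iff)
qed

lemma sum_cmod_square_eq_0:
  assumes "finite X" "(\<Sum>x\<in>X. f x * cnj (f x)) = 0" "x \<in> X"
  shows "f x = 0"
proof -
  have "complex_of_real (\<Sum>x\<in>X. (cmod (f x))\<^sup>2) = 0"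
    using assms(2) by (simp add: complex_norm_square del: of_real_power)
  then have "(\<Sum>x\<in>X. (cmod (f x))\<^sup>2) = 0" by (simp only: of_real_eq_0_iff)
  then show ?thesis using assms by (simp add: sum_nonneg_eq_0_iff)
qed

text \<open>The defect \<open>1 - U U\<^sup>\<dagger>\<close> has squared Frobenius norm \<open>|X| - |Y|\<close>.\<close>

lemma isometry_on_unitary:
  assumes fin: "finite X" "finite Y" and iso: "isometry_on X Y U" and card: "card X = card Y"
  shows "unitary_on X Y U"
proof -
  define P where "P x x' = (\<Sum>y\<in>Y. U x y * cnj (U x' y))" for x x'
  define D where "D x x' = (if x = x' then 1 else 0) - P x x'" for x x'
  have cP: "cnj (P x x') = P x' x" for x x' by (simp add: P_def mult.commute)
  have "(\<Sum>x\<in>X. \<Sum>x'\<in>X. P x x' * cnj (P x x'))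
      = (\<Sum>x\<in>X. \<Sum>x'\<in>X. \<Sum>y\<in>Y. \<Sum>y'\<in>Y. (cnj (U x y') * U x y) * (cnj (U x' y) * U x' y'))"
    unfolding P_def by (simp add: sum_product mult_ac)
  also have "\<dots> = (\<Sum>x\<in>X. \<Sum>y\<in>Y. \<Sum>x'\<in>X. \<Sum>y'\<in>Y. (cnj (U x y') * U x y) * (cnj (U x' y) * U x' y'))"
    by (intro sum.cong refl sum.swap)
  also have "\<dots> = (\<Sum>y\<in>Y. \<Sum>x\<in>X. \<Sum>y'\<in>Y. \<Sum>x'\<in>X. (cnj (U x y') * U x y) * (cnj (U x' y) * U x' y'))"
    by (subst sum.swap) (intro sum.cong refl sum.swap)
  also have "\<dots> = (\<Sum>y\<in>Y. \<Sum>y'\<in>Y. \<Sum>x\<in>X. \<Sum>x'\<in>X. (cnj (U x y') * U x y) * (cnj (U x' y) * U x' y'))"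
    by (intro sum.cong refl sum.swap)
  also have "\<dots> = (\<Sum>y\<in>Y. \<Sum>y'\<in>Y. (\<Sum>x\<in>X. cnj (U x y') * U x y) * (\<Sum>x'\<in>X. cnj (U x' y) * U x' y'))"
    by (simp add: sum_product)
  also have "\<dots> = (\<Sum>y\<in>Y. \<Sum>y'\<in>Y. if y = y' then 1 else 0)"
    using iso by (intro sum.cong refl) (auto simp: isometry_onD)
  also have "\<dots> = of_nat (card Y)" using fin by simp
  finally have PP: "(\<Sum>x\<in>X. \<Sum>x'\<in>X. P x x' * cnj (P x x')) = of_nat (card Y)" .
  have "(\<Sum>x\<in>X. P x x) = (\<Sum>y\<in>Y. \<Sum>x\<in>X. cnj (U x y) * U x y)"
    unfolding P_def by (subst sum.swap) (simp add: mult.commute)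
  also have "\<dots> = of_nat (card Y)" using iso by (simp add: isometry_onD)
  finally have trP: "(\<Sum>x\<in>X. P x x) = of_nat (card Y)" .
  have "(\<Sum>x\<in>X. \<Sum>x'\<in>X. D x x' * cnj (D x x'))
      = (\<Sum>x\<in>X. \<Sum>x'\<in>X. (if x = x' then 1 - P x x' - cnj (P x x') else 0) + P x x' * cnj (P x x'))"
    by (intro sum.cong refl) (auto simp: D_def algebra_simps)
  also have "\<dots> = (\<Sum>x\<in>X. 1 - P x x - cnj (P x x)) + of_nat (card Y)"
    using fin by (simp add: sum.distrib PP)
  also have "\<dots> = 0"
    using trP card by (simp add: sum_subtractf cP sum_distrib_left[symmetric])
  finally have "(\<Sum>z\<in>X \<times> X. D (fst z) (snd z) * cnj (D (fst z) (snd z))) = 0"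
    by (simp add: sum.cartesian_product split_def)
  then have "D x x' = 0" if "x \<in> X" "x' \<in> X" for x x'
    using sum_cmod_square_eq_0[of "X \<times> X" "\<lambda>z. D (fst z) (snd z)" "(x, x')"] fin that by simp
  then have "(\<Sum>y\<in>Y. U x y * cnj (U x' y)) = (if x = x' then 1 else 0)"
    if "x \<in> X" "x' \<in> X" for x x' using that by (simp add: D_def P_def)
  then show ?thesis using iso by (auto simp: unitary_on_def isometry_on_def)
qed

lemma isometry_on_mult:
  assumes fin: "finite X" "finite Y" "finite Z"
    and "isometry_on X Y U" "isometry_on Y Z V"
  shows "isometry_on X Z (\<lambda>x z. \<Sum>y\<in>Y. U x y * V y z)"
  unfolding isometry_on_def
proof (intro ballI)
  fix z z' assume z: "z \<in> Z" "z' \<in> Z"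
  have "(\<Sum>x\<in>X. cnj (\<Sum>y\<in>Y. U x y * V y z) * (\<Sum>y\<in>Y. U x y * V y z'))
     = (\<Sum>x\<in>X. \<Sum>y\<in>Y. \<Sum>y'\<in>Y. (cnj (V y z) * V y' z') * (cnj (U x y) * U x y'))"
    unfolding cnj_sum sum_product by (simp add: mult_ac)
  also have "\<dots> = (\<Sum>y\<in>Y. \<Sum>y'\<in>Y. \<Sum>x\<in>X. (cnj (V y z) * V y' z') * (cnj (U x y) * U x y'))"
    by (subst sum.swap) (intro sum.cong refl sum.swap)
  also have "\<dots> = (\<Sum>y\<in>Y. \<Sum>y'\<in>Y. if y = y' then cnj (V y z) * V y' z' else 0)"
    unfolding sum_distrib_left[symmetric] using assms(4)
    by (intro sum.cong refl) (auto simp: isometry_onD)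
  also have "\<dots> = (\<Sum>y\<in>Y. cnj (V y z) * V y z')" using fin by simp
  also have "\<dots> = (if z = z' then 1 else 0)" using assms(5) z by (rule isometry_onD)
  finally show "(\<Sum>x\<in>X. cnj (\<Sum>y\<in>Y. U x y * V y z) * (\<Sum>y\<in>Y. U x y * V y z'))
     = (if z = z' then 1 else 0)" .
qed

section \<open>Diagonalisation of Hermitian matrices\<close>

text \<open>A complex matrix of positive size has nonempty spectrum; \<open>X\<close> is enumerated
  by \<open>f\<close> to import this fact, and the eigenvector is normalised afterwards.\<close>

lemma exists_unit_eigenvector:
  fixes \<rho> :: "'a \<Rightarrow> 'a \<Rightarrow> complex"
  assumes fin: "finite X" and ne: "X \<noteq> {}"
  shows "\<exists>u \<kappa>. unit_vector X u \<and> (\<forall>x\<in>X. (\<Sum>y\<in>X. \<rho> x y * u y) = \<kappa> * u x)"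
proof -
  define n where "n = card X"
  obtain f where f: "bij_betw f {0..<n} X"
    using ex_bij_betw_nat_finite[OF fin] n_def by blast
  define A where "A = mat n n (\<lambda>(i, j). \<rho> (f i) (f j))"
  have A: "A \<in> carrier_mat n n" by (simp add: A_def)
  have "n > 0" using fin ne by (simp add: n_def card_gt_0_iff)
  then obtain \<kappa> where "eigenvalue A \<kappa>"
    using spectrum_non_empty[OF A] unfolding spectrum_def by auto
  then obtain v where v: "v \<in> carrier_vec n" "v \<noteq> 0\<^sub>v n" "A *\<^sub>v v = \<kappa> \<cdot>\<^sub>v v"
    using A unfolding eigenvalue_def eigenvector_def by auto
  define w where "w x = v $ (the_inv_into {0..<n} f x)" for x
  have wf: "w (f i) = v $ i" if "i < n" for i
    using f that by (simp add: w_def bij_betw_def the_inv_into_f_f)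
  have sum_f: "(\<Sum>y\<in>X. g y) = (\<Sum>i\<in>{0..<n}. g (f i))" for g :: "'a \<Rightarrow> 'c::comm_monoid_add"
    by (rule sum.reindex_bij_betw[OF f, symmetric])
  have ev: "(\<Sum>y\<in>X. \<rho> x y * w y) = \<kappa> * w x" if x: "x \<in> X" for x
  proof -
    obtain i where i: "i < n" "x = f i" using f x by (auto simp: bij_betw_def)
    have "(A *\<^sub>v v) $ i = (\<Sum>j\<in>{0..<n}. \<rho> (f i) (f j) * v $ j)"
      using i v(1) by (simp add: A_def scalar_prod_def)
    moreover have "(A *\<^sub>v v) $ i = \<kappa> * v $ i" using v i by simp
    ultimately show ?thesis using i by (simp add: sum_f wf)
  qed
  define N where "N = (\<Sum>x\<in>X. (cmod (w x))\<^sup>2)"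
  obtain i where i: "i < n" "v $ i \<noteq> 0" using v(1,2) by (metis carrier_vecD eq_vecI index_zero_vec)
  have "f i \<in> X" using f i by (auto simp: bij_betw_def)
  then have N: "N > 0" unfolding N_def
    using i wf by (intro sum_pos2[of X "f i"]) (auto simp: fin)
  define u where "u x = w x / complex_of_real (sqrt N)" for x
  have "(\<Sum>x\<in>X. (cmod (u x))\<^sup>2) = (\<Sum>x\<in>X. (cmod (w x))\<^sup>2 / N)"
    using N by (intro sum.cong) (auto simp: u_def norm_divide power_divide)
  also have "\<dots> = 1" using N by (simp add: sum_divide_distrib[symmetric] N_def[symmetric])
  finally have "unit_vector X u" by (simp add: unit_vector_def)
  moreover have "(\<Sum>y\<in>X. \<rho> x y * u y) = \<kappa> * u x" if "x \<in> X" for x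
    using ev[OF that] by (simp add: u_def sum_divide_distrib[symmetric])
  ultimately show ?thesis by blast
qed

text \<open>The Householder reflection along \<open>u - \<omega> e\<^sub>z\<close>, where the phase \<open>\<omega>\<close> keeps this vector away from \<open>0\<close>.\<close>

lemma householder:
  assumes fin: "finite X" and z: "z \<in> X" and u: "unit_vector X u"
  shows "\<exists>H \<omega>. unitary_on X X H \<and> cmod \<omega> = 1 \<and> (\<forall>x\<in>X. H x z = \<omega> * u x)"
proof -
  define r where "r = cmod (u z)"
  \<comment> \<open>The sign makes the two terms of \<open>w z\<close> add up: its modulus is 1 + r,
    so \<open>w\<close> is nonzero even if \<open>u\<close> is already a multiple of the basis
    vector at \<open>z\<close>.\<close>
  obtain \<omega> where \<omega>: "cmod \<omega> = 1" "u z = - \<omega> * complex_of_real r"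
  proof (cases "u z = 0")
    case True then show ?thesis using that[of 1] by (simp add: r_def)
  next
    case False
    then show ?thesis using that[of "- u z / complex_of_real r"]
      by (simp add: r_def norm_divide)
  qed
  have \<omega>\<omega>: "\<omega> * cnj \<omega> = 1" "cnj \<omega> * \<omega> = 1" using \<omega>(1) by (simp_all add: complex_norm_square[symmetric] mult.commute)
  define w where "w x = u x - (if x = z then \<omega> else 0)" for x
  define N where "N = complex_of_real (1 + r)"
  have r0: "r \<ge> 0" by (simp add: r_def)
  have N0: "N \<noteq> 0" unfolding N_def using r0 by (simp only: of_real_eq_0_iff)
  have uu: "(\<Sum>x\<in>X. cnj (u x) * u x) = 1"
    using u unfolding unit_vector_def
    by (metis (mono_tags, lifting) complex_norm_square mult.commute of_real_1 of_real_sum sum.cong)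
  have wz: "w z = - \<omega> * N" by (simp add: w_def \<omega>(2) N_def algebra_simps)
  have "(\<Sum>x\<in>X. cnj (w x) * w x) = (\<Sum>x\<in>X. cnj (u x) * u x +
       (if x = z then - cnj \<omega> * u x - cnj (u x) * \<omega> + cnj \<omega> * \<omega> else 0))"
    by (intro sum.cong refl) (auto simp: w_def algebra_simps)
  also have "\<dots> = 1 - cnj \<omega> * u z - cnj (u z) * \<omega> + cnj \<omega> * \<omega>"
    using fin z by (simp add: sum.distrib uu)
  also have "\<dots> = 2 + (cnj \<omega> * \<omega>) * (2 * complex_of_real r)"
    by (simp add: \<omega>(2) \<omega>\<omega>)
  also have "\<dots> = 2 * N" by (simp add: \<omega>\<omega> N_def)
  finally have ww: "(\<Sum>x\<in>X. cnj (w x) * w x) = 2 * N" .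
  \<comment> \<open>The reflection 1 - 2 |w><w| / <w, w>, since <w, w> = 2 * N by
    \<open>ww\<close>.\<close>
  define H where "H x y = (if x = y then 1 else 0) - w x * cnj (w y) / N" for x y
  have cN: "cnj N = N" by (simp add: N_def)
  have "isometry_on X X H" unfolding isometry_on_def
  proof (intro ballI)
    fix y y' assume y: "y \<in> X" "y' \<in> X"
    define c where "c = w y * cnj (w y') / N\<^sup>2"
    have "(\<Sum>x\<in>X. cnj (H x y) * H x y') =
      (\<Sum>x\<in>X. (if x = y then (if x = y' then 1 else 0) - w x * cnj (w y') / N else 0)
          - (if x = y' then cnj (w x) * w y / N else 0) + c * (cnj (w x) * w x))"
      by (intro sum.cong refl) (auto simp: H_def c_def cN algebra_simps power2_eq_square)
    also have "\<dots> = (if y = y' then 1 else 0) - w y * cnj (w y') / N - cnj (w y') * w y / N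
         + c * (2 * N)"
      using fin y by (simp add: sum.distrib sum_subtractf sum_distrib_left[symmetric] ww)
    also have "\<dots> = (if y = y' then 1 else 0)" using N0 by (simp add: c_def power2_eq_square)
    finally show "(\<Sum>x\<in>X. cnj (H x y) * H x y') = (if y = y' then 1 else 0)" .
  qed
  then have "unitary_on X X H" using fin by (intro isometry_on_unitary) auto
  \<comment> \<open>Since \<open>w z\<close> is - \<omega> N, the reflection sends \<omega> times
    the basis vector at \<open>z\<close> to \<open>u\<close>; the phase claimed in the statement is
    therefore \<open>cnj \<omega>\<close>.\<close>
  moreover have "H x z = cnj \<omega> * u x" for x
  proof -
    have "H x z = (if x = z then 1 else 0) + w x * cnj \<omega>"
      using N0 by (simp add: H_def wz cN)
    then show ?thesis using \<omega>\<omega> by (cases "x = z") (simp_all add: w_def algebra_simps)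
  qed
  ultimately show ?thesis using \<omega>(1) by (metis complex_mod_cnj)
qed


text \<open>Deflation by one eigenvector: in a Householder basis that contains a unit eigenvector as
  column \<open>z\<close>, row and column \<open>z\<close> of the matrix vanish off the diagonal,
  and the induction hypothesis applies to the labels \<open>X - {z}\<close>. The Householder basis
  keeps \<open>X\<close> itself as its label set.\<close>

lemma spectral_theorem:
  fixes \<rho> :: "'a \<Rightarrow> 'a \<Rightarrow> complex"
  assumes "finite X" "\<And>x y. x \<in> X \<Longrightarrow> y \<in> X \<Longrightarrow> \<rho> y x = cnj (\<rho> x y)"
  shows "\<exists>U p. unitary_on X X U \<and>
     (\<forall>x\<in>X. \<forall>y\<in>X. \<rho> x y = (\<Sum>k\<in>X. U x k * complex_of_real (p k) * cnj (U y k)))"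
  using assms
proof (induction X arbitrary: \<rho> rule: finite_psubset_induct)
  case (psubset X)
  note fin = \<open>finite X\<close> and herm = psubset.prems
  show ?case
  proof (cases "X = {}")
    case True then show ?thesis by (simp add: unitary_on_def)
  next
    case False
    then obtain z where z: "z \<in> X" by auto
    obtain u \<kappa> where u: "unit_vector X u" and ev: "\<forall>x\<in>X. (\<Sum>y\<in>X. \<rho> x y * u y) = \<kappa> * u x"
      using exists_unit_eigenvector[OF fin False] by blast
    obtain H \<omega> where H: "unitary_on X X H" and Hz: "\<And>x. x \<in> X \<Longrightarrow> H x z = \<omega> * u x"
      using householder[OF fin z u] by blast
    have isoH: "isometry_on X X H" using H by (rule unitary_on_isometry)
    have H': "(\<Sum>k\<in>X. H x k * cnj (H y k)) = (if x = y then 1 else 0)" if "x \<in> X" "y \<in> X" for x y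
      using H that by (simp add: unitary_on_def)
    define \<sigma> where "\<sigma> k l = (\<Sum>x\<in>X. \<Sum>y\<in>X. cnj (H x k) * \<rho> x y * H y l)" for k l
    have \<sigma>_herm: "\<sigma> l k = cnj (\<sigma> k l)" if "k \<in> X" "l \<in> X" for k l
    proof -
      have "cnj (\<sigma> k l) = (\<Sum>x\<in>X. \<Sum>y\<in>X. cnj (H y l) * \<rho> y x * H x k)"
        unfolding \<sigma>_def cnj_sum by (intro sum.cong refl) (simp add: herm[symmetric] mult_ac)
      also have "\<dots> = \<sigma> l k" unfolding \<sigma>_def by (rule sum.swap)
      finally show ?thesis ..
    qed
    have \<sigma>z: "\<sigma> k z = (if k = z then \<kappa> else 0)" if k: "k \<in> X" for k
    proof -
      have "\<sigma> k z = (\<Sum>x\<in>X. cnj (H x k) * \<omega> * (\<Sum>y\<in>X. \<rho> x y * u y))"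
        unfolding \<sigma>_def by (intro sum.cong refl) (simp add: Hz sum_distrib_left mult_ac)
      also have "\<dots> = (\<Sum>x\<in>X. \<kappa> * (cnj (H x k) * H x z))"
        using ev by (intro sum.cong refl) (simp add: Hz mult_ac)
      also have "\<dots> = (if k = z then \<kappa> else 0)"
        using isometry_onD[OF isoH k z] by (simp add: sum_distrib_left[symmetric])
      finally show ?thesis .
    qed
    \<comment> \<open>A diagonal entry of a Hermitian matrix is real; hence the weight
      \<open>Re \<kappa>\<close> in \<open>q\<close> below.\<close>
    have \<kappa>: "cnj \<kappa> = \<kappa>" using \<sigma>_herm[OF z z] \<sigma>z[OF z] by metis
    have z\<sigma>: "\<sigma> z k = (if k = z then \<kappa> else 0)" if k: "k \<in> X" for k
      unfolding \<sigma>_herm[OF k z] \<sigma>z[OF k] using \<kappa> by simp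
    define Y where "Y = X - {z}"
    have Y: "Y \<subset> X" "X = insert z Y" "z \<notin> Y" "finite Y" using z fin by (auto simp: Y_def)
    have "\<exists>U p. unitary_on Y Y U \<and>
        (\<forall>x\<in>Y. \<forall>y\<in>Y. \<sigma> x y = (\<Sum>k\<in>Y. U x k * complex_of_real (p k) * cnj (U y k)))"
      by (rule psubset.IH[OF Y(1)], rule \<sigma>_herm) (use Y(2) in auto)
    then obtain V p where V: "unitary_on Y Y V"
      and \<sigma>V: "\<And>k l. k \<in> Y \<Longrightarrow> l \<in> Y \<Longrightarrow> \<sigma> k l = (\<Sum>i\<in>Y. V k i * complex_of_real (p i) * cnj (V l i))"
      by blast
    \<comment> \<open>\<open>V\<close> bordered by a 1 at \<open>z\<close>; the eigenbasis of \<rho>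
      will be the matrix product of \<open>H\<close> and \<open>W\<close>.\<close>
    define W where "W k l = (if k = z \<or> l = z then (if k = l then 1 else 0) else V k l)" for k l
    define q where "q = p(z := Re \<kappa>)"
    have re: "complex_of_real (Re \<kappa>) = \<kappa>" using \<kappa> by (simp add: complex_eq_iff)
    have Yz: "i \<noteq> z" if "i \<in> Y" for i using that Y by auto
    have isoW: "isometry_on X X W" unfolding isometry_on_def
    proof (intro ballI)
      fix y y' assume y: "y \<in> X" "y' \<in> X"
      have "(\<Sum>x\<in>Y. cnj (W x y) * W x y') = (if y = z \<or> y' = z then 0 else if y = y' then 1 else 0)"
      proof (cases "y = z \<or> y' = z")
        case True
        then show ?thesis by (intro trans[OF sum.neutral]) (auto simp: W_def Yz)
      next
        case False
        then have "(\<Sum>x\<in>Y. cnj (W x y) * W x y') = (\<Sum>x\<in>Y. cnj (V x y) * V x y')"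
          by (intro sum.cong refl) (auto simp: W_def Yz)
        then show ?thesis
          using False y Y(2) isometry_onD[OF unitary_on_isometry[OF V]] by auto
      qed
      then show "(\<Sum>x\<in>X. cnj (W x y) * W x y') = (if y = y' then 1 else 0)"
        using Y by (auto simp: W_def)
    qed
    have \<sigma>W: "\<sigma> k l = (\<Sum>i\<in>X. W k i * complex_of_real (q i) * cnj (W l i))"
      if kl: "k \<in> X" "l \<in> X" for k l
    proof -
      have "(\<Sum>i\<in>Y. W k i * complex_of_real (q i) * cnj (W l i)) = (if k = z \<or> l = z then 0 else \<sigma> k l)"
      proof (cases "k = z \<or> l = z")
        case True
        then show ?thesis using Y(3) by (intro trans[OF sum.neutral]) (auto simp: W_def Yz)
      next
        case False
        then have "\<sigma> k l = (\<Sum>i\<in>Y. V k i * complex_of_real (p i) * cnj (V l i))"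
          using kl Y(2) \<sigma>V by auto
        also have "\<dots> = (\<Sum>i\<in>Y. W k i * complex_of_real (q i) * cnj (W l i))"
          using False by (intro sum.cong refl) (auto simp: W_def q_def Yz)
        finally show ?thesis using False by simp
      qed
      then show ?thesis
        using Y kl by (auto simp: W_def q_def re \<sigma>z z\<sigma>)
    qed
    define U where "U x k = (\<Sum>l\<in>X. H x l * W l k)" for x k
    have "unitary_on X X U"
      unfolding U_def by (intro isometry_on_unitary isometry_on_mult[OF fin fin fin isoH isoW] fin refl)
    moreover have "\<rho> x y = (\<Sum>k\<in>X. U x k * complex_of_real (q k) * cnj (U y k))"
      if xy: "x \<in> X" "y \<in> X" for x y
    proof -
      have "(\<Sum>k\<in>X. U x k * complex_of_real (q k) * cnj (U y k))
          = (\<Sum>k\<in>X. \<Sum>a\<in>X. \<Sum>b\<in>X. (H x a * cnj (H y b)) * (W a k * complex_of_real (q k) * cnj (W b k)))"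
        unfolding U_def cnj_sum sum_distrib_left sum_distrib_right
        by (rule sum.cong[OF refl], subst sum.swap) (simp add: mult_ac)
      also have "\<dots> = (\<Sum>a\<in>X. \<Sum>b\<in>X. \<Sum>k\<in>X. (H x a * cnj (H y b)) * (W a k * complex_of_real (q k) * cnj (W b k)))"
        by (subst sum.swap) (intro sum.cong refl sum.swap)
      also have "\<dots> = (\<Sum>a\<in>X. \<Sum>b\<in>X. (H x a * cnj (H y b)) * \<sigma> a b)"
        by (simp add: sum_distrib_left[symmetric] \<sigma>W)
      also have "\<dots> = (\<Sum>a\<in>X. \<Sum>b\<in>X. \<Sum>s\<in>X. \<Sum>t\<in>X. (H x a * cnj (H s a)) * (H t b * cnj (H y b)) * \<rho> s t)"
        unfolding \<sigma>_def sum_distrib_left by (simp add: mult_ac)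
      also have "\<dots> = (\<Sum>a\<in>X. \<Sum>s\<in>X. \<Sum>b\<in>X. \<Sum>t\<in>X. (H x a * cnj (H s a)) * (H t b * cnj (H y b)) * \<rho> s t)"
        by (intro sum.cong refl sum.swap)
      also have "\<dots> = (\<Sum>s\<in>X. \<Sum>a\<in>X. \<Sum>t\<in>X. \<Sum>b\<in>X. (H x a * cnj (H s a)) * (H t b * cnj (H y b)) * \<rho> s t)"
        by (subst sum.swap) (intro sum.cong refl sum.swap)
      also have "\<dots> = (\<Sum>s\<in>X. \<Sum>t\<in>X. \<Sum>a\<in>X. \<Sum>b\<in>X. (H x a * cnj (H s a)) * (H t b * cnj (H y b)) * \<rho> s t)"
        by (intro sum.cong refl sum.swap)
      also have "\<dots> = (\<Sum>s\<in>X. \<Sum>t\<in>X. (\<Sum>a\<in>X. H x a * cnj (H s a)) * (\<Sum>b\<in>X. H t b * cnj (H y b)) * \<rho> s t)"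
        by (simp only: sum_product) (simp only: sum_distrib_right)
      also have "\<dots> = (\<Sum>s\<in>X. \<Sum>t\<in>X. if s = x then if t = y then \<rho> s t else 0 else 0)"
        using xy by (intro sum.cong refl) (auto simp: H')
      also have "\<dots> = (\<Sum>s\<in>X. if s = x then \<rho> s y else 0)"
        using xy fin by (intro sum.cong refl) auto
      also have "\<dots> = \<rho> x y" using xy fin by simp
      finally show ?thesis ..
    qed
    ultimately show ?thesis by blast
  qed
qed

section \<open>Functions of a density matrix and its entropy\<close>

text \<open>The overlaps \<open>W\<close> of the two families intertwine the weights, as stated in
  \<open>qW\<close>. Where \<open>W z k\<close> is nonzero the weights agree, so \<open>f\<close>
  may be applied to both sides. The condition \<open>f 0 = 0\<close> compensates for the columns of
  \<open>V\<close> not spanning the whole space.\<close>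

lemma isometric_decomposition_fun_unique:
  fixes V :: "'a \<Rightarrow> 'k \<Rightarrow> complex" and p :: "'k \<Rightarrow> real" and f :: "real \<Rightarrow> real"
  assumes fin: "finite X" "finite Z" "finite K"
    and U: "unitary_on X Z U" and V: "isometry_on X K V" and f0: "f 0 = 0"
    and eq: "\<And>x y. x \<in> X \<Longrightarrow> y \<in> X \<Longrightarrow>
       (\<Sum>z\<in>Z. U x z * complex_of_real (q z) * cnj (U y z)) =
       (\<Sum>k\<in>K. V x k * complex_of_real (p k) * cnj (V y k))"
    and xy: "x \<in> X" "y \<in> X"
  shows "(\<Sum>z\<in>Z. U x z * complex_of_real (f (q z)) * cnj (U y z)) =
       (\<Sum>k\<in>K. V x k * complex_of_real (f (p k)) * cnj (V y k))"
proof -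
  define W where "W z k = (\<Sum>x\<in>X. cnj (U x z) * V x k)" for z k
  note isoU = isometry_onD[OF unitary_on_isometry[OF U]]
  have left: "complex_of_real (q z) * cnj (U y z) = (\<Sum>k\<in>K. W z k * complex_of_real (p k) * cnj (V y k))"
    if z: "z \<in> Z" and y: "y \<in> X" for z y
  proof -
    have "(\<Sum>k\<in>K. W z k * complex_of_real (p k) * cnj (V y k))
        = (\<Sum>x\<in>X. cnj (U x z) * (\<Sum>k\<in>K. V x k * complex_of_real (p k) * cnj (V y k)))"
      unfolding W_def sum_distrib_left sum_distrib_right by (subst sum.swap) (simp add: mult_ac)
    also have "\<dots> = (\<Sum>x\<in>X. \<Sum>z'\<in>Z. (cnj (U x z) * U x z') * (complex_of_real (q z') * cnj (U y z')))"
      using y by (intro sum.cong refl, subst eq[symmetric]) (auto simp: sum_distrib_left mult_ac)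
    also have "\<dots> = (\<Sum>z'\<in>Z. (\<Sum>x\<in>X. cnj (U x z) * U x z') * (complex_of_real (q z') * cnj (U y z')))"
      by (subst sum.swap) (simp add: sum_distrib_right)
    also have "\<dots> = (\<Sum>z'\<in>Z. if z = z' then complex_of_real (q z') * cnj (U y z') else 0)"
      using z by (intro sum.cong refl) (auto simp: isoU)
    also have "\<dots> = complex_of_real (q z) * cnj (U y z)" using z fin by simp
    finally show ?thesis ..
  qed
  have qW: "complex_of_real (q z) * W z k = W z k * complex_of_real (p k)"
    if z: "z \<in> Z" and k: "k \<in> K" for z k
  proof -
    have "complex_of_real (q z) * W z k = (\<Sum>y\<in>X. (complex_of_real (q z) * cnj (U y z)) * V y k)"
      unfolding W_def sum_distrib_left by (simp add: mult_ac)
    also have "\<dots> = (\<Sum>y\<in>X. \<Sum>k'\<in>K. W z k' * complex_of_real (p k') * (cnj (V y k') * V y k))"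
      using z by (intro sum.cong refl) (simp add: left sum_distrib_left mult_ac)
    also have "\<dots> = (\<Sum>k'\<in>K. W z k' * complex_of_real (p k') * (\<Sum>y\<in>X. cnj (V y k') * V y k))"
      by (subst sum.swap) (simp add: sum_distrib_left)
    also have "\<dots> = (\<Sum>k'\<in>K. if k' = k then W z k' * complex_of_real (p k') else 0)"
      using k by (intro sum.cong refl) (auto simp: isometry_onD[OF V])
    also have "\<dots> = W z k * complex_of_real (p k)" using k fin by simp
    finally show ?thesis .
  qed
  have fW: "W z k * complex_of_real (f (p k)) = complex_of_real (f (q z)) * W z k"
    if "z \<in> Z" "k \<in> K" for z k
    using qW[OF that] by (cases "W z k = 0") (auto simp: mult.commute)
  have VW: "V x k = (\<Sum>z\<in>Z. U x z * W z k)" if "x \<in> X" for x k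
  proof -
    have "(\<Sum>z\<in>Z. U x z * W z k) = (\<Sum>x'\<in>X. (\<Sum>z\<in>Z. U x z * cnj (U x' z)) * V x' k)"
      unfolding W_def sum_distrib_left sum_distrib_right by (subst sum.swap) (simp add: mult_ac)
    also have "\<dots> = (\<Sum>x'\<in>X. if x = x' then V x' k else 0)"
      using U that by (intro sum.cong refl) (auto simp: unitary_on_def)
    finally show ?thesis using that fin by simp
  qed
  have "(\<Sum>k\<in>K. V x k * complex_of_real (f (p k)) * cnj (V y k))
      = (\<Sum>k\<in>K. \<Sum>z\<in>Z. U x z * (W z k * complex_of_real (f (p k))) * cnj (V y k))"
    using xy by (simp add: VW sum_distrib_right sum_distrib_left mult_ac)
  also have "\<dots> = (\<Sum>k\<in>K. \<Sum>z\<in>Z. U x z * (complex_of_real (f (q z)) * W z k) * cnj (V y k))"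
    by (intro sum.cong refl) (simp add: fW)
  also have "\<dots> = (\<Sum>z\<in>Z. U x z * (complex_of_real (f (q z)) * (\<Sum>k\<in>K. W z k * cnj (V y k))))"
    by (subst sum.swap) (simp add: sum_distrib_left mult_ac)
  also have "\<dots> = (\<Sum>z\<in>Z. U x z * (complex_of_real (f (q z)) * cnj (U y z)))"
  proof (intro sum.cong refl)
    fix z assume z: "z \<in> Z"
    show "U x z * (complex_of_real (f (q z)) * (\<Sum>k\<in>K. W z k * cnj (V y k)))
        = U x z * (complex_of_real (f (q z)) * cnj (U y z))"
    \<comment> \<open>W V^dagger and U^dagger are known to agree only in rows with nonzero
      \<open>q z\<close>, by cancelling this factor in \<open>left\<close>; in the other rows
      \<open>f (q z)\<close> is 0.\<close>
    proof (cases "q z = 0")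
      case True then show ?thesis by (simp add: f0)
    next
      case False
      have "complex_of_real (q z) * cnj (U y z) = (\<Sum>k\<in>K. complex_of_real (q z) * W z k * cnj (V y k))"
        using z xy by (simp add: left qW)
      also have "\<dots> = complex_of_real (q z) * (\<Sum>k\<in>K. W z k * cnj (V y k))"
        by (simp add: sum_distrib_left mult_ac)
      finally show ?thesis using False by simp
    qed
  qed
  finally show ?thesis by (simp add: mult.assoc)
qed

text \<open>An eigenbasis for \<open>SOME\<close> to choose exists by the spectral theorem, and the
  value does not depend on the choice; any orthonormal family with real weights may replace
  it.\<close>

lemma matrix_fun_isometric_decomposition:
  assumes fin: "finite X" "finite K" and V: "isometry_on X K V" and f0: "f 0 = 0"
    and \<rho>: "\<And>x y. x \<in> X \<Longrightarrow> y \<in> X \<Longrightarrow> \<rho> x y = (\<Sum>k\<in>K. V x k * complex_of_real (p k) * cnj (V y k))"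
    and xy: "x \<in> X" "y \<in> X"
  shows "matrix_fun X f \<rho> x y = (\<Sum>k\<in>K. V x k * complex_of_real (f (p k)) * cnj (V y k))"
proof -
  let ?P = "\<lambda>\<sigma>. \<exists>U q. unitary_on X X U \<and>
     (\<forall>x\<in>X. \<forall>y\<in>X. \<rho> x y = (\<Sum>k\<in>X. U x k * complex_of_real (q k) * cnj (U y k))) \<and>
     \<sigma> = (\<lambda>x y. \<Sum>k\<in>X. U x k * complex_of_real (f (q k)) * cnj (U y k))"
  have "\<rho> y x = cnj (\<rho> x y)" if "x \<in> X" "y \<in> X" for x y
    using that by (simp add: \<rho> mult_ac)
  then have "\<exists>\<sigma>. ?P \<sigma>" using spectral_theorem[OF fin(1), of \<rho>] by blast
  then have "?P (matrix_fun X f \<rho>)" unfolding matrix_fun_def by (rule someI_ex)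
  then obtain U q where U: "unitary_on X X U"
    and \<rho>U: "\<forall>x\<in>X. \<forall>y\<in>X. \<rho> x y = (\<Sum>k\<in>X. U x k * complex_of_real (q k) * cnj (U y k))"
    and m: "matrix_fun X f \<rho> = (\<lambda>x y. \<Sum>k\<in>X. U x k * complex_of_real (f (q k)) * cnj (U y k))"
    by blast
  show ?thesis unfolding m
    by (rule isometric_decomposition_fun_unique[where f = f and U = U and V = V and q = q and p = p, OF fin(1) fin(1) fin(2) U V f0 _ xy])
       (use \<rho> \<rho>U in auto)
qed

lemma von_Neumann_entropy_isometric_decomposition:
  assumes fin: "finite X" "finite K" and V: "isometry_on X K V"
    and \<rho>: "\<And>x y. x \<in> X \<Longrightarrow> y \<in> X \<Longrightarrow> \<rho> x y = (\<Sum>k\<in>K. V x k * complex_of_real (p k) * cnj (V y k))"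
  shows "von_Neumann_entropy X \<rho> = - (\<Sum>k\<in>K. p k * ln (p k))"
proof -
  have "(\<Sum>x\<in>X. matrix_fun X (\<lambda>t. t * ln t) \<rho> x x)
      = (\<Sum>x\<in>X. \<Sum>k\<in>K. complex_of_real (p k * ln (p k)) * (cnj (V x k) * V x k))"
    by (intro sum.cong refl)
       (simp add: matrix_fun_isometric_decomposition[OF fin V _ \<rho>] mult_ac)
  also have "\<dots> = (\<Sum>k\<in>K. complex_of_real (p k * ln (p k)) * (\<Sum>x\<in>X. cnj (V x k) * V x k))"
    by (subst sum.swap) (simp add: sum_distrib_left)
  also have "\<dots> = complex_of_real (\<Sum>k\<in>K. p k * ln (p k))"
    by (simp add: isometry_onD[OF V])
  finally show ?thesis by (simp only: von_Neumann_entropy_def Re_complex_of_real)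
qed

text \<open>Diagonalising M M^dagger by \<open>U\<close> makes the rows of U^dagger M orthogonal,
  with squared norms equal to the eigenvalues; normalising the nonzero rows gives the second
  family.\<close>

lemma schmidt_decomposition:
  fixes M :: "'a \<Rightarrow> 'b \<Rightarrow> complex"
  assumes fin: "finite X" "finite Y" and unit: "unit_vector (X \<times> Y) (\<lambda>(x, y). M x y)"
  shows "\<exists>K p u v. K \<subseteq> X \<and> isometry_on X K u \<and> isometry_on Y K v \<and> (\<forall>k\<in>K. p k > 0) \<and> sum p K = 1 \<and>
    (\<forall>x\<in>X. \<forall>y\<in>Y. M x y = (\<Sum>k\<in>K. complex_of_real (sqrt (p k)) * u x k * v y k))"
proof -
  define \<rho> where "\<rho> x x' = (\<Sum>y\<in>Y. M x y * cnj (M x' y))" for x x'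
  have "\<rho> y x = cnj (\<rho> x y)" for x y by (simp add: \<rho>_def mult.commute)
  then have "\<exists>U p. unitary_on X X U \<and>
     (\<forall>x\<in>X. \<forall>y\<in>X. \<rho> x y = (\<Sum>k\<in>X. U x k * complex_of_real (p k) * cnj (U y k)))"
    by (intro spectral_theorem[OF fin(1)])
  then obtain U p where U: "unitary_on X X U"
    and \<rho>U: "\<And>x y. x \<in> X \<Longrightarrow> y \<in> X \<Longrightarrow> \<rho> x y = (\<Sum>k\<in>X. U x k * complex_of_real (p k) * cnj (U y k))"
    by blast
  note isoU = isometry_onD[OF unitary_on_isometry[OF U]]
  define N where "N k y = (\<Sum>x\<in>X. cnj (U x k) * M x y)" for k y
  have NN: "(\<Sum>y\<in>Y. N k y * cnj (N l y)) = (if k = l then complex_of_real (p k) else 0)"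
    if kl: "k \<in> X" "l \<in> X" for k l
  proof -
    have "(\<Sum>y\<in>Y. N k y * cnj (N l y))
        = (\<Sum>y\<in>Y. \<Sum>x\<in>X. \<Sum>x'\<in>X. (cnj (U x k) * U x' l) * (M x y * cnj (M x' y)))"
      unfolding N_def cnj_sum sum_product by (simp add: mult_ac)
    also have "\<dots> = (\<Sum>x\<in>X. \<Sum>x'\<in>X. \<Sum>y\<in>Y. (cnj (U x k) * U x' l) * (M x y * cnj (M x' y)))"
      by (subst sum.swap) (intro sum.cong refl sum.swap)
    also have "\<dots> = (\<Sum>x\<in>X. \<Sum>x'\<in>X. (cnj (U x k) * U x' l) * \<rho> x x')"
      by (simp add: \<rho>_def sum_distrib_left)
    also have "\<dots> = (\<Sum>x\<in>X. \<Sum>x'\<in>X. \<Sum>i\<in>X. complex_of_real (p i) * (cnj (U x k) * U x i) * (cnj (U x' i) * U x' l))"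
      by (intro sum.cong refl) (simp add: \<rho>U sum_distrib_left mult_ac)
    also have "\<dots> = (\<Sum>x\<in>X. \<Sum>i\<in>X. \<Sum>x'\<in>X. complex_of_real (p i) * (cnj (U x k) * U x i) * (cnj (U x' i) * U x' l))"
      by (intro sum.cong refl sum.swap)
    also have "\<dots> = (\<Sum>i\<in>X. \<Sum>x\<in>X. \<Sum>x'\<in>X. complex_of_real (p i) * (cnj (U x k) * U x i) * (cnj (U x' i) * U x' l))"
      by (rule sum.swap)
    also have "\<dots> = (\<Sum>i\<in>X. complex_of_real (p i) * (\<Sum>x\<in>X. cnj (U x k) * U x i) * (\<Sum>x'\<in>X. cnj (U x' i) * U x' l))"
      by (simp only: mult.assoc sum_product) (simp only: sum_distrib_left mult.assoc)
    also have "\<dots> = (\<Sum>i\<in>X. if k = i then if i = l then complex_of_real (p i) else 0 else 0)"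
      using kl by (intro sum.cong refl) (auto simp: isoU)
    also have "\<dots> = (if k = l then complex_of_real (p k) else 0)" using kl fin by simp
    finally show ?thesis .
  qed
  \<comment> \<open>\<open>spectral_theorem\<close> gives only real eigenvalues; this identity shows
    that they are nonnegative and that rows with eigenvalue 0 vanish.\<close>
  have p: "p k = (\<Sum>y\<in>Y. (cmod (N k y))\<^sup>2)" if "k \<in> X" for k
  proof -
    have "complex_of_real (\<Sum>y\<in>Y. (cmod (N k y))\<^sup>2) = complex_of_real (p k)"
      using NN[OF that that] by (simp add: complex_norm_square del: of_real_power)
    then show ?thesis by (simp only: of_real_eq_iff)
  qed
  have p_nonneg: "p k \<ge> 0" if "k \<in> X" for k using p[OF that] by (simp add: sum_nonneg)
  have MN: "M x y = (\<Sum>k\<in>X. U x k * N k y)" if "x \<in> X" for x y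
  proof -
    have "(\<Sum>k\<in>X. U x k * N k y) = (\<Sum>x'\<in>X. (\<Sum>k\<in>X. U x k * cnj (U x' k)) * M x' y)"
      unfolding N_def sum_distrib_left sum_distrib_right by (subst sum.swap) (simp add: mult_ac)
    also have "\<dots> = (\<Sum>x'\<in>X. if x = x' then M x' y else 0)"
      using U that by (intro sum.cong refl) (auto simp: unitary_on_def)
    finally show ?thesis using that fin by simp
  qed
  have N0: "N k y = 0" if "k \<in> X" "p k = 0" "y \<in> Y" for k y
    using that p[OF that(1)] fin by (simp add: sum_nonneg_eq_0_iff)
  \<comment> \<open>Zero weights are dropped, which permits the division in \<open>v\<close> and,
    later, the logarithms of the weights.\<close>
  define K where "K = {k\<in>X. p k > 0}"
  have K: "K \<subseteq> X" "finite K" using fin by (auto simp: K_def)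
  define v where "v y k = N k y / complex_of_real (sqrt (p k))" for y k
  have v: "isometry_on Y K v" unfolding isometry_on_def
  proof (intro ballI)
    fix k l assume kl: "k \<in> K" "l \<in> K"
    then have pos: "p k > 0" "p l > 0" "k \<in> X" "l \<in> X" by (auto simp: K_def)
    have "(\<Sum>y\<in>Y. cnj (v y k) * v y l)
        = (\<Sum>y\<in>Y. N l y * cnj (N k y)) / (complex_of_real (sqrt (p k)) * complex_of_real (sqrt (p l)))"
      by (simp add: v_def sum_divide_distrib mult.commute)
    also have "\<dots> = (if k = l then 1 else 0)"
      using pos NN[of l k] by (auto simp: of_real_mult[symmetric] simp del: of_real_mult)
    finally show "(\<Sum>y\<in>Y. cnj (v y k) * v y l) = (if k = l then 1 else 0)" .
  qed
  have M: "M x y = (\<Sum>k\<in>K. complex_of_real (sqrt (p k)) * U x k * v y k)"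
    if xy: "x \<in> X" "y \<in> Y" for x y
  proof -
    have "M x y = (\<Sum>k\<in>K. U x k * N k y)"
      unfolding MN[OF xy(1)] using xy fin p_nonneg N0
      by (intro sum.mono_neutral_right) (auto simp: K_def order_less_le)
    also have "\<dots> = (\<Sum>k\<in>K. complex_of_real (sqrt (p k)) * U x k * v y k)"
      by (intro sum.cong refl) (auto simp: v_def K_def)
    finally show ?thesis .
  qed
  have "complex_of_real (\<Sum>k\<in>X. p k) = (\<Sum>k\<in>X. \<Sum>x\<in>X. complex_of_real (p k) * (cnj (U x k) * U x k))"
    unfolding sum_distrib_left[symmetric] by (simp add: isoU)
  also have "\<dots> = (\<Sum>x\<in>X. \<rho> x x)"
    by (subst sum.swap) (simp add: \<rho>U mult_ac)
  also have "\<dots> = complex_of_real (\<Sum>x\<in>X. \<Sum>y\<in>Y. (cmod (M x y))\<^sup>2)"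
    by (simp add: \<rho>_def complex_norm_square del: of_real_power)
  also have "(\<Sum>x\<in>X. \<Sum>y\<in>Y. (cmod (M x y))\<^sup>2) = 1"
    using unit by (simp add: unit_vector_def sum.cartesian_product split_def)
  finally have "(\<Sum>k\<in>X. p k) = 1" by (simp only: of_real_eq_iff)
  moreover have "(\<Sum>k\<in>X. p k) = sum p K"
    using fin p_nonneg by (intro sum.mono_neutral_right) (auto simp: K_def order_less_le)
  ultimately have "sum p K = 1" by simp
  moreover have "isometry_on X K U" using unitary_on_isometry[OF U] K(1) by (rule isometry_on_subset)
  ultimately show ?thesis using K v M by (intro exI[of _ K] exI[of _ p] exI[of _ U] exI[of _ v]) (auto simp: K_def)
qed

section \<open>The Markov gap of a sum of triangle states\<close>

text \<open>By \<open>inj\<close>, distinct pairs (i, k) select distinct members of the orthonormal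
  product family of \<open>e\<close> and \<open>g\<close>. Different \<open>i\<close> thus use
  disjoint groups of product vectors, and \<open>one\<close> normalises each group. In the
  applications \<open>k\<close> is the pair index internal to the two merged parties.\<close>

lemma isometry_on_weighted_sum:
  fixes e :: "'a \<Rightarrow> 's \<Rightarrow> complex" and g :: "'b \<Rightarrow> 't \<Rightarrow> complex" and x :: "'i \<Rightarrow> 'k \<Rightarrow> real"
  assumes e: "isometry_on X E e" and g: "isometry_on Y F g"
    and fin: "\<And>i. i \<in> I \<Longrightarrow> finite (K i)"
    and E: "\<And>i k. i \<in> I \<Longrightarrow> k \<in> K i \<Longrightarrow> \<sigma> i k \<in> E"
    and F: "\<And>i k. i \<in> I \<Longrightarrow> k \<in> K i \<Longrightarrow> \<tau> i k \<in> F"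
    and pos: "\<And>i k. i \<in> I \<Longrightarrow> k \<in> K i \<Longrightarrow> 0 \<le> x i k"
    and one: "\<And>i. i \<in> I \<Longrightarrow> (\<Sum>k\<in>K i. x i k) = 1"
    and inj: "\<And>i k i' k'. i \<in> I \<Longrightarrow> k \<in> K i \<Longrightarrow> i' \<in> I \<Longrightarrow> k' \<in> K i' \<Longrightarrow>
       \<sigma> i k = \<sigma> i' k' \<Longrightarrow> \<tau> i k = \<tau> i' k' \<Longrightarrow> i = i' \<and> k = k'"
  shows "isometry_on (X \<times> Y) I
    (\<lambda>(a, b) i. \<Sum>k\<in>K i. complex_of_real (sqrt (x i k)) * (e a (\<sigma> i k) * g b (\<tau> i k)))"
  unfolding isometry_on_def
proof (intro ballI)
  fix i i' assume i: "i \<in> I" "i' \<in> I"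
  let ?s = "\<lambda>i k. complex_of_real (sqrt (x i k))"
  let ?t = "\<lambda>a b i k. ?s i k * (e a (\<sigma> i k) * g b (\<tau> i k))"
  have "(\<Sum>ab\<in>X \<times> Y. cnj ((case ab of (a, b) \<Rightarrow> \<lambda>i. \<Sum>k\<in>K i. ?t a b i k) i) *
           (case ab of (a, b) \<Rightarrow> \<lambda>i. \<Sum>k\<in>K i. ?t a b i k) i')
      = (\<Sum>a\<in>X. \<Sum>b\<in>Y. \<Sum>k\<in>K i. \<Sum>k'\<in>K i'. cnj (?t a b i k) * ?t a b i' k')"
    by (simp only: sum.cartesian_product' prod.case cnj_sum sum_product)
  also have "\<dots> = (\<Sum>k\<in>K i. \<Sum>k'\<in>K i'. \<Sum>a\<in>X. \<Sum>b\<in>Y. cnj (?t a b i k) * ?t a b i' k')"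
    by (simp only: sum.swap[of _ "K i" Y] sum.swap[of _ "K i'" Y]
        sum.swap[of _ "K i" X] sum.swap[of _ "K i'" X])
  also have "\<dots> = (\<Sum>k\<in>K i. \<Sum>k'\<in>K i'. ?s i k * ?s i' k' *
      ((\<Sum>a\<in>X. cnj (e a (\<sigma> i k)) * e a (\<sigma> i' k')) * (\<Sum>b\<in>Y. cnj (g b (\<tau> i k)) * g b (\<tau> i' k'))))"
    by (simp only: sum_product) (simp add: sum_distrib_left mult_ac)
  also have "\<dots> = (\<Sum>k\<in>K i. \<Sum>k'\<in>K i'. if i = i' \<and> k = k' then complex_of_real (x i k) else 0)"
    using i by (intro sum.cong refl)
      (auto simp: isometry_onD[OF e] isometry_onD[OF g] E F pos of_real_mult[symmetric]
         simp del: of_real_mult dest: inj)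
  also have "\<dots> = (if i = i' then 1 else 0)"
  proof (cases "i = i'")
    case True
    then have "(\<Sum>k\<in>K i. \<Sum>k'\<in>K i'. if i = i' \<and> k = k' then complex_of_real (x i k) else 0)
        = (\<Sum>k\<in>K i. complex_of_real (x i k))"
      using fin i by (intro sum.cong refl) auto
    then show ?thesis using True one[OF i(1)] by (simp add: of_real_sum[symmetric] del: of_real_sum)
  qed simp
  finally show "(\<Sum>ab\<in>X \<times> Y. cnj ((case ab of (a, b) \<Rightarrow> \<lambda>i. \<Sum>k\<in>K i. ?t a b i k) i) *
           (case ab of (a, b) \<Rightarrow> \<lambda>i. \<Sum>k\<in>K i. ?t a b i k) i') = (if i = i' then 1 else 0)" .
qed

lemma partial_trace_schmidt:
  assumes fin: "finite I" and g: "isometry_on Z I g" and w: "\<And>i. i \<in> I \<Longrightarrow> w i \<ge> 0"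
  shows "(\<Sum>c\<in>Z. (\<Sum>i\<in>I. complex_of_real (sqrt (w i)) * (f i * g c i)) *
            cnj (\<Sum>i\<in>I. complex_of_real (sqrt (w i)) * (f' i * g c i)))
       = (\<Sum>i\<in>I. f i * complex_of_real (w i) * cnj (f' i))"
proof -
  let ?s = "\<lambda>i. complex_of_real (sqrt (w i))"
  have "(\<Sum>c\<in>Z. (\<Sum>i\<in>I. ?s i * (f i * g c i)) * cnj (\<Sum>i\<in>I. ?s i * (f' i * g c i)))
      = (\<Sum>c\<in>Z. \<Sum>i\<in>I. \<Sum>j\<in>I. ?s i * ?s j * (f i * cnj (f' j)) * (cnj (g c j) * g c i))"
    unfolding cnj_sum sum_product by (simp add: mult_ac)
  also have "\<dots> = (\<Sum>i\<in>I. \<Sum>j\<in>I. \<Sum>c\<in>Z. ?s i * ?s j * (f i * cnj (f' j)) * (cnj (g c j) * g c i))"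
    by (subst sum.swap) (intro sum.cong refl sum.swap)
  also have "\<dots> = (\<Sum>i\<in>I. \<Sum>j\<in>I. if i = j then f i * complex_of_real (w i) * cnj (f' i) else 0)"
    unfolding sum_distrib_left[symmetric] using w
    by (intro sum.cong refl)
      (auto simp: isometry_onD[OF g] of_real_mult[symmetric] simp del: of_real_mult)
  also have "\<dots> = (\<Sum>i\<in>I. f i * complex_of_real (w i) * cnj (f' i))" using fin by simp
  finally show ?thesis .
qed

text \<open>Tracing out the orthonormal family \<open>g\<close> leaves a diagonal form in
  \<open>f\<close>, so the squared Schmidt coefficients \<open>w\<close> are the spectrum up to
  zeros.\<close>

lemma entropy_schmidt:
  assumes fin: "finite S" "finite I" and f: "isometry_on S I f" and g: "isometry_on Z I g"
    and w: "\<And>i. i \<in> I \<Longrightarrow> w i \<ge> 0"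
    and \<rho>: "\<And>s s'. s \<in> S \<Longrightarrow> s' \<in> S \<Longrightarrow> \<rho> s s' = (\<Sum>c\<in>Z. \<psi> s c * cnj (\<psi> s' c))"
    and \<psi>: "\<And>s c. s \<in> S \<Longrightarrow> c \<in> Z \<Longrightarrow> \<psi> s c = (\<Sum>i\<in>I. complex_of_real (sqrt (w i)) * (f s i * g c i))"
  shows "von_Neumann_entropy S \<rho> = - (\<Sum>i\<in>I. w i * ln (w i))"
proof (rule von_Neumann_entropy_isometric_decomposition[OF fin f])
  fix s s' assume s: "s \<in> S" "s' \<in> S"
  then have "\<rho> s s' = (\<Sum>c\<in>Z. (\<Sum>i\<in>I. complex_of_real (sqrt (w i)) * (f s i * g c i)) *
            cnj (\<Sum>i\<in>I. complex_of_real (sqrt (w i)) * (f s' i * g c i)))"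
    unfolding \<rho>[OF s] by (intro sum.cong refl) (simp only: \<psi>)
  also have "\<dots> = (\<Sum>i\<in>I. f s i * complex_of_real (w i) * cnj (f s' i))"
    by (rule partial_trace_schmidt[OF fin(2) g w])
  finally show "\<rho> s s' = (\<Sum>i\<in>I. f s i * complex_of_real (w i) * cnj (f s' i))" .
qed

section \<open>Spectra and entropies in Schmidt form\<close>

lemma sum_Sigma_Times:
  assumes "finite J" "\<And>j. j \<in> J \<Longrightarrow> finite (K j)" "\<And>j. j \<in> J \<Longrightarrow> finite (M j)"
  shows "(\<Sum>i\<in>(SIGMA j:J. K j \<times> M j). f i) = (\<Sum>j\<in>J. \<Sum>k\<in>K j. \<Sum>m\<in>M j. f (j, k, m))"
  using assms sum.Sigma[of J "\<lambda>j. K j \<times> M j" "\<lambda>j q. f (j, q)"]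
  by (simp add: sum.cartesian_product split_def)

text \<open>The chain rule of Shannon entropy: given \<open>j\<close>, the indices \<open>k\<close>
  and \<open>l\<close> are independent, so the entropy is that of \<open>p\<close> plus two
  conditional averages. All spectra below have this form.\<close>

lemma sum_product_ln:
  fixes p :: "'j \<Rightarrow> real" and x :: "'j \<Rightarrow> 'k \<Rightarrow> real" and y :: "'j \<Rightarrow> 'l \<Rightarrow> real"
  assumes fin: "finite J" "\<And>j. j \<in> J \<Longrightarrow> finite (K j)" "\<And>j. j \<in> J \<Longrightarrow> finite (L j)"
    and p: "\<And>j. j \<in> J \<Longrightarrow> p j \<ge> 0"
    and x: "\<And>j k. j \<in> J \<Longrightarrow> k \<in> K j \<Longrightarrow> x j k > 0" "\<And>j. j \<in> J \<Longrightarrow> sum (x j) (K j) = 1"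
    and y: "\<And>j l. j \<in> J \<Longrightarrow> l \<in> L j \<Longrightarrow> y j l > 0" "\<And>j. j \<in> J \<Longrightarrow> sum (y j) (L j) = 1"
  shows "(\<Sum>(j, k, l)\<in>(SIGMA j:J. K j \<times> L j). (p j * x j k * y j l) * ln (p j * x j k * y j l))
     = (\<Sum>j\<in>J. p j * ln (p j)) + (\<Sum>j\<in>J. p j * (\<Sum>k\<in>K j. x j k * ln (x j k)))
       + (\<Sum>j\<in>J. p j * (\<Sum>l\<in>L j. y j l * ln (y j l)))"
proof -
  have "(\<Sum>k\<in>K j. \<Sum>l\<in>L j. (p j * x j k * y j l) * ln (p j * x j k * y j l))
     = p j * ln (p j) + p j * (\<Sum>k\<in>K j. x j k * ln (x j k)) + p j * (\<Sum>l\<in>L j. y j l * ln (y j l))"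
    if j: "j \<in> J" for j
  proof -
    have "(\<Sum>k\<in>K j. \<Sum>l\<in>L j. (p j * x j k * y j l) * ln (p j * x j k * y j l))
      = (\<Sum>k\<in>K j. \<Sum>l\<in>L j. p j * ln (p j) * (x j k * y j l) + p j * ((x j k * ln (x j k)) * y j l)
           + p j * (x j k * (y j l * ln (y j l))))"
    proof (intro sum.cong refl)
      fix k l assume kl: "k \<in> K j" "l \<in> L j"
      show "(p j * x j k * y j l) * ln (p j * x j k * y j l) = p j * ln (p j) * (x j k * y j l)
          + p j * ((x j k * ln (x j k)) * y j l) + p j * (x j k * (y j l * ln (y j l)))"
      \<comment> \<open>\<open>ln\<close> splits only for positive factors; a sector of weight 0
        contributes 0 on both sides.\<close>
      proof (cases "p j = 0")
        case False
        then have "p j > 0" using p[OF j] by simp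
        then have "ln (p j * x j k * y j l) = ln (p j) + ln (x j k) + ln (y j l)"
          using x(1)[OF j kl(1)] y(1)[OF j kl(2)] by (simp add: ln_mult_pos)
        then show ?thesis by (simp add: algebra_simps)
      qed simp
    qed
    also have "\<dots> = p j * ln (p j) * (sum (x j) (K j) * sum (y j) (L j))
        + p j * ((\<Sum>k\<in>K j. x j k * ln (x j k)) * sum (y j) (L j))
        + p j * (sum (x j) (K j) * (\<Sum>l\<in>L j. y j l * ln (y j l)))"
      by (simp only: sum.distrib sum_product) (simp only: sum_distrib_left)
    finally show ?thesis using j by (simp add: x y)
  qed
  then show ?thesis using fin by (simp add: sum_Sigma_Times sum.distrib)
qed

text \<open>The index \<open>k\<close> labels the Schmidt basis shared by \<open>A\<^sub>R\<close> and \<open>B\<^sub>L\<close>, \<open>l\<close> the one of \<open>B\<^sub>R\<close> and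
  \<open>C\<^sub>L\<close>, and \<open>m\<close> the one of \<open>C\<^sub>R\<close> and \<open>A\<^sub>L\<close>. The families \<open>\<alpha>\<close>, \<open>\<beta>\<close>, \<open>\<gamma>\<close> are indexed by the block \<open>j\<close>,
  the right index and the left index, in this order.\<close>

locale schmidt_triangle =
  fixes X :: "'a set" and Y :: "'b set" and Z :: "'c set"
    and J :: "'j set" and K L M :: "'j \<Rightarrow> 'k set"
    and p :: "'j \<Rightarrow> real" and x y z :: "'j \<Rightarrow> 'k \<Rightarrow> real"
    and \<alpha> :: "'a \<Rightarrow> 'j \<times> 'k \<times> 'k \<Rightarrow> complex"
    and \<beta> :: "'b \<Rightarrow> 'j \<times> 'k \<times> 'k \<Rightarrow> complex"
    and \<gamma> :: "'c \<Rightarrow> 'j \<times> 'k \<times> 'k \<Rightarrow> complex"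
    and \<psi> :: "'a \<Rightarrow> 'b \<Rightarrow> 'c \<Rightarrow> complex"
  assumes fin: "finite X" "finite Y" "finite Z" "finite J"
      "\<And>j. j \<in> J \<Longrightarrow> finite (K j)" "\<And>j. j \<in> J \<Longrightarrow> finite (L j)" "\<And>j. j \<in> J \<Longrightarrow> finite (M j)"
    and \<alpha>: "isometry_on X (SIGMA j:J. K j \<times> M j) \<alpha>"
    and \<beta>: "isometry_on Y (SIGMA j:J. L j \<times> K j) \<beta>"
    and \<gamma>: "isometry_on Z (SIGMA j:J. M j \<times> L j) \<gamma>"
    and p: "\<And>j. j \<in> J \<Longrightarrow> p j \<ge> 0"
    and x: "\<And>j k. j \<in> J \<Longrightarrow> k \<in> K j \<Longrightarrow> x j k > 0" "\<And>j. j \<in> J \<Longrightarrow> sum (x j) (K j) = 1"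
    and y: "\<And>j l. j \<in> J \<Longrightarrow> l \<in> L j \<Longrightarrow> y j l > 0" "\<And>j. j \<in> J \<Longrightarrow> sum (y j) (L j) = 1"
    and z: "\<And>j m. j \<in> J \<Longrightarrow> m \<in> M j \<Longrightarrow> z j m > 0" "\<And>j. j \<in> J \<Longrightarrow> sum (z j) (M j) = 1"
    and \<psi>: "\<And>a b c. a \<in> X \<Longrightarrow> b \<in> Y \<Longrightarrow> c \<in> Z \<Longrightarrow> \<psi> a b c =
       (\<Sum>j\<in>J. \<Sum>k\<in>K j. \<Sum>l\<in>L j. \<Sum>m\<in>M j.
          complex_of_real (sqrt (p j) * sqrt (x j k) * sqrt (y j l) * sqrt (z j m)) *
          (\<alpha> a (j, k, m) * \<beta> b (j, l, k) * \<gamma> c (j, m, l)))"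
begin

text \<open>Schmidt vectors for the various cuts: \<Phi>, \<Theta>, \<Xi> live on AB, BC, AC,
  opposite to \<gamma>, \<alpha>, \<beta>. \<Omega> and \<Upsilon> live on AA* and BB* and belong to
  the canonical purification; there A is paired with A* through the index \<open>m\<close> formerly
  shared with C, and B with B* through \<open>l\<close>.\<close>

definition "\<Phi> = (\<lambda>(a, b) (j, m, l). \<Sum>k\<in>K j. complex_of_real (sqrt (x j k)) * (\<alpha> a (j, k, m) * \<beta> b (j, l, k)))"
definition "\<Theta> = (\<lambda>(b, c) (j, k, m). \<Sum>l\<in>L j. complex_of_real (sqrt (y j l)) * (\<beta> b (j, l, k) * \<gamma> c (j, m, l)))"
definition "\<Xi> = (\<lambda>(a, c) (j, l, k). \<Sum>m\<in>M j. complex_of_real (sqrt (z j m)) * (\<alpha> a (j, k, m) * \<gamma> c (j, m, l)))"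
definition "\<Omega> = (\<lambda>(a, a') (j, k, k'). \<Sum>m\<in>M j. complex_of_real (sqrt (z j m)) * (\<alpha> a (j, k, m) * cnj (\<alpha> a' (j, k', m))))"
definition "\<Upsilon> = (\<lambda>(b, b') (j, k, k'). \<Sum>l\<in>L j. complex_of_real (sqrt (y j l)) * (\<beta> b (j, l, k) * cnj (\<beta> b' (j, l, k'))))"

lemma isometry_\<Phi>: "isometry_on (X \<times> Y) (SIGMA j:J. M j \<times> L j) \<Phi>"
proof -
  have "isometry_on (X \<times> Y) (SIGMA j:J. M j \<times> L j)
    (\<lambda>(a, b) i. \<Sum>k\<in>K (fst i). complex_of_real (sqrt (x (fst i) k)) *
       (\<alpha> a (fst i, k, fst (snd i)) * \<beta> b (fst i, snd (snd i), k)))"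
    by (rule isometry_on_weighted_sum[OF \<alpha> \<beta>]) (auto simp: fin x less_imp_le)
  then show ?thesis by (simp add: \<Phi>_def split_def)
qed

lemma isometry_\<Theta>: "isometry_on (Y \<times> Z) (SIGMA j:J. K j \<times> M j) \<Theta>"
proof -
  have "isometry_on (Y \<times> Z) (SIGMA j:J. K j \<times> M j)
    (\<lambda>(b, c) i. \<Sum>l\<in>L (fst i). complex_of_real (sqrt (y (fst i) l)) *
       (\<beta> b (fst i, l, fst (snd i)) * \<gamma> c (fst i, snd (snd i), l)))"
    by (rule isometry_on_weighted_sum[OF \<beta> \<gamma>]) (auto simp: fin y less_imp_le)
  then show ?thesis by (simp add: \<Theta>_def split_def)
qed

lemma isometry_\<Xi>: "isometry_on (X \<times> Z) (SIGMA j:J. L j \<times> K j) \<Xi>"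
proof -
  have "isometry_on (X \<times> Z) (SIGMA j:J. L j \<times> K j)
    (\<lambda>(a, c) i. \<Sum>m\<in>M (fst i). complex_of_real (sqrt (z (fst i) m)) *
       (\<alpha> a (fst i, snd (snd i), m) * \<gamma> c (fst i, m, fst (snd i))))"
    by (rule isometry_on_weighted_sum[OF \<alpha> \<gamma>]) (auto simp: fin z less_imp_le)
  then show ?thesis by (simp add: \<Xi>_def split_def)
qed

lemma isometry_\<Omega>: "isometry_on (X \<times> X) (SIGMA j:J. K j \<times> K j) \<Omega>"
proof -
  have "isometry_on (X \<times> X) (SIGMA j:J. K j \<times> K j)
    (\<lambda>(a, a') i. \<Sum>m\<in>M (fst i). complex_of_real (sqrt (z (fst i) m)) *
       (\<alpha> a (fst i, fst (snd i), m) * cnj (\<alpha> a' (fst i, snd (snd i), m))))"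
    by (rule isometry_on_weighted_sum[OF \<alpha> isometry_on_cnj[OF \<alpha>]]) (auto simp: fin z less_imp_le)
  then show ?thesis by (simp add: \<Omega>_def split_def)
qed

lemma isometry_\<Upsilon>: "isometry_on (Y \<times> Y) (SIGMA j:J. K j \<times> K j) \<Upsilon>"
proof -
  have "isometry_on (Y \<times> Y) (SIGMA j:J. K j \<times> K j)
    (\<lambda>(b, b') i. \<Sum>l\<in>L (fst i). complex_of_real (sqrt (y (fst i) l)) *
       (\<beta> b (fst i, l, fst (snd i)) * cnj (\<beta> b' (fst i, l, snd (snd i)))))"
    by (rule isometry_on_weighted_sum[OF \<beta> isometry_on_cnj[OF \<beta>]]) (auto simp: fin y less_imp_le)
  then show ?thesis by (simp add: \<Upsilon>_def split_def)
qed

lemma \<psi>_C: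
  assumes "a \<in> X" "b \<in> Y" "c \<in> Z"
  shows "\<psi> a b c = (\<Sum>i\<in>(SIGMA j:J. M j \<times> L j).
     complex_of_real (sqrt (case i of (j, m, l) \<Rightarrow> p j * z j m * y j l)) * (\<Phi> (a, b) i * \<gamma> c i))"
proof -
  have "\<psi> a b c = (\<Sum>j\<in>J. \<Sum>m\<in>M j. \<Sum>l\<in>L j. \<Sum>k\<in>K j.
          complex_of_real (sqrt (p j) * sqrt (x j k) * sqrt (y j l) * sqrt (z j m)) *
          (\<alpha> a (j, k, m) * \<beta> b (j, l, k) * \<gamma> c (j, m, l)))"
    unfolding \<psi>[OF assms]
    by (rule sum.cong[OF refl]) (simp only: sum.swap[of _ "K _" "L _"] sum.swap[of _ "K _" "M _"] sum.swap[of _ "L _" "M _"])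
  then show ?thesis
    by (simp add: sum_Sigma_Times fin \<Phi>_def real_sqrt_mult sum_distrib_left sum_distrib_right mult_ac)
qed

lemma \<psi>_A:
  assumes "a \<in> X" "b \<in> Y" "c \<in> Z"
  shows "\<psi> a b c = (\<Sum>i\<in>(SIGMA j:J. K j \<times> M j).
     complex_of_real (sqrt (case i of (j, k, m) \<Rightarrow> p j * x j k * z j m)) * (\<alpha> a i * \<Theta> (b, c) i))"
proof -
  have "\<psi> a b c = (\<Sum>j\<in>J. \<Sum>k\<in>K j. \<Sum>m\<in>M j. \<Sum>l\<in>L j.
          complex_of_real (sqrt (p j) * sqrt (x j k) * sqrt (y j l) * sqrt (z j m)) *
          (\<alpha> a (j, k, m) * \<beta> b (j, l, k) * \<gamma> c (j, m, l)))"
    unfolding \<psi>[OF assms] by (intro sum.cong refl sum.swap)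
  then show ?thesis
    by (simp add: sum_Sigma_Times fin \<Theta>_def real_sqrt_mult sum_distrib_left sum_distrib_right mult_ac)
qed

lemma \<psi>_B:
  assumes "a \<in> X" "b \<in> Y" "c \<in> Z"
  shows "\<psi> a b c = (\<Sum>i\<in>(SIGMA j:J. L j \<times> K j).
     complex_of_real (sqrt (case i of (j, l, k) \<Rightarrow> p j * y j l * x j k)) * (\<beta> b i * \<Xi> (a, c) i))"
proof -
  have "\<psi> a b c = (\<Sum>j\<in>J. \<Sum>l\<in>L j. \<Sum>k\<in>K j. \<Sum>m\<in>M j.
          complex_of_real (sqrt (p j) * sqrt (x j k) * sqrt (y j l) * sqrt (z j m)) *
          (\<alpha> a (j, k, m) * \<beta> b (j, l, k) * \<gamma> c (j, m, l)))"
    unfolding \<psi>[OF assms] by (rule sum.cong[OF refl], rule sum.swap)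
  then show ?thesis
    by (simp add: sum_Sigma_Times fin \<Xi>_def real_sqrt_mult sum_distrib_left sum_distrib_right mult_ac)
qed

lemma finite_Sigma:
  "finite (SIGMA j:J. K j \<times> M j)" "finite (SIGMA j:J. L j \<times> K j)" "finite (SIGMA j:J. M j \<times> L j)"
  "finite (SIGMA j:J. K j \<times> K j)"
  using fin by (auto intro!: finite_SigmaI)

lemma entropy_A:
  "von_Neumann_entropy X (rho_A Y Z \<psi>)
    = - (\<Sum>(j, k, m)\<in>(SIGMA j:J. K j \<times> M j). (p j * x j k * z j m) * ln (p j * x j k * z j m))"
proof -
  have "von_Neumann_entropy X (rho_A Y Z \<psi>) = - (\<Sum>i\<in>(SIGMA j:J. K j \<times> M j).
     (case i of (j, k, m) \<Rightarrow> p j * x j k * z j m) * ln (case i of (j, k, m) \<Rightarrow> p j * x j k * z j m))"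
    by (rule entropy_schmidt[OF fin(1) finite_Sigma(1) \<alpha> isometry_\<Theta>, where \<psi> = "\<lambda>a (b, c). \<psi> a b c"])
      (auto simp: rho_A_def rho_AB_def \<psi>_A sum.cartesian_product split_def p x z less_imp_le)
  then show ?thesis by (simp add: split_def)
qed

lemma entropy_B:
  "von_Neumann_entropy Y (rho_B X Z \<psi>)
    = - (\<Sum>(j, l, k)\<in>(SIGMA j:J. L j \<times> K j). (p j * y j l * x j k) * ln (p j * y j l * x j k))"
proof -
  have "von_Neumann_entropy Y (rho_B X Z \<psi>) = - (\<Sum>i\<in>(SIGMA j:J. L j \<times> K j).
     (case i of (j, l, k) \<Rightarrow> p j * y j l * x j k) * ln (case i of (j, l, k) \<Rightarrow> p j * y j l * x j k))"
    by (rule entropy_schmidt[OF fin(2) finite_Sigma(2) \<beta> isometry_\<Xi>, where \<psi> = "\<lambda>b (a, c). \<psi> a b c"])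
      (auto simp: rho_B_def rho_AB_def \<psi>_B sum.cartesian_product split_def p x y less_imp_le)
  then show ?thesis by (simp add: split_def)
qed

lemma rho_AB_decomposition:
  assumes "s \<in> X \<times> Y" "s' \<in> X \<times> Y"
  shows "rho_AB Z \<psi> s s' = (\<Sum>i\<in>(SIGMA j:J. M j \<times> L j).
     \<Phi> s i * complex_of_real (case i of (j, m, l) \<Rightarrow> p j * z j m * y j l) * cnj (\<Phi> s' i))"
proof -
  obtain a b a' b' where [simp]: "s = (a, b)" "s' = (a', b')" by (cases s, cases s') auto
  have "rho_AB Z \<psi> s s' = (\<Sum>c\<in>Z. \<psi> a b c * cnj (\<psi> a' b' c))" by (simp add: rho_AB_def)
  also have "\<dots> = (\<Sum>c\<in>Z. (\<Sum>i\<in>(SIGMA j:J. M j \<times> L j).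
     complex_of_real (sqrt (case i of (j, m, l) \<Rightarrow> p j * z j m * y j l)) * (\<Phi> (a, b) i * \<gamma> c i)) *
     cnj (\<Sum>i\<in>(SIGMA j:J. M j \<times> L j).
     complex_of_real (sqrt (case i of (j, m, l) \<Rightarrow> p j * z j m * y j l)) * (\<Phi> (a', b') i * \<gamma> c i)))"
    using assms by (intro sum.cong refl) (simp only: \<psi>_C mem_Times_iff fst_conv snd_conv \<open>s = _\<close> \<open>s' = _\<close>)
  also have "\<dots> = (\<Sum>i\<in>(SIGMA j:J. M j \<times> L j).
     \<Phi> s i * complex_of_real (case i of (j, m, l) \<Rightarrow> p j * z j m * y j l) * cnj (\<Phi> s' i))"
    unfolding \<open>s = _\<close> \<open>s' = _\<close>
    by (rule partial_trace_schmidt[OF finite_Sigma(3) \<gamma>]) (auto simp: p y z less_imp_le)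
  finally show ?thesis .
qed

lemma entropy_AB:
  "von_Neumann_entropy (X \<times> Y) (rho_AB Z \<psi>)
    = - (\<Sum>(j, m, l)\<in>(SIGMA j:J. M j \<times> L j). (p j * z j m * y j l) * ln (p j * z j m * y j l))"
proof -
  have "von_Neumann_entropy (X \<times> Y) (rho_AB Z \<psi>) = - (\<Sum>i\<in>(SIGMA j:J. M j \<times> L j).
     (case i of (j, m, l) \<Rightarrow> p j * z j m * y j l) * ln (case i of (j, m, l) \<Rightarrow> p j * z j m * y j l))"
    by (rule von_Neumann_entropy_isometric_decomposition[OF _ finite_Sigma(3) isometry_\<Phi> rho_AB_decomposition])
      (use fin in auto)
  then show ?thesis by (simp add: split_def)
qed

text \<open>By functional calculus the square root keeps the family \<Phi> and takes roots of the
  weights. After expanding \<Phi> and regrouping, \<open>k\<close> and \<open>k'\<close> remain as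
  the Schmidt index between AA* and BB*, while \<open>m\<close> and \<open>l\<close> are absorbed
  into \<Omega> and \<Upsilon>; the pair state of A and B thus enters twice.\<close>

lemma canonical_purification_schmidt:
  assumes "a \<in> X" "b \<in> Y" "a' \<in> X" "b' \<in> Y"
  shows "canonical_purification X Y Z \<psi> a b a' b' = (\<Sum>i\<in>(SIGMA j:J. K j \<times> K j).
     complex_of_real (sqrt (case i of (j, k, k') \<Rightarrow> p j * x j k * x j k')) * (\<Omega> (a, a') i * \<Upsilon> (b, b') i))"
proof -
  have "canonical_purification X Y Z \<psi> a b a' b' = (\<Sum>i\<in>(SIGMA j:J. M j \<times> L j).
     \<Phi> (a, b) i * complex_of_real (sqrt (case i of (j, m, l) \<Rightarrow> p j * z j m * y j l)) * cnj (\<Phi> (a', b') i))"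
    unfolding canonical_purification_def
    by (rule matrix_fun_isometric_decomposition[OF _ finite_Sigma(3) isometry_\<Phi> _ rho_AB_decomposition])
      (use fin assms in auto)
  also have "\<dots> = (\<Sum>j\<in>J. \<Sum>m\<in>M j. \<Sum>l\<in>L j. \<Sum>k\<in>K j. \<Sum>k'\<in>K j.
     complex_of_real (sqrt (p j) * sqrt (z j m) * sqrt (y j l) * sqrt (x j k) * sqrt (x j k')) *
     (\<alpha> a (j, k, m) * \<beta> b (j, l, k) * cnj (\<alpha> a' (j, k', m) * \<beta> b' (j, l, k'))))"
    by (simp add: sum_Sigma_Times fin \<Phi>_def real_sqrt_mult sum_product)
       (simp add: sum_distrib_left sum_distrib_right mult_ac)
  also have "\<dots> = (\<Sum>j\<in>J. \<Sum>k\<in>K j. \<Sum>k'\<in>K j. \<Sum>m\<in>M j. \<Sum>l\<in>L j.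
     complex_of_real (sqrt (p j) * sqrt (z j m) * sqrt (y j l) * sqrt (x j k) * sqrt (x j k')) *
     (\<alpha> a (j, k, m) * \<beta> b (j, l, k) * cnj (\<alpha> a' (j, k', m) * \<beta> b' (j, l, k'))))"
    by (rule sum.cong[OF refl])
      (simp only: sum.swap[of _ "K _" "L _"] sum.swap[of _ "K _" "M _"])
  also have "\<dots> = (\<Sum>i\<in>(SIGMA j:J. K j \<times> K j).
     complex_of_real (sqrt (case i of (j, k, k') \<Rightarrow> p j * x j k * x j k')) * (\<Omega> (a, a') i * \<Upsilon> (b, b') i))"
    by (simp add: sum_Sigma_Times fin \<Omega>_def \<Upsilon>_def real_sqrt_mult sum_product)
       (simp add: sum_distrib_left sum_distrib_right mult_ac)
  finally show ?thesis .
qed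

lemma reflected_entropy_eq:
  "reflected_entropy X Y Z \<psi>
    = - (\<Sum>(j, k, k')\<in>(SIGMA j:J. K j \<times> K j). (p j * x j k * x j k') * ln (p j * x j k * x j k'))"
proof -
  have "reflected_entropy X Y Z \<psi> = - (\<Sum>i\<in>(SIGMA j:J. K j \<times> K j).
     (case i of (j, k, k') \<Rightarrow> p j * x j k * x j k') * ln (case i of (j, k, k') \<Rightarrow> p j * x j k * x j k'))"
    unfolding reflected_entropy_def
    by (rule entropy_schmidt[OF _ finite_Sigma(4) isometry_\<Omega> isometry_\<Upsilon>,
          where \<psi> = "\<lambda>(a, a') (b, b'). canonical_purification X Y Z \<psi> a b a' b'"])
      (auto simp: fin canonical_purification_schmidt sum.cartesian_product split_def p x less_imp_le)
  then show ?thesis by (simp add: split_def)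
qed

text \<open>The weights \<open>z\<close> and \<open>y\<close> occur once in the entropy of A or B
  and once in that of AB, so they cancel in the mutual information; one copy of \<open>p\<close> and
  two of \<open>x\<close> remain, as in the reflected entropy.\<close>

lemma markov_gap_eq_0: "markov_gap X Y Z \<psi> = 0"
  unfolding markov_gap_def mutual_information_def reflected_entropy_eq entropy_A entropy_B entropy_AB
  using fin p x y z by (simp add: sum_product_ln)

end

section \<open>Reduction of block decompositions to Schmidt form\<close>

text \<open>In each sector the Schmidt bases \<open>u\<close> on the right factor and
  \<open>v\<close> on the left factor form a product family, which \<open>U\<close> carries into the
  party; different sectors are orthogonal because \<open>U\<close> is an isometry. The new index
  lists right before left, the labels of \<open>U\<close> left before right.\<close>

lemma isometry_on_block_sum:
  fixes U :: "'a \<Rightarrow> nat + nat \<times> nat \<times> nat \<Rightarrow> complex"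
  assumes U: "isometry_on X (sum_split_labels n n0 nL nR) U"
    and u: "\<And>j. j < n \<Longrightarrow> isometry_on {..<nR j} (K j) (u j)"
    and v: "\<And>j. j < n \<Longrightarrow> isometry_on {..<nL j} (M j) (v j)"
  shows "isometry_on X (SIGMA j:{..<n}. K j \<times> M j)
     (\<lambda>a (j, k, m). \<Sum>(l, r)\<in>{..<nL j} \<times> {..<nR j}. U a (Inr (j, l, r)) * (u j r k * v j l m))"
  unfolding isometry_on_def
proof (intro ballI)
  fix i i' assume i: "i \<in> (SIGMA j:{..<n}. K j \<times> M j)" "i' \<in> (SIGMA j:{..<n}. K j \<times> M j)"
  obtain j k m j' k' m' where ii [simp]: "i = (j, k, m)" "i' = (j', k', m')"
    by (cases i, cases i') auto
  have j: "j < n" "k \<in> K j" "m \<in> M j" "j' < n" "k' \<in> K j'" "m' \<in> M j'" using i by auto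
  let ?P = "\<lambda>j. {..<nL j} \<times> {..<nR j}"
  let ?w = "\<lambda>j k m q. u j (snd q) k * v j (fst q) m"
  have "(\<Sum>a\<in>X. cnj (\<Sum>q\<in>?P j. U a (Inr (j, q)) * ?w j k m q) * (\<Sum>q\<in>?P j'. U a (Inr (j', q)) * ?w j' k' m' q))
     = (\<Sum>a\<in>X. \<Sum>q\<in>?P j. \<Sum>q'\<in>?P j'. cnj (?w j k m q) * ?w j' k' m' q' * (cnj (U a (Inr (j, q))) * U a (Inr (j', q'))))"
    unfolding cnj_sum sum_product by (simp add: mult_ac)
  also have "\<dots> = (\<Sum>q\<in>?P j. \<Sum>q'\<in>?P j'. \<Sum>a\<in>X. cnj (?w j k m q) * ?w j' k' m' q' * (cnj (U a (Inr (j, q))) * U a (Inr (j', q'))))"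
    by (subst sum.swap) (intro sum.cong refl sum.swap)
  also have "\<dots> = (\<Sum>q\<in>?P j. \<Sum>q'\<in>?P j'. if j = j' \<and> q = q' then cnj (?w j k m q) * ?w j k' m' q else 0)"
    unfolding sum_distrib_left[symmetric] using j
    by (intro sum.cong refl, subst isometry_onD[OF U]) (auto simp: sum_split_labels_def)
  also have "\<dots> = (if j = j' then (\<Sum>q\<in>?P j. cnj (?w j k m q) * ?w j k' m' q) else 0)"
  proof (cases "j = j'")
    case True
    then show ?thesis by (auto intro!: sum.cong)
  qed simp
  also have "\<dots> = (if j = j' then (\<Sum>l<nL j. cnj (v j l m) * v j l m') * (\<Sum>r<nR j. cnj (u j r k) * u j r k') else 0)"
    by (simp only: sum_product sum.cartesian_product' fst_conv snd_conv) (simp add: mult_ac)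
  also have "\<dots> = (if i = i' then 1 else 0)"
    using j by (auto simp: isometry_onD[OF u] isometry_onD[OF v])
  finally show "(\<Sum>a\<in>X. cnj (case i of (j, k, m) \<Rightarrow> \<Sum>(l, r)\<in>?P j. U a (Inr (j, l, r)) * (u j r k * v j l m)) *
       (case i' of (j, k, m) \<Rightarrow> \<Sum>(l, r)\<in>?P j. U a (Inr (j, l, r)) * (u j r k * v j l m)))
     = (if i = i' then 1 else 0)"
    by (simp add: split_def)
qed

lemma sum_swap_3_3:
  fixes f :: "'a \<Rightarrow> 'b \<Rightarrow> 'c \<Rightarrow> 'k \<Rightarrow> 'l \<Rightarrow> 'm \<Rightarrow> 'd :: comm_monoid_add"
  shows "(\<Sum>a\<in>A. \<Sum>b\<in>B. \<Sum>c\<in>C. \<Sum>k\<in>K. \<Sum>l\<in>L. \<Sum>m\<in>M. f a b c k l m)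
    = (\<Sum>k\<in>K. \<Sum>l\<in>L. \<Sum>m\<in>M. \<Sum>a\<in>A. \<Sum>b\<in>B. \<Sum>c\<in>C. f a b c k l m)"
proof -
  have move: "(\<Sum>a\<in>A. \<Sum>b\<in>B. \<Sum>c\<in>C. \<Sum>k\<in>Q. g a b c k) = (\<Sum>k\<in>Q. \<Sum>a\<in>A. \<Sum>b\<in>B. \<Sum>c\<in>C. g a b c k)"
    for Q and g :: "'a \<Rightarrow> 'b \<Rightarrow> 'c \<Rightarrow> 'q \<Rightarrow> 'd"
  proof -
    have "(\<Sum>a\<in>A. \<Sum>b\<in>B. \<Sum>c\<in>C. \<Sum>k\<in>Q. g a b c k) = (\<Sum>a\<in>A. \<Sum>b\<in>B. \<Sum>k\<in>Q. \<Sum>c\<in>C. g a b c k)"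
      by (intro sum.cong refl sum.swap)
    also have "\<dots> = (\<Sum>a\<in>A. \<Sum>k\<in>Q. \<Sum>b\<in>B. \<Sum>c\<in>C. g a b c k)"
      by (intro sum.cong refl) (rule sum.swap)
    also have "\<dots> = (\<Sum>k\<in>Q. \<Sum>a\<in>A. \<Sum>b\<in>B. \<Sum>c\<in>C. g a b c k)" by (rule sum.swap)
    finally show ?thesis .
  qed
  show ?thesis unfolding move ..
qed

text \<open>Inserting the Schmidt decompositions of the pair states and absorbing their bases into
  \<open>UA\<close>, \<open>UB\<close>, \<open>UC\<close> brings \<psi> into the form of
  \<open>schmidt_triangle\<close>.\<close>

theorem markov_gap_sum_of_triangle_states:
  assumes fin: "finite X" "finite Y" "finite Z" and "sum_of_triangle_states X Y Z \<psi>"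
  shows "markov_gap X Y Z \<psi> = 0"
proof -
  obtain n p a0 aL aR UA b0 bL bR UB c0 cL cR UC
       \<psi>AB \<psi>BC \<psi>CA where
       UA: "unitary_on X (sum_split_labels n a0 aL aR) UA" and
       UB: "unitary_on Y (sum_split_labels n b0 bL bR) UB" and
       UC: "unitary_on Z (sum_split_labels n c0 cL cR) UC" and
       p: "\<forall>j<n. p j \<ge> (0::real)" and
       units: "\<forall>j<n. unit_vector ({..<aR j} \<times> {..<bL j}) (\<lambda>(r, l). \<psi>AB j r l) \<and>
              unit_vector ({..<bR j} \<times> {..<cL j}) (\<lambda>(r, l). \<psi>BC j r l) \<and>
              unit_vector ({..<cR j} \<times> {..<aL j}) (\<lambda>(r, l). \<psi>CA j r l)" and
       \<psi>: "\<forall>a\<in>X. \<forall>b\<in>Y. \<forall>c\<in>Z. \<psi> a b c =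
          (\<Sum>j<n. complex_of_real (sqrt (p j)) *
            (\<Sum>(lA, rA) \<in> {..<aL j} \<times> {..<aR j}. \<Sum>(lB, rB) \<in> {..<bL j} \<times> {..<bR j}.
             \<Sum>(lC, rC) \<in> {..<cL j} \<times> {..<cR j}.
               UA a (Inr (j, lA, rA)) * UB b (Inr (j, lB, rB)) * UC c (Inr (j, lC, rC)) *
               (\<psi>AB j rA lB * \<psi>BC j rB lC * \<psi>CA j rC lA)))"
    by (insert assms(4), unfold sum_of_triangle_states_def, elim exE conjE, rule that) assumption+
  have schmidt: "\<exists>(K :: nat \<Rightarrow> nat set) x u v. \<forall>j<n. finite (K j) \<and> isometry_on {..<R j} (K j) (u j) \<and> isometry_on {..<L j} (K j) (v j) \<and>
      (\<forall>k\<in>K j. x j k > 0) \<and> sum (x j) (K j) = 1 \<and>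
      (\<forall>r\<in>{..<R j}. \<forall>l\<in>{..<L j}. \<chi> j r l = (\<Sum>k\<in>K j. complex_of_real (sqrt (x j k)) * u j r k * v j l k))"
    if "\<forall>j<n. unit_vector ({..<R j} \<times> {..<L j}) (\<lambda>(r, l). \<chi> j r l)"
    for R L :: "nat \<Rightarrow> nat" and \<chi> :: "nat \<Rightarrow> nat \<Rightarrow> nat \<Rightarrow> complex"
  proof -
    \<comment> \<open>The bound \<open>j < n\<close> is moved under the existential quantifiers so
      that \<open>choice_iff\<close> can choose the data for all \<open>j\<close> at once.\<close>
    have "\<forall>j. \<exists>(K :: nat set) x u v. j < n \<longrightarrow> finite K \<and> isometry_on {..<R j} K u \<and> isometry_on {..<L j} K v \<and>
      (\<forall>k\<in>K. x k > 0) \<and> sum x K = 1 \<and>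
      (\<forall>r\<in>{..<R j}. \<forall>l\<in>{..<L j}. \<chi> j r l = (\<Sum>k\<in>K. complex_of_real (sqrt (x k)) * u r k * v l k))"
      (is "\<forall>j. \<exists>K x u v. j < n \<longrightarrow> ?P j K x u v")
    proof
      fix j
      show "\<exists>K x u v. j < n \<longrightarrow> ?P j K x u v"
      proof (cases "j < n")
        case True
        from schmidt_decomposition[OF finite_lessThan finite_lessThan that[rule_format, OF True]]
        obtain K x u v where *: "K \<subseteq> {..<R j}" "isometry_on {..<R j} K u" "isometry_on {..<L j} K v"
          "\<forall>k\<in>K. x k > 0" "sum x K = 1"
          "\<forall>r\<in>{..<R j}. \<forall>l\<in>{..<L j}. \<chi> j r l = (\<Sum>k\<in>K. complex_of_real (sqrt (x k)) * u r k * v l k)"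
          by (elim exE conjE) (rule that)
        moreover have "finite K" using *(1) by (rule finite_subset) simp
        ultimately have "?P j K x u v" by (intro conjI)
        then show ?thesis by (intro exI impI)
      qed simp
    qed
    then show ?thesis unfolding choice_iff .
  qed
  have AB: "\<forall>j<n. unit_vector ({..<aR j} \<times> {..<bL j}) (\<lambda>(r, l). \<psi>AB j r l)"
    and BC: "\<forall>j<n. unit_vector ({..<bR j} \<times> {..<cL j}) (\<lambda>(r, l). \<psi>BC j r l)"
    and CA: "\<forall>j<n. unit_vector ({..<cR j} \<times> {..<aL j}) (\<lambda>(r, l). \<psi>CA j r l)"
    using units by simp_all
  obtain K :: "nat \<Rightarrow> nat set" and x uAB vAB where K: "\<forall>j<n. finite (K j) \<and> isometry_on {..<aR j} (K j) (uAB j) \<and> isometry_on {..<bL j} (K j) (vAB j) \<and>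
      (\<forall>k\<in>K j. x j k > 0) \<and> sum (x j) (K j) = 1 \<and>
      (\<forall>r\<in>{..<aR j}. \<forall>l\<in>{..<bL j}. \<psi>AB j r l = (\<Sum>k\<in>K j. complex_of_real (sqrt (x j k)) * uAB j r k * vAB j l k))"
    using schmidt[of aR bL \<psi>AB, OF AB]
    by (elim exE) (rule that, assumption)
  obtain L :: "nat \<Rightarrow> nat set" and y uBC vBC where L: "\<forall>j<n. finite (L j) \<and> isometry_on {..<bR j} (L j) (uBC j) \<and> isometry_on {..<cL j} (L j) (vBC j) \<and>
      (\<forall>k\<in>L j. y j k > 0) \<and> sum (y j) (L j) = 1 \<and>
      (\<forall>r\<in>{..<bR j}. \<forall>l\<in>{..<cL j}. \<psi>BC j r l = (\<Sum>k\<in>L j. complex_of_real (sqrt (y j k)) * uBC j r k * vBC j l k))"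
    using schmidt[of bR cL \<psi>BC, OF BC]
    by (elim exE) (rule that, assumption)
  obtain M :: "nat \<Rightarrow> nat set" and z uCA vCA where M: "\<forall>j<n. finite (M j) \<and> isometry_on {..<cR j} (M j) (uCA j) \<and> isometry_on {..<aL j} (M j) (vCA j) \<and>
      (\<forall>k\<in>M j. z j k > 0) \<and> sum (z j) (M j) = 1 \<and>
      (\<forall>r\<in>{..<cR j}. \<forall>l\<in>{..<aL j}. \<psi>CA j r l = (\<Sum>k\<in>M j. complex_of_real (sqrt (z j k)) * uCA j r k * vCA j l k))"
    using schmidt[of cR aL \<psi>CA, OF CA]
    by (elim exE) (rule that, assumption)
  define \<alpha> where "\<alpha> = (\<lambda>a (j, k, m). \<Sum>(l, r)\<in>{..<aL j} \<times> {..<aR j}. UA a (Inr (j, l, r)) * (uAB j r k * vCA j l m))"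
  define \<beta> where "\<beta> = (\<lambda>b (j, k, m). \<Sum>(l, r)\<in>{..<bL j} \<times> {..<bR j}. UB b (Inr (j, l, r)) * (uBC j r k * vAB j l m))"
  define \<gamma> where "\<gamma> = (\<lambda>c (j, k, m). \<Sum>(l, r)\<in>{..<cL j} \<times> {..<cR j}. UC c (Inr (j, l, r)) * (uCA j r k * vBC j l m))"
  interpret schmidt_triangle X Y Z "{..<n}" K L M p x y z \<alpha> \<beta> \<gamma> \<psi>
  proof
    show "isometry_on X (SIGMA j:{..<n}. K j \<times> M j) \<alpha>"
      unfolding \<alpha>_def
      by (rule isometry_on_block_sum[OF unitary_on_isometry[OF UA]]) (simp_all add: K M)
    show "isometry_on Y (SIGMA j:{..<n}. L j \<times> K j) \<beta>"
      unfolding \<beta>_def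
      by (rule isometry_on_block_sum[OF unitary_on_isometry[OF UB]]) (simp_all add: K L)
    show "isometry_on Z (SIGMA j:{..<n}. M j \<times> L j) \<gamma>"
      unfolding \<gamma>_def
      by (rule isometry_on_block_sum[OF unitary_on_isometry[OF UC]]) (simp_all add: L M)
  next
    fix a b c assume abc: "a \<in> X" "b \<in> Y" "c \<in> Z"
    have "(\<Sum>qA \<in> {..<aL j} \<times> {..<aR j}. \<Sum>qB \<in> {..<bL j} \<times> {..<bR j}. \<Sum>qC \<in> {..<cL j} \<times> {..<cR j}.
               UA a (Inr (j, qA)) * UB b (Inr (j, qB)) * UC c (Inr (j, qC)) *
               (\<psi>AB j (snd qA) (fst qB) * \<psi>BC j (snd qB) (fst qC) * \<psi>CA j (snd qC) (fst qA)))
        = (\<Sum>k\<in>K j. \<Sum>l\<in>L j. \<Sum>m\<in>M j.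
          complex_of_real (sqrt (x j k) * sqrt (y j l) * sqrt (z j m)) *
          (\<alpha> a (j, k, m) * \<beta> b (j, l, k) * \<gamma> c (j, m, l)))" (is "?l = ?r") if j: "j < n" for j
    proof -
      let ?A = "\<lambda>qA k m. UA a (Inr (j, qA)) * (uAB j (snd qA) k * vCA j (fst qA) m)"
      let ?B = "\<lambda>qB l k. UB b (Inr (j, qB)) * (uBC j (snd qB) l * vAB j (fst qB) k)"
      let ?C = "\<lambda>qC m l. UC c (Inr (j, qC)) * (uCA j (snd qC) m * vBC j (fst qC) l)"
      let ?s = "\<lambda>k l m. complex_of_real (sqrt (x j k) * sqrt (y j l) * sqrt (z j m))"
      have "?l = (\<Sum>qA \<in> {..<aL j} \<times> {..<aR j}. \<Sum>qB \<in> {..<bL j} \<times> {..<bR j}. \<Sum>qC \<in> {..<cL j} \<times> {..<cR j}.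
           \<Sum>k\<in>K j. \<Sum>l\<in>L j. \<Sum>m\<in>M j. ?s k l m * (?A qA k m * ?B qB l k * ?C qC m l))"
      proof (intro sum.cong refl)
        fix qA qB qC assume q: "qA \<in> {..<aL j} \<times> {..<aR j}" "qB \<in> {..<bL j} \<times> {..<bR j}" "qC \<in> {..<cL j} \<times> {..<cR j}"
        have "\<psi>AB j (snd qA) (fst qB) = (\<Sum>k\<in>K j. complex_of_real (sqrt (x j k)) * uAB j (snd qA) k * vAB j (fst qB) k)"
          "\<psi>BC j (snd qB) (fst qC) = (\<Sum>l\<in>L j. complex_of_real (sqrt (y j l)) * uBC j (snd qB) l * vBC j (fst qC) l)"
          "\<psi>CA j (snd qC) (fst qA) = (\<Sum>m\<in>M j. complex_of_real (sqrt (z j m)) * uCA j (snd qC) m * vCA j (fst qA) m)"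
          using q j by (simp_all add: K L M mem_Times_iff)
        then show "UA a (Inr (j, qA)) * UB b (Inr (j, qB)) * UC c (Inr (j, qC)) *
               (\<psi>AB j (snd qA) (fst qB) * \<psi>BC j (snd qB) (fst qC) * \<psi>CA j (snd qC) (fst qA))
           = (\<Sum>k\<in>K j. \<Sum>l\<in>L j. \<Sum>m\<in>M j. ?s k l m * (?A qA k m * ?B qB l k * ?C qC m l))"
          by (simp only: mult.assoc sum_distrib_right) (simp only: sum_distrib_left, simp add: mult_ac)
      qed
      also have "\<dots> = (\<Sum>k\<in>K j. \<Sum>l\<in>L j. \<Sum>m\<in>M j. \<Sum>qA \<in> {..<aL j} \<times> {..<aR j}. \<Sum>qB \<in> {..<bL j} \<times> {..<bR j}. \<Sum>qC \<in> {..<cL j} \<times> {..<cR j}.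
           ?s k l m * (?A qA k m * ?B qB l k * ?C qC m l))"
        by (rule sum_swap_3_3)
      also have "\<dots> = ?r"
      proof (intro sum.cong refl)
        fix k l m
        have "\<alpha> a (j, k, m) * \<beta> b (j, l, k) * \<gamma> c (j, m, l) = (\<Sum>qA \<in> {..<aL j} \<times> {..<aR j}. \<Sum>qB \<in> {..<bL j} \<times> {..<bR j}. \<Sum>qC \<in> {..<cL j} \<times> {..<cR j}.
           ?A qA k m * ?B qB l k * ?C qC m l)"
          unfolding \<alpha>_def \<beta>_def \<gamma>_def split_def
          by (simp only: fst_conv snd_conv prod.collapse mult.assoc sum_distrib_right) (simp only: sum_distrib_left mult.assoc)
        then show "(\<Sum>qA \<in> {..<aL j} \<times> {..<aR j}. \<Sum>qB \<in> {..<bL j} \<times> {..<bR j}. \<Sum>qC \<in> {..<cL j} \<times> {..<cR j}.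
           ?s k l m * (?A qA k m * ?B qB l k * ?C qC m l)) = ?s k l m * (\<alpha> a (j, k, m) * \<beta> b (j, l, k) * \<gamma> c (j, m, l))"
          by (simp only: sum_distrib_left)
      qed
      finally show ?thesis .
    qed
    note inner = this
    have "\<psi> a b c = (\<Sum>j<n. complex_of_real (sqrt (p j)) *
       (\<Sum>qA \<in> {..<aL j} \<times> {..<aR j}. \<Sum>qB \<in> {..<bL j} \<times> {..<bR j}. \<Sum>qC \<in> {..<cL j} \<times> {..<cR j}.
               UA a (Inr (j, qA)) * UB b (Inr (j, qB)) * UC c (Inr (j, qC)) *
               (\<psi>AB j (snd qA) (fst qB) * \<psi>BC j (snd qB) (fst qC) * \<psi>CA j (snd qC) (fst qA))))"
      unfolding \<psi>[rule_format, OF abc] split_def prod.collapse ..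
    also have "\<dots> = (\<Sum>j<n. complex_of_real (sqrt (p j)) * (\<Sum>k\<in>K j. \<Sum>l\<in>L j. \<Sum>m\<in>M j.
          complex_of_real (sqrt (x j k) * sqrt (y j l) * sqrt (z j m)) *
          (\<alpha> a (j, k, m) * \<beta> b (j, l, k) * \<gamma> c (j, m, l))))"
      by (rule sum.cong[OF refl]) (simp only: inner lessThan_iff)
    also have "\<dots> = (\<Sum>j<n. \<Sum>k\<in>K j. \<Sum>l\<in>L j. \<Sum>m\<in>M j.
          complex_of_real (sqrt (p j) * sqrt (x j k) * sqrt (y j l) * sqrt (z j m)) *
          (\<alpha> a (j, k, m) * \<beta> b (j, l, k) * \<gamma> c (j, m, l)))"
      by (simp only: sum_distrib_left of_real_mult mult.assoc)
    finally show "\<psi> a b c = (\<Sum>j<n. \<Sum>k\<in>K j. \<Sum>l\<in>L j. \<Sum>m\<in>M j.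
          complex_of_real (sqrt (p j) * sqrt (x j k) * sqrt (y j l) * sqrt (z j m)) *
          (\<alpha> a (j, k, m) * \<beta> b (j, l, k) * \<gamma> c (j, m, l)))" .
  qed (use fin p in \<open>simp_all add: K L M\<close>)
  show ?thesis by (rule markov_gap_eq_0)
qed

section \<open>Configurations and local circuits\<close>

lemma finite_configs [simp]: "finite S \<Longrightarrow> finite (configs d S)"
  by (simp add: configs_def finite_PiE)

lemma override_on_configs:
  "\<sigma> \<in> configs d S \<Longrightarrow> \<tau> \<in> configs d T \<Longrightarrow> override_on \<tau> \<sigma> S \<in> configs d (S \<union> T)"
  by (auto simp: configs_def override_on_def PiE_iff extensional_def)

lemma restrict_configs: "\<sigma> \<in> configs d T \<Longrightarrow> S \<subseteq> T \<Longrightarrow> restrict \<sigma> S \<in> configs d S"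
  by (auto simp: configs_def PiE_iff)

lemma restrict_configs_id: "\<sigma> \<in> configs d S \<Longrightarrow> restrict \<sigma> S = \<sigma>"
  by (simp add: configs_def PiE_restrict)

lemma sum_configs_Un:
  assumes "S \<inter> T = {}"
  shows "(\<Sum>\<sigma>\<in>configs d (S \<union> T). f \<sigma>) = (\<Sum>\<sigma>\<in>configs d S. \<Sum>\<tau>\<in>configs d T. f (override_on \<tau> \<sigma> S))"
proof -
  have "(\<Sum>\<sigma>\<in>configs d (S \<union> T). f \<sigma>) = (\<Sum>q\<in>configs d S \<times> configs d T. f (override_on (snd q) (fst q) S))"
  proof (rule sum.reindex_bij_witness[where i = "\<lambda>q. override_on (snd q) (fst q) S" and j = "\<lambda>\<sigma>. (restrict \<sigma> S, restrict \<sigma> T)"])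
    fix \<sigma> assume \<sigma>: "\<sigma> \<in> configs d (S \<union> T)"
    then show "override_on (snd (restrict \<sigma> S, restrict \<sigma> T)) (fst (restrict \<sigma> S, restrict \<sigma> T)) S = \<sigma>"
      by (auto simp: override_on_def configs_def PiE_iff extensional_def fun_eq_iff)
    then show "f (override_on (snd (restrict \<sigma> S, restrict \<sigma> T)) (fst (restrict \<sigma> S, restrict \<sigma> T)) S) = f \<sigma>"
      by simp
    show "(restrict \<sigma> S, restrict \<sigma> T) \<in> configs d S \<times> configs d T"
      using \<sigma> by (auto intro: restrict_configs)
  next
    fix q assume q: "q \<in> configs d S \<times> configs d T"
    then show "override_on (snd q) (fst q) S \<in> configs d (S \<union> T)" by (auto intro: override_on_configs)
    show "(restrict (override_on (snd q) (fst q) S) S, restrict (override_on (snd q) (fst q) S) T) = q"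
      using q assms
      by (auto simp: prod_eq_iff override_on_def configs_def PiE_iff extensional_def fun_eq_iff)
  qed
  then show ?thesis by (simp add: sum.cartesian_product split_def)
qed

lemma sum_configs_prod_inner:
  fixes v w :: "site \<Rightarrow> nat \<Rightarrow> complex"
  assumes "finite S"
  shows "(\<Sum>\<sigma>\<in>configs d S. cnj (\<Prod>s\<in>S. v s (\<sigma> s)) * (\<Prod>s\<in>S. w s (\<sigma> s)))
     = (\<Prod>s\<in>S. \<Sum>i<d s. cnj (v s i) * w s i)"
  using assms unfolding configs_def by (subst prod_sum_PiE) (auto simp: prod.distrib)

lemma isometry_on_inner:
  assumes fin: "finite X" "finite Y" and U: "isometry_on X Y U"
  shows "(\<Sum>x\<in>X. cnj (\<Sum>y\<in>Y. U x y * f y) * (\<Sum>y\<in>Y. U x y * g y)) = (\<Sum>y\<in>Y. cnj (f y) * g y)"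
proof -
  have "(\<Sum>x\<in>X. cnj (\<Sum>y\<in>Y. U x y * f y) * (\<Sum>y\<in>Y. U x y * g y))
     = (\<Sum>x\<in>X. \<Sum>y\<in>Y. \<Sum>y'\<in>Y. (cnj (f y) * g y') * (cnj (U x y) * U x y'))"
    unfolding cnj_sum sum_product by (simp add: mult_ac)
  also have "\<dots> = (\<Sum>y\<in>Y. \<Sum>y'\<in>Y. \<Sum>x\<in>X. (cnj (f y) * g y') * (cnj (U x y) * U x y'))"
    by (subst sum.swap) (intro sum.cong refl sum.swap)
  also have "\<dots> = (\<Sum>y\<in>Y. \<Sum>y'\<in>Y. if y = y' then cnj (f y) * g y' else 0)"
    unfolding sum_distrib_left[symmetric] using U by (intro sum.cong refl) (auto simp: isometry_onD)
  also have "\<dots> = (\<Sum>y\<in>Y. cnj (f y) * g y)" using fin by simp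
  finally show ?thesis .
qed

section \<open>Locality of vectors and circuits\<close>

text \<open>Locality without a change of type: tensor factors stay functions of global
  configurations and merely ignore the sites outside \<open>T\<close>, so a tensor product is a
  pointwise product.\<close>

definition depends_on :: "site set \<Rightarrow> (config \<Rightarrow> complex) \<Rightarrow> bool" where
  "depends_on T f \<longleftrightarrow> (\<forall>\<sigma> \<sigma>'. (\<forall>s\<in>T. \<sigma> s = \<sigma>' s) \<longrightarrow> f \<sigma> = f \<sigma>')"

lemma depends_onD: "depends_on T f \<Longrightarrow> (\<And>s. s \<in> T \<Longrightarrow> \<sigma> s = \<sigma>' s) \<Longrightarrow> f \<sigma> = f \<sigma>'"
  by (auto simp: depends_on_def)

lemma depends_on_mult:
  "depends_on T f \<Longrightarrow> depends_on T' g \<Longrightarrow> depends_on (T \<union> T') (\<lambda>\<sigma>. f \<sigma> * g \<sigma>)"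
  unfolding depends_on_def by (metis UnI1 UnI2)

text \<open>Every gate must fit into some member of \<open>\<S>\<close> but may be smaller, so that
  regrouping a circuit becomes a change of \<open>\<S>\<close>. The rule adds the gate that is
  applied last.\<close>

inductive circuit_on ::
  "(site \<Rightarrow> nat) \<Rightarrow> site set set \<Rightarrow> ((config \<Rightarrow> complex) \<Rightarrow> config \<Rightarrow> complex) \<Rightarrow> bool" for d \<S> where
  circuit_on_id: "circuit_on d \<S> (\<lambda>\<psi>. \<psi>)"
| circuit_on_gate: "circuit_on d \<S> F \<Longrightarrow> S \<in> \<S> \<Longrightarrow> S' \<subseteq> S \<Longrightarrow>
    unitary_on (configs d S') (configs d S') U \<Longrightarrow> circuit_on d \<S> (\<lambda>\<psi>. apply_gate d S' U (F \<psi>))"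

lemma circuit_on_single:
  "S \<in> \<S> \<Longrightarrow> S' \<subseteq> S \<Longrightarrow> unitary_on (configs d S') (configs d S') U \<Longrightarrow>
    circuit_on d \<S> (apply_gate d S' U)"
  using circuit_on_gate[OF circuit_on_id] by simp

lemma circuit_on_mono:
  assumes "circuit_on d \<S> F" "\<And>S. S \<in> \<S> \<Longrightarrow> \<exists>S'\<in>\<S>'. S \<subseteq> S'"
  shows "circuit_on d \<S>' F"
  using assms(1)
proof induction
  case (circuit_on_gate F S S' U)
  obtain S'' where "S'' \<in> \<S>'" "S \<subseteq> S''" using assms(2)[OF circuit_on_gate.hyps(2)] by blast
  then show ?case
    using circuit_on_gate by (intro circuit_on.circuit_on_gate[of d \<S>' F S'']) auto
qed (rule circuit_on.circuit_on_id)

lemma circuit_on_comp: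
  assumes "circuit_on d \<S> F" "circuit_on d \<S> G"
  shows "circuit_on d \<S> (\<lambda>\<psi>. F (G \<psi>))"
  using assms(1) by induction (auto intro: assms(2) circuit_on_gate)

lemma apply_gate_commute:
  assumes "S \<inter> S' = {}"
  shows "apply_gate d S U (apply_gate d S' U' \<psi>) = apply_gate d S' U' (apply_gate d S U \<psi>)"
proof
  fix \<sigma> :: config
  have *: "restrict (override_on \<sigma> \<tau> S) S' = restrict \<sigma> S'" "restrict (override_on \<sigma> \<tau> S') S = restrict \<sigma> S"
    "override_on (override_on \<sigma> \<tau> S) \<tau>' S' = override_on (override_on \<sigma> \<tau>' S') \<tau> S" for \<tau> \<tau>' :: config
    using assms by (auto simp: fun_eq_iff override_on_def restrict_def)
  show "apply_gate d S U (apply_gate d S' U' \<psi>) \<sigma> = apply_gate d S' U' (apply_gate d S U \<psi>) \<sigma>"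
    unfolding apply_gate_def sum_distrib_left
    by (subst sum.swap) (simp add: * mult_ac)
qed

lemma apply_gate_circuit_on_commute:
  assumes "circuit_on d \<S> F" "\<And>S. S \<in> \<S> \<Longrightarrow> T \<inter> S = {}"
  shows "apply_gate d T U (F \<psi>) = F (apply_gate d T U \<psi>)"
  using assms(1)
proof induction
  case (circuit_on_gate F S S' U')
  then have "T \<inter> S' = {}" using assms(2) by blast
  then show ?case using circuit_on_gate.IH by (simp add: apply_gate_commute)
qed simp

lemma circuit_on_commute:
  assumes "circuit_on d \<S> F" "circuit_on d \<T> G" "\<And>S T. S \<in> \<S> \<Longrightarrow> T \<in> \<T> \<Longrightarrow> S \<inter> T = {}"
  shows "F (G \<psi>) = G (F \<psi>)"
  using assms(1)
proof induction
  case (circuit_on_gate F S S' U)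
  have "S' \<inter> T = {}" if "T \<in> \<T>" for T using that assms(3) circuit_on_gate by blast
  then show ?case using circuit_on_gate.IH apply_gate_circuit_on_commute[OF assms(2)] by simp
qed simp

text \<open>A gate in a region of \<open>\<S>\<close> misses \<open>S\<close>, so it commutes past
  the part collected on \<open>S\<close> and joins the other part. Iteration separates a circuit on
  disjoint regions into one circuit per region.\<close>

lemma circuit_on_insert_split:
  assumes "circuit_on d (insert S \<S>) F" "\<And>T. T \<in> \<S> \<Longrightarrow> S \<inter> T = {}"
  shows "\<exists>F1 F2. circuit_on d {S} F1 \<and> circuit_on d \<S> F2 \<and> F = (\<lambda>\<psi>. F1 (F2 \<psi>))"
  using assms(1)
proof induction
  case circuit_on_id
  then show ?case by (intro exI[of _ "\<lambda>\<psi>. \<psi>"]) (auto intro: circuit_on.circuit_on_id)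
next
  case (circuit_on_gate F T S' U)
  then obtain F1 F2 where F: "circuit_on d {S} F1" "circuit_on d \<S> F2" "F = (\<lambda>\<psi>. F1 (F2 \<psi>))" by blast
  show ?case
  proof (cases "T = S")
    case True
    then have "circuit_on d {S} (\<lambda>\<psi>. apply_gate d S' U (F1 \<psi>))"
      using circuit_on_gate F(1) by (auto intro: circuit_on.circuit_on_gate)
    then show ?thesis using F by blast
  next
    case False
    then have T: "T \<in> \<S>" using circuit_on_gate by simp
    then have "circuit_on d \<S> (\<lambda>\<psi>. apply_gate d S' U (F2 \<psi>))"
      using circuit_on_gate F(2) by (auto intro: circuit_on.circuit_on_gate)
    moreover have "apply_gate d S' U (F1 \<psi>) = F1 (apply_gate d S' U \<psi>)" for \<psi>
      using assms(2)[OF T] circuit_on_gate by (intro apply_gate_circuit_on_commute[OF F(1)]) blast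
    ultimately show ?thesis
      using F by (intro exI[of _ F1] exI[of _ "\<lambda>\<psi>. apply_gate d S' U (F2 \<psi>)"] conjI) simp_all
  qed
qed

lemma circuit_on_triple_split:
  assumes "circuit_on d {S1, S2, S3} F" "S1 \<inter> S2 = {}" "S1 \<inter> S3 = {}" "S2 \<inter> S3 = {}"
  shows "\<exists>F1 F2 F3. circuit_on d {S1} F1 \<and> circuit_on d {S2} F2 \<and> circuit_on d {S3} F3 \<and>
    F = (\<lambda>\<psi>. F1 (F2 (F3 \<psi>)))"
proof -
  obtain F1 G where 1: "circuit_on d {S1} F1" "circuit_on d {S2, S3} G" "F = (\<lambda>\<psi>. F1 (G \<psi>))"
    using circuit_on_insert_split[OF assms(1)] assms by auto
  obtain F2 F3 where 2: "circuit_on d {S2} F2" "circuit_on d {S3} F3" "G = (\<lambda>\<psi>. F2 (F3 \<psi>))"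
    using circuit_on_insert_split[OF 1(2)] assms by auto
  show ?thesis using 1 2 by blast
qed

lemma circuit_on_linear:
  assumes "circuit_on d \<S> F"
  shows "F (\<lambda>\<sigma>. \<Sum>i\<in>I. c i * \<phi> i \<sigma>) = (\<lambda>\<sigma>. \<Sum>i\<in>I. c i * F (\<phi> i) \<sigma>)"
  using assms
proof induction
  case (circuit_on_gate F S S' U)
  show ?case
    unfolding circuit_on_gate.IH apply_gate_def fun_eq_iff sum_distrib_left
    by (subst sum.swap) (simp add: mult_ac)
qed simp

text \<open>Each gate replaces values only at sites that \<open>f\<close> ignores, so
  \<open>f\<close> comes out of every sum. This is how a circuit acts on a single factor of a
  product vector.\<close>

lemma circuit_on_factor:
  assumes "circuit_on d \<S> F" "depends_on T f" "\<And>S. S \<in> \<S> \<Longrightarrow> S \<inter> T = {}"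
  shows "F (\<lambda>\<sigma>. f \<sigma> * \<psi> \<sigma>) = (\<lambda>\<sigma>. f \<sigma> * F \<psi> \<sigma>)"
  using assms(1)
proof induction
  case (circuit_on_gate F S S' U)
  have "f (override_on \<sigma> \<tau> S') = f \<sigma>" for \<sigma> \<tau>
    using circuit_on_gate assms(3)[of S] by (intro depends_onD[OF assms(2)]) (auto simp: override_on_def)
  then show ?case
    unfolding circuit_on_gate.IH apply_gate_def fun_eq_iff by (simp add: sum_distrib_left mult_ac)
qed simp

lemma circuit_on_depends_on:
  assumes "circuit_on d \<S> F" "depends_on T \<psi>" "\<And>S. S \<in> \<S> \<Longrightarrow> S \<subseteq> T"
  shows "depends_on T (F \<psi>)"
  using assms(1)
proof induction
  case (circuit_on_gate F S S' U)
  then have S': "S' \<subseteq> T" using assms(3) by blast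
  show ?case unfolding depends_on_def
  proof (intro allI impI)
    fix \<sigma> \<sigma>' :: config assume eq: "\<forall>s\<in>T. \<sigma> s = \<sigma>' s"
    have "restrict \<sigma> S' = restrict \<sigma>' S'" using eq S' by (auto simp: fun_eq_iff restrict_def)
    moreover have "F \<psi> (override_on \<sigma> \<tau> S') = F \<psi> (override_on \<sigma>' \<tau> S')" for \<tau>
      using eq by (intro depends_onD[OF circuit_on_gate.IH]) (auto simp: override_on_def)
    ultimately show "apply_gate d S' U (F \<psi>) \<sigma> = apply_gate d S' U (F \<psi>) \<sigma>'"
      by (simp add: apply_gate_def)
  qed
qed (rule assms(2))

text \<open>For each fixed configuration off \<open>S\<close> the gate is the isometry
  \<open>U\<close> on the labels of \<open>S\<close>, which preserves the inner product of the two
  slices.\<close>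

lemma apply_gate_inner:
  assumes fin: "finite T" and S: "S \<subseteq> T" and U: "unitary_on (configs d S) (configs d S) U"
  shows "(\<Sum>\<sigma>\<in>configs d T. cnj (apply_gate d S U \<phi> \<sigma>) * apply_gate d S U \<psi> \<sigma>)
    = (\<Sum>\<sigma>\<in>configs d T. cnj (\<phi> \<sigma>) * \<psi> \<sigma>)"
proof -
  have T: "T = S \<union> (T - S)" and disj: "S \<inter> (T - S) = {}" using S by auto
  have finS: "finite S" using S fin by (rule finite_subset)
  have gate: "apply_gate d S U \<chi> (override_on \<tau> \<sigma> S) = (\<Sum>\<rho>\<in>configs d S. U \<sigma> \<rho> * \<chi> (override_on \<tau> \<rho> S))"
    if "\<sigma> \<in> configs d S" for \<sigma> \<tau> \<chi>
  proof -
    have "restrict (override_on \<tau> \<sigma> S) S = \<sigma>"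
      using that by (auto simp: fun_eq_iff override_on_def configs_def PiE_iff extensional_def)
    moreover have "override_on (override_on \<tau> \<sigma> S) \<rho> S = override_on \<tau> \<rho> S" for \<rho>
      by (auto simp: fun_eq_iff override_on_def)
    ultimately show ?thesis by (simp add: apply_gate_def)
  qed
  have "(\<Sum>\<sigma>\<in>configs d T. cnj (apply_gate d S U \<phi> \<sigma>) * apply_gate d S U \<psi> \<sigma>)
     = (\<Sum>\<tau>\<in>configs d (T - S). \<Sum>\<sigma>\<in>configs d S. cnj (\<Sum>\<rho>\<in>configs d S. U \<sigma> \<rho> * \<phi> (override_on \<tau> \<rho> S)) *
          (\<Sum>\<rho>\<in>configs d S. U \<sigma> \<rho> * \<psi> (override_on \<tau> \<rho> S)))"
    by (subst T, subst sum_configs_Un[OF disj], subst sum.swap) (simp add: gate)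
  also have "\<dots> = (\<Sum>\<tau>\<in>configs d (T - S). \<Sum>\<sigma>\<in>configs d S. cnj (\<phi> (override_on \<tau> \<sigma> S)) * \<psi> (override_on \<tau> \<sigma> S))"
    by (intro sum.cong refl isometry_on_inner unitary_on_isometry[OF U]) (simp_all add: finS)
  also have "\<dots> = (\<Sum>\<sigma>\<in>configs d T. cnj (\<phi> \<sigma>) * \<psi> \<sigma>)"
    by (subst (2) T, subst sum_configs_Un[OF disj], rule sum.swap)
  finally show ?thesis .
qed

lemma circuit_on_inner:
  assumes "circuit_on d \<S> F" "finite T" "\<And>S. S \<in> \<S> \<Longrightarrow> S \<subseteq> T"
  shows "(\<Sum>\<sigma>\<in>configs d T. cnj (F \<phi> \<sigma>) * F \<psi> \<sigma>) = (\<Sum>\<sigma>\<in>configs d T. cnj (\<phi> \<sigma>) * \<psi> \<sigma>)"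
  using assms(1)
proof induction
  case (circuit_on_gate F S S' U)
  then have "S' \<subseteq> T" using assms(3) by blast
  then show ?case using circuit_on_gate by (simp add: apply_gate_inner[OF assms(2)])
qed simp

lemma isometry_on_delta:
  assumes "finite X"
  shows "isometry_on X X (\<lambda>x y. if x = y then 1 else 0)"
  unfolding isometry_on_def
proof (intro ballI)
  fix y y' assume "y \<in> X"
  have "(\<Sum>x\<in>X. cnj (if x = y then 1 else 0) * (if x = y' then 1 else 0))
      = (\<Sum>x\<in>X. if x = y then if y = y' then 1 else 0 else (0::complex))"
    by (intro sum.cong) auto
  then show "(\<Sum>x\<in>X. cnj (if x = y then 1 else 0) * (if x = y' then 1 else 0))
      = (if y = y' then 1 else (0::complex))"
    using assms \<open>y \<in> X\<close> by simp
qed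

text \<open>The condition on \<sigma> matters: \<open>apply_gate\<close> sums over valid
  configurations only, so at a label outside the basis already the identity circuit is not given by
  a matrix.\<close>

lemma circuit_on_matrix:
  assumes "circuit_on d {S} F" and fin: "finite S"
  shows "\<exists>U. unitary_on (configs d S) (configs d S) U \<and>
    (\<forall>\<psi> \<sigma>. restrict \<sigma> S \<in> configs d S \<longrightarrow> F \<psi> \<sigma> = apply_gate d S U \<psi> \<sigma>)"
  using assms(1)
proof induction
  case circuit_on_id
  have "\<psi> \<sigma> = apply_gate d S (\<lambda>\<rho> \<tau>. if \<rho> = \<tau> then 1 else 0) \<psi> \<sigma>"
    if "restrict \<sigma> S \<in> configs d S" for \<psi> \<sigma>
  proof -
    have "apply_gate d S (\<lambda>\<rho> \<tau>. if \<rho> = \<tau> then 1 else 0) \<psi> \<sigma>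
        = (\<Sum>\<tau>\<in>configs d S. if restrict \<sigma> S = \<tau> then \<psi> (override_on \<sigma> \<tau> S) else 0)"
      unfolding apply_gate_def by (intro sum.cong) auto
    also have "\<dots> = \<psi> (override_on \<sigma> (restrict \<sigma> S) S)" using that fin by simp
    also have "override_on \<sigma> (restrict \<sigma> S) S = \<sigma>" by (auto simp: fun_eq_iff override_on_def)
    finally show ?thesis ..
  qed
  moreover have "unitary_on (configs d S) (configs d S) (\<lambda>\<rho> \<tau>. if \<rho> = \<tau> then 1 else 0)"
    using fin by (intro isometry_on_unitary isometry_on_delta) auto
  ultimately show ?case by blast
next
  case (circuit_on_gate F T S' U')
  then have S': "S' \<subseteq> S" by simp
  obtain U where U: "unitary_on (configs d S) (configs d S) U"
    and FU: "\<And>\<psi> \<sigma>. restrict \<sigma> S \<in> configs d S \<Longrightarrow> F \<psi> \<sigma> = apply_gate d S U \<psi> \<sigma>"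
    using circuit_on_gate.IH by blast
  \<comment> \<open>The gate is applied to each column of \<open>U\<close>; since gates preserve
    inner products, the columns stay orthonormal.\<close>
  define W where "W \<rho> \<tau> = apply_gate d S' U' (\<lambda>\<rho>. U \<rho> \<tau>) \<rho>" for \<rho> \<tau>
  have "isometry_on (configs d S) (configs d S) W"
    unfolding isometry_on_def W_def apply_gate_inner[OF fin S' circuit_on_gate.hyps(4)]
    using unitary_on_isometry[OF U] by (simp add: isometry_on_def)
  then have "unitary_on (configs d S) (configs d S) W"
    using fin by (intro isometry_on_unitary) auto
  moreover have "apply_gate d S' U' (F \<psi>) \<sigma> = apply_gate d S W \<psi> \<sigma>"
    if \<sigma>: "restrict \<sigma> S \<in> configs d S" for \<psi> \<sigma>
  proof -
    have res: "restrict (override_on \<sigma> \<tau> S') S = override_on (restrict \<sigma> S) \<tau> S'" for \<tau>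
      using S' by (auto simp: fun_eq_iff restrict_def override_on_def)
    have over: "override_on (override_on \<sigma> \<tau> S') \<rho> S = override_on \<sigma> \<rho> S" for \<tau> \<rho>
      using S' by (auto simp: fun_eq_iff override_on_def)
    have res': "restrict (restrict \<sigma> S) S' = restrict \<sigma> S'" using S' by (simp add: Int_absorb1)
    have "F \<psi> (override_on \<sigma> \<tau> S') = apply_gate d S U \<psi> (override_on \<sigma> \<tau> S')" if "\<tau> \<in> configs d S'" for \<tau>
    proof (rule FU)
      show "restrict (override_on \<sigma> \<tau> S') S \<in> configs d S"
        using override_on_configs[OF that \<sigma>] S' by (simp add: res Un_absorb1)
    qed
    then show ?thesis
      unfolding apply_gate_def[of d S'] apply_gate_def[of d S] W_def res'
      by (simp add: res over sum_distrib_left sum_distrib_right mult.assoc) (rule sum.swap)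
  qed
  ultimately show ?case by blast
qed

section \<open>From circuits to sums of triangle states\<close>

lemma unit_vector_iff: "unit_vector X v \<longleftrightarrow> (\<Sum>x\<in>X. cnj (v x) * v x) = 1"
proof -
  have "(\<Sum>x\<in>X. cnj (v x) * v x) = complex_of_real (\<Sum>x\<in>X. (cmod (v x))\<^sup>2)"
    unfolding of_real_sum by (intro sum.cong refl) (simp only: complex_norm_square mult.commute)
  then show ?thesis unfolding unit_vector_def by (simp only: of_real_eq_1_iff)
qed

section \<open>Normal form of sums of triangle states\<close>

text \<open>The existential part of \<open>sum_of_triangle_states\<close> with the number of sectors
  exposed, so that a single sector can be matched with \<open>triangle_state\<close>.\<close>

definition triangle_sum ::
  "nat \<Rightarrow> 'a set \<Rightarrow> 'b set \<Rightarrow> 'c set \<Rightarrow> ('a \<Rightarrow> 'b \<Rightarrow> 'c \<Rightarrow> complex) \<Rightarrow> bool" where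
  "triangle_sum m X Y Z \<psi> \<longleftrightarrow>
    (\<exists>(p :: nat \<Rightarrow> real) (a0::nat) aL aR UA (b0::nat) bL bR UB (c0::nat) cL cR UC
       (\<psi>AB :: nat \<Rightarrow> nat \<Rightarrow> nat \<Rightarrow> complex) (\<psi>BC :: nat \<Rightarrow> nat \<Rightarrow> nat \<Rightarrow> complex)
       (\<psi>CA :: nat \<Rightarrow> nat \<Rightarrow> nat \<Rightarrow> complex).
       unitary_on X (sum_split_labels m a0 aL aR) UA \<and>
       unitary_on Y (sum_split_labels m b0 bL bR) UB \<and>
       unitary_on Z (sum_split_labels m c0 cL cR) UC \<and>
       (\<forall>j<m. p j \<ge> 0) \<and> (\<Sum>j<m. p j) = 1 \<and>
       (\<forall>j<m. unit_vector ({..<aR j} \<times> {..<bL j}) (\<lambda>(r, l). \<psi>AB j r l) \<and>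
              unit_vector ({..<bR j} \<times> {..<cL j}) (\<lambda>(r, l). \<psi>BC j r l) \<and>
              unit_vector ({..<cR j} \<times> {..<aL j}) (\<lambda>(r, l). \<psi>CA j r l)) \<and>
       (\<forall>a\<in>X. \<forall>b\<in>Y. \<forall>c\<in>Z. \<psi> a b c =
          (\<Sum>j<m. complex_of_real (sqrt (p j)) *
            (\<Sum>(lA, rA) \<in> {..<aL j} \<times> {..<aR j}. \<Sum>(lB, rB) \<in> {..<bL j} \<times> {..<bR j}.
             \<Sum>(lC, rC) \<in> {..<cL j} \<times> {..<cR j}.
               UA a (Inr (j, lA, rA)) * UB b (Inr (j, lB, rB)) * UC c (Inr (j, lC, rC)) *
               (\<psi>AB j rA lB * \<psi>BC j rB lC * \<psi>CA j rC lA)))))"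

lemma sum_of_triangle_states_iff:
  "sum_of_triangle_states X Y Z \<psi> \<longleftrightarrow> tripartite_state X Y Z \<psi> \<and> (\<exists>m. triangle_sum m X Y Z \<psi>)"
  unfolding sum_of_triangle_states_def triangle_sum_def ..

lemma unitary_on_reindex:
  assumes "unitary_on X Y U" "bij_betw g Y' Y"
  shows "unitary_on X Y' (\<lambda>x y. U x (g y))"
  unfolding unitary_on_def
proof (intro conjI ballI)
  fix y y' assume "y \<in> Y'" "y' \<in> Y'"
  then show "(\<Sum>x\<in>X. cnj (U x (g y)) * U x (g y')) = (if y = y' then 1 else 0)"
    using assms by (auto simp: unitary_on_def bij_betw_def inj_on_def)
next
  fix x x' assume "x \<in> X" "x' \<in> X"
  then show "(\<Sum>y\<in>Y'. U x (g y) * cnj (U x' (g y))) = (if x = x' then 1 else 0)"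
    using assms(1) by (subst sum.reindex_bij_betw[OF assms(2)]) (auto simp: unitary_on_def)
qed

text \<open>The single weight is 1 by normalisation, and \<open>?g\<close> inserts the constant
  sector label 0.\<close>

lemma triangle_state_if_triangle_sum:
  assumes "tripartite_state X Y Z \<psi>" "triangle_sum 1 X Y Z \<psi>"
  shows "triangle_state X Y Z \<psi>"
proof -
  let ?g = "\<lambda>q :: nat + nat \<times> nat. case q of Inl i \<Rightarrow> Inl i | Inr q \<Rightarrow> Inr (0 :: nat, q)"
  have bij: "bij_betw ?g (split_labels n0 (nL 0) (nR 0)) (sum_split_labels 1 n0 nL nR)" for n0 nL nR
    by (rule bij_betw_byWitness[where f' = "\<lambda>q. case q of Inl i \<Rightarrow> Inl i | Inr (j, q) \<Rightarrow> Inr q"])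
      (auto simp: split_labels_def sum_split_labels_def)
  obtain p a0 aL aR UA b0 bL bR UB c0 cL cR UC \<psi>AB \<psi>BC \<psi>CA where *:
       "unitary_on X (sum_split_labels 1 a0 aL aR) UA"
       "unitary_on Y (sum_split_labels 1 b0 bL bR) UB"
       "unitary_on Z (sum_split_labels 1 c0 cL cR) UC"
       "(\<Sum>j<1. p j) = (1 :: real)"
       "\<forall>a\<in>X. \<forall>b\<in>Y. \<forall>c\<in>Z. \<psi> a b c =
          (\<Sum>j<1. complex_of_real (sqrt (p j)) *
            (\<Sum>(lA, rA) \<in> {..<aL j} \<times> {..<aR j}. \<Sum>(lB, rB) \<in> {..<bL j} \<times> {..<bR j}.
             \<Sum>(lC, rC) \<in> {..<cL j} \<times> {..<cR j}.
               UA a (Inr (j, lA, rA)) * UB b (Inr (j, lB, rB)) * UC c (Inr (j, lC, rC)) *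
               (\<psi>AB j rA lB * \<psi>BC j rB lC * \<psi>CA j rC lA)))"
    by (insert assms(2), unfold triangle_sum_def, elim exE conjE, rule that) assumption+
  have "p 0 = 1" using *(4) by simp
  then have \<psi>: "\<forall>a\<in>X. \<forall>b\<in>Y. \<forall>c\<in>Z. \<psi> a b c =
      (\<Sum>(lA, rA) \<in> {..<aL 0} \<times> {..<aR 0}. \<Sum>(lB, rB) \<in> {..<bL 0} \<times> {..<bR 0}.
       \<Sum>(lC, rC) \<in> {..<cL 0} \<times> {..<cR 0}.
         UA a (?g (Inr (lA, rA))) * UB b (?g (Inr (lB, rB))) * UC c (?g (Inr (lC, rC))) *
         (\<psi>AB 0 rA lB * \<psi>BC 0 rB lC * \<psi>CA 0 rC lA))"
    using *(5) by (simp only: lessThan_Suc_eq_insert_0 One_nat_def lessThan_0 image_empty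
        sum.insert finite.emptyI empty_iff sum.empty real_sqrt_one of_real_1 mult_1 add_0_right sum.case not_False_eq_True)
  note U = unitary_on_reindex[OF *(1) bij] unitary_on_reindex[OF *(2) bij] unitary_on_reindex[OF *(3) bij]
  show ?thesis unfolding triangle_state_def
    by (rule conjI[OF assms(1)], intro exI) (intro conjI, rule U(1), rule U(2), rule U(3), rule \<psi>)
qed

text \<open>The value \<open>undefined\<close> is never taken: with leftover dimension 0 there are
  no \<open>Inl\<close> labels.\<close>

lemma bij_betw_sum_split_labels:
  assumes "bij_betw eL {..<nL} L" "bij_betw eR {..<nR} R"
  shows "bij_betw (\<lambda>q. case q of Inl i \<Rightarrow> undefined | Inr (j, l, r) \<Rightarrow> (j, eL l, eR r))
     (sum_split_labels n 0 (\<lambda>_. nL) (\<lambda>_. nR)) ({..<n} \<times> L \<times> R)"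
proof -
  note inv = bij_betw_inv_into_left[OF assms(1)] bij_betw_inv_into_left[OF assms(2)]
    bij_betw_inv_into_right[OF assms(1)] bij_betw_inv_into_right[OF assms(2)]
  note mem = bij_betwE[OF assms(1)] bij_betwE[OF assms(2)]
    bij_betwE[OF bij_betw_inv_into[OF assms(1)]] bij_betwE[OF bij_betw_inv_into[OF assms(2)]]
  show ?thesis
    by (rule bij_betw_byWitness[where f' = "\<lambda>(j, x, y). Inr (j, inv_into {..<nL} eL x, inv_into {..<nR} eR y)"])
      (use mem in \<open>auto simp: sum_split_labels_def inv\<close>)
qed

text \<open>Factor spaces labelled by arbitrary finite sets, later by configurations, are enumerated
  to obtain the numerical labels of the definition. All sectors share the same factor dimensions and
  nothing is left over. The sums are nested party by party, which suits the successive rewriting of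
  C, B and A.\<close>

lemma triangle_sumI:
  assumes fin: "finite LA" "finite RA" "finite LB" "finite RB" "finite LC" "finite RC"
    and UA: "unitary_on X ({..<n} \<times> LA \<times> RA) UA"
    and UB: "unitary_on Y ({..<n} \<times> LB \<times> RB) UB"
    and UC: "unitary_on Z ({..<n} \<times> LC \<times> RC) UC"
    and p: "\<forall>j<n. p j \<ge> 0" "(\<Sum>j<n. p j) = 1"
    and AB: "\<And>j. j < n \<Longrightarrow> (\<Sum>r\<in>RA. \<Sum>l\<in>LB. cnj (\<chi>AB j r l) * \<chi>AB j r l) = 1"
    and BC: "\<And>j. j < n \<Longrightarrow> (\<Sum>r\<in>RB. \<Sum>l\<in>LC. cnj (\<chi>BC j r l) * \<chi>BC j r l) = 1"
    and CA: "\<And>j. j < n \<Longrightarrow> (\<Sum>r\<in>RC. \<Sum>l\<in>LA. cnj (\<chi>CA j r l) * \<chi>CA j r l) = 1"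
    and \<psi>: "\<And>a b c. a \<in> X \<Longrightarrow> b \<in> Y \<Longrightarrow> c \<in> Z \<Longrightarrow> \<psi> a b c =
       (\<Sum>j<n. complex_of_real (sqrt (p j)) *
          (\<Sum>lA\<in>LA. \<Sum>rA\<in>RA. UA a (j, lA, rA) * (\<Sum>lB\<in>LB. \<Sum>rB\<in>RB. UB b (j, lB, rB) *
            (\<Sum>lC\<in>LC. \<Sum>rC\<in>RC. UC c (j, lC, rC) * (\<chi>AB j rA lB * \<chi>BC j rB lC * \<chi>CA j rC lA)))))"
  shows "triangle_sum n X Y Z \<psi>"
proof -
  have ex: "\<exists>e. bij_betw e {..<card S} S" if "finite S" for S
    using ex_bij_betw_nat_finite[OF that] by (simp add: atLeast0LessThan)
  obtain eLA where eLA: "bij_betw eLA {..<card LA} LA" using ex[OF fin(1)] by blast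
  obtain eRA where eRA: "bij_betw eRA {..<card RA} RA" using ex[OF fin(2)] by blast
  obtain eLB where eLB: "bij_betw eLB {..<card LB} LB" using ex[OF fin(3)] by blast
  obtain eRB where eRB: "bij_betw eRB {..<card RB} RB" using ex[OF fin(4)] by blast
  obtain eLC where eLC: "bij_betw eLC {..<card LC} LC" using ex[OF fin(5)] by blast
  obtain eRC where eRC: "bij_betw eRC {..<card RC} RC" using ex[OF fin(6)] by blast
  note e = eLA eRA eLB eRB eLC eRC
  note re = sum.reindex_bij_betw[OF e(1), symmetric] sum.reindex_bij_betw[OF e(2), symmetric]
    sum.reindex_bij_betw[OF e(3), symmetric] sum.reindex_bij_betw[OF e(4), symmetric]
    sum.reindex_bij_betw[OF e(5), symmetric] sum.reindex_bij_betw[OF e(6), symmetric]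
  let ?g = "\<lambda>eL eR (q :: nat + nat \<times> nat \<times> nat). case q of Inl i \<Rightarrow> undefined | Inr (j, l, r) \<Rightarrow> (j, eL l, eR r)"
  let ?UA = "\<lambda>a q. UA a (?g eLA eRA q)" and ?UB = "\<lambda>b q. UB b (?g eLB eRB q)" and ?UC = "\<lambda>c q. UC c (?g eLC eRC q)"
  let ?AB = "\<lambda>j r l. \<chi>AB j (eRA r) (eLB l)" and ?BC = "\<lambda>j r l. \<chi>BC j (eRB r) (eLC l)" and ?CA = "\<lambda>j r l. \<chi>CA j (eRC r) (eLA l)"
  have 1: "unitary_on X (sum_split_labels n 0 (\<lambda>_. card LA) (\<lambda>_. card RA)) ?UA"
    by (rule unitary_on_reindex[OF UA bij_betw_sum_split_labels[OF e(1,2)]])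
  have 2: "unitary_on Y (sum_split_labels n 0 (\<lambda>_. card LB) (\<lambda>_. card RB)) ?UB"
    by (rule unitary_on_reindex[OF UB bij_betw_sum_split_labels[OF e(3,4)]])
  have 3: "unitary_on Z (sum_split_labels n 0 (\<lambda>_. card LC) (\<lambda>_. card RC)) ?UC"
    by (rule unitary_on_reindex[OF UC bij_betw_sum_split_labels[OF e(5,6)]])
  have 4: "\<forall>j<n. unit_vector ({..<card RA} \<times> {..<card LB}) (\<lambda>(r, l). ?AB j r l) \<and>
              unit_vector ({..<card RB} \<times> {..<card LC}) (\<lambda>(r, l). ?BC j r l) \<and>
              unit_vector ({..<card RC} \<times> {..<card LA}) (\<lambda>(r, l). ?CA j r l)"
    using AB BC CA by (simp only: unit_vector_iff sum.cartesian_product' prod.case re) simp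
  have 5: "\<forall>a\<in>X. \<forall>b\<in>Y. \<forall>c\<in>Z. \<psi> a b c =
          (\<Sum>j<n. complex_of_real (sqrt (p j)) *
            (\<Sum>(lA, rA) \<in> {..<card LA} \<times> {..<card RA}. \<Sum>(lB, rB) \<in> {..<card LB} \<times> {..<card RB}.
             \<Sum>(lC, rC) \<in> {..<card LC} \<times> {..<card RC}.
               ?UA a (Inr (j, lA, rA)) * ?UB b (Inr (j, lB, rB)) * ?UC c (Inr (j, lC, rC)) *
               (?AB j rA lB * ?BC j rB lC * ?CA j rC lA)))"
  proof (intro ballI)
    fix a b c assume abc: "a \<in> X" "b \<in> Y" "c \<in> Z"
    show "\<psi> a b c = (\<Sum>j<n. complex_of_real (sqrt (p j)) *
            (\<Sum>(lA, rA) \<in> {..<card LA} \<times> {..<card RA}. \<Sum>(lB, rB) \<in> {..<card LB} \<times> {..<card RB}.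
             \<Sum>(lC, rC) \<in> {..<card LC} \<times> {..<card RC}.
               ?UA a (Inr (j, lA, rA)) * ?UB b (Inr (j, lB, rB)) * ?UC c (Inr (j, lC, rC)) *
               (?AB j rA lB * ?BC j rB lC * ?CA j rC lA)))"
      unfolding \<psi>[OF abc] re sum.cartesian_product' prod.case sum.case sum_distrib_left mult.assoc ..
  qed
  show ?thesis unfolding triangle_sum_def
    by (intro exI) (intro conjI, rule 1, rule 2, rule 3, rule p(1), rule p(2), rule 4, rule 5)
qed

section \<open>Sectors of one party and the two-stage circuit\<close>

lemma card_configs_Un:
  assumes "S \<inter> T = {}"
  shows "card (configs d (S \<union> T)) = card (configs d S) * card (configs d T)"
  using sum_configs_Un[OF assms, of "\<lambda>_. 1 :: nat" d] by simp

lemma restrict_override_on_same: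
  "\<sigma> \<in> configs d S \<Longrightarrow> restrict (override_on \<tau> \<sigma> S) S = \<sigma>"
  by (auto simp: fun_eq_iff override_on_def configs_def PiE_iff extensional_def)

lemma restrict_override_on_disjoint:
  "S \<inter> T = {} \<Longrightarrow> restrict (override_on \<tau> \<sigma> S) T = restrict \<tau> T"
  by (auto simp: fun_eq_iff override_on_def restrict_def)

text \<open>The label \<open>j\<close> is read off the sites in \<open>H\<close>, which splits the space of a party into sectors
  \<open>|j\<rangle> \<otimes> \<H>\<^sub>L \<otimes> \<H>\<^sub>R\<close>.\<close>

lemma sector_decomposition:
  assumes fin: "finite H" "finite L" "finite R"
    and disj: "H \<inter> L = {}" "H \<inter> R = {}" "L \<inter> R = {}" and A: "A = H \<union> (L \<union> R)"
    and M: "unitary_on (configs d A) (configs d A) M"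
    and P: "unitary_on (configs d H) {..<q::nat} P"
  shows "\<exists>U. unitary_on (configs d A) ({..<q} \<times> configs d L \<times> configs d R) U \<and>
    (\<forall>j<q. \<forall>a G. (\<Sum>\<alpha>\<in>configs d A. M a \<alpha> * (P (restrict \<alpha> H) j * G (restrict \<alpha> L) (restrict \<alpha> R)))
       = (\<Sum>l\<in>configs d L. \<Sum>r\<in>configs d R. U a (j, l, r) * G l r))"
proof -
  have disj': "H \<inter> (L \<union> R) = {}" using disj by auto
  have finA: "finite A" using fin A by simp
  \<comment> \<open>Column (j, l, r) of \<open>K\<close> is the product of column \<open>j\<close>
    of \<open>P\<close> on \<open>H\<close> with the basis states \<open>l\<close> and
    \<open>r\<close>; \<open>M\<close> then acts on it.\<close>
  define K where "K \<alpha> = (\<lambda>(j, l, r). if restrict \<alpha> L = l \<and> restrict \<alpha> R = r then P (restrict \<alpha> H) j else 0)" for \<alpha>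
  have "isometry_on (configs d A) ({..<q} \<times> configs d L \<times> configs d R) K"
    unfolding isometry_on_def
  proof (intro ballI)
    fix i i' assume i: "i \<in> {..<q} \<times> configs d L \<times> configs d R" "i' \<in> {..<q} \<times> configs d L \<times> configs d R"
    obtain j l r j' l' r' where [simp]: "i = (j, l, r)" "i' = (j', l', r')" by (cases i, cases i') auto
    have "(\<Sum>\<alpha>\<in>configs d A. cnj (K \<alpha> i) * K \<alpha> i') = (\<Sum>h\<in>configs d H. \<Sum>l0\<in>configs d L. \<Sum>r0\<in>configs d R.
        if r0 = r then if l0 = l then if l = l' \<and> r = r' then cnj (P h j) * P h j' else 0 else 0 else 0)"
      unfolding A sum_configs_Un[OF disj'] sum_configs_Un[OF disj(3)]
    proof (intro sum.cong refl)
      fix h l0 r0 assume h: "h \<in> configs d H" and l0: "l0 \<in> configs d L" and r0: "r0 \<in> configs d R"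
      let ?\<alpha> = "override_on (override_on r0 l0 L) h H"
      have "restrict ?\<alpha> H = h" using h by (rule restrict_override_on_same)
      moreover have "restrict ?\<alpha> L = l0"
        using l0 disj(1) by (simp add: restrict_override_on_same restrict_override_on_disjoint)
      moreover have "restrict ?\<alpha> R = r0"
        using r0 disj by (simp add: restrict_configs_id restrict_override_on_disjoint)
      ultimately show "cnj (K ?\<alpha> i) * K ?\<alpha> i' =
        (if r0 = r then if l0 = l then if l = l' \<and> r = r' then cnj (P h j) * P h j' else 0 else 0 else 0)"
        by (auto simp: K_def)
    qed
    also have "\<dots> = (\<Sum>h\<in>configs d H. if l = l' \<and> r = r' then cnj (P h j) * P h j' else 0)"
      using i fin by simp
    also have "\<dots> = (if i = i' then 1 else 0)"
      using isometry_onD[OF unitary_on_isometry[OF P], of j j'] i by (cases "l = l' \<and> r = r'") auto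
    finally show "(\<Sum>\<alpha>\<in>configs d A. cnj (K \<alpha> i) * K \<alpha> i') = (if i = i' then 1 else 0)" .
  qed
  then have "isometry_on (configs d A) ({..<q} \<times> configs d L \<times> configs d R) (\<lambda>a i. \<Sum>\<alpha>\<in>configs d A. M a \<alpha> * K \<alpha> i)"
    using fin finA by (intro isometry_on_mult unitary_on_isometry[OF M]) auto
  \<comment> \<open>\<open>H\<close> has exactly \<open>q\<close> basis states because
    \<open>P\<close> is unitary, so the sectors exhaust the space of the party.\<close>
  moreover have "card (configs d A) = card ({..<q} \<times> configs d L \<times> configs d R)"
    using unitary_on_card[OF P] by (simp add: A card_configs_Un disj' disj card_cartesian_product)
  ultimately have "unitary_on (configs d A) ({..<q} \<times> configs d L \<times> configs d R) (\<lambda>a i. \<Sum>\<alpha>\<in>configs d A. M a \<alpha> * K \<alpha> i)"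
    using fin finA by (intro isometry_on_unitary) auto
  moreover have "(\<Sum>l\<in>configs d L. \<Sum>r\<in>configs d R. (\<Sum>\<alpha>\<in>configs d A. M a \<alpha> * K \<alpha> (j, l, r)) * G l r)
     = (\<Sum>\<alpha>\<in>configs d A. M a \<alpha> * (P (restrict \<alpha> H) j * G (restrict \<alpha> L) (restrict \<alpha> R)))" for a j G
  proof -
    have "(\<Sum>l\<in>configs d L. \<Sum>r\<in>configs d R. (\<Sum>\<alpha>\<in>configs d A. M a \<alpha> * K \<alpha> (j, l, r)) * G l r)
       = (\<Sum>l\<in>configs d L. \<Sum>\<alpha>\<in>configs d A. \<Sum>r\<in>configs d R. M a \<alpha> * K \<alpha> (j, l, r) * G l r)"
      unfolding sum_distrib_right by (rule sum.cong[OF refl], rule sum.swap)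
    also have "\<dots> = (\<Sum>\<alpha>\<in>configs d A. \<Sum>l\<in>configs d L. \<Sum>r\<in>configs d R. M a \<alpha> * K \<alpha> (j, l, r) * G l r)"
      by (rule sum.swap)
    also have "\<dots> = (\<Sum>\<alpha>\<in>configs d A. \<Sum>l\<in>configs d L. \<Sum>r\<in>configs d R.
        if restrict \<alpha> R = r then if restrict \<alpha> L = l then M a \<alpha> * (P (restrict \<alpha> H) j * G (restrict \<alpha> L) (restrict \<alpha> R)) else 0 else 0)"
      by (intro sum.cong refl) (auto simp: K_def)
    also have "\<dots> = (\<Sum>\<alpha>\<in>configs d A. M a \<alpha> * (P (restrict \<alpha> H) j * G (restrict \<alpha> L) (restrict \<alpha> R)))"
    proof (rule sum.cong[OF refl])
      fix \<alpha> assume "\<alpha> \<in> configs d A"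
      then have "restrict \<alpha> L \<in> configs d L" "restrict \<alpha> R \<in> configs d R"
        by (auto simp: A intro: restrict_configs)
      then show "(\<Sum>l\<in>configs d L. \<Sum>r\<in>configs d R.
        if restrict \<alpha> R = r then if restrict \<alpha> L = l then M a \<alpha> * (P (restrict \<alpha> H) j * G (restrict \<alpha> L) (restrict \<alpha> R)) else 0 else 0)
        = M a \<alpha> * (P (restrict \<alpha> H) j * G (restrict \<alpha> L) (restrict \<alpha> R))"
        using fin by simp
    qed
    finally show ?thesis .
  qed
  ultimately show ?thesis
    by (intro exI[of _ "\<lambda>a i. \<Sum>\<alpha>\<in>configs d A. M a \<alpha> * K \<alpha> i"] conjI allI impI) (simp_all only:)
qed

lemma prod_depends_on: "S \<subseteq> T \<Longrightarrow> depends_on T (\<lambda>\<sigma>. \<Prod>s\<in>S. v s (\<sigma> s))"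
  unfolding depends_on_def by (intro allI impI prod.cong) auto

text \<open>A circuit that factors into a first stage \<open>W\<close>, each of whose parts straddles only one of the
  three cuts, and a second stage \<open>V\<close> local to the parties.\<close>

locale factorized_circuit =
  fixes d :: "site \<Rightarrow> nat" and A B C HA LA RA HB LB RB HC LC RC :: "site set"
    and VA VB VC WAB WBC WCA :: "(config \<Rightarrow> complex) \<Rightarrow> config \<Rightarrow> complex"
    and q :: nat and p :: "nat \<Rightarrow> real" and v :: "nat \<Rightarrow> site \<Rightarrow> nat \<Rightarrow> complex"
    and \<phi> :: "config \<Rightarrow> complex"
  assumes A: "A = HA \<union> (LA \<union> RA)" and B: "B = HB \<union> (LB \<union> RB)" and C: "C = HC \<union> (LC \<union> RC)"
    and fin: "finite A" "finite B" "finite C"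
    and disj: "A \<inter> B = {}" "A \<inter> C = {}" "B \<inter> C = {}"
      "HA \<inter> LA = {}" "HA \<inter> RA = {}" "LA \<inter> RA = {}"
      "HB \<inter> LB = {}" "HB \<inter> RB = {}" "LB \<inter> RB = {}"
      "HC \<inter> LC = {}" "HC \<inter> RC = {}" "LC \<inter> RC = {}"
    and V: "circuit_on d {A} VA" "circuit_on d {B} VB" "circuit_on d {C} VC"
    and W: "circuit_on d {RA \<union> LB} WAB" "circuit_on d {RB \<union> LC} WBC" "circuit_on d {RC \<union> LA} WCA"
    and p: "\<And>j. j < q \<Longrightarrow> p j \<ge> 0" "(\<Sum>j<q. p j) = 1"
    and unit: "\<And>j s. j < q \<Longrightarrow> s \<in> A \<union> B \<union> C \<Longrightarrow> (\<Sum>i<d s. cnj (v j s i) * v j s i) = 1"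
    and sectors: "unitary_on (configs d HA) {..<q} (\<lambda>h j. \<Prod>s\<in>HA. v j s (h s))"
      "unitary_on (configs d HB) {..<q} (\<lambda>h j. \<Prod>s\<in>HB. v j s (h s))"
      "unitary_on (configs d HC) {..<q} (\<lambda>h j. \<Prod>s\<in>HC. v j s (h s))"
    and \<phi>: "\<phi> = (\<lambda>\<sigma>. \<Sum>j<q. complex_of_real (sqrt (p j)) * (\<Prod>s\<in>A \<union> (B \<union> C). v j s (\<sigma> s)))"
begin

definition prd :: "site set \<Rightarrow> nat \<Rightarrow> config \<Rightarrow> complex" where
  "prd S j \<sigma> = (\<Prod>s\<in>S. v j s (\<sigma> s))"

lemma prd_Un: "finite S \<Longrightarrow> finite T \<Longrightarrow> S \<inter> T = {} \<Longrightarrow> prd (S \<union> T) j \<sigma> = prd S j \<sigma> * prd T j \<sigma>"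
  by (simp add: prd_def prod.union_disjoint)

lemma prd_depends_on: "depends_on S (prd S j)"
  unfolding prd_def by (rule prod_depends_on) simp

lemma fin_parts: "finite HA" "finite LA" "finite RA" "finite HB" "finite LB" "finite RB"
  "finite HC" "finite LC" "finite RC"
  using fin by (auto simp: A B C)

lemma disj_parts:
  "HA \<inter> (LA \<union> RA) = {}" "HB \<inter> (LB \<union> RB) = {}" "HC \<inter> (LC \<union> RC) = {}"
  "RA \<inter> LB = {}" "RB \<inter> LC = {}" "RC \<inter> LA = {}"
  using disj by (auto simp: A B C)

lemma prd_sites: "prd (A \<union> (B \<union> C)) j \<sigma>
   = (prd HA j \<sigma> * prd HB j \<sigma> * prd HC j \<sigma>) * prd (RA \<union> LB) j \<sigma> * prd (RB \<union> LC) j \<sigma> * prd (RC \<union> LA) j \<sigma>"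
proof -
  have "prd (A \<union> (B \<union> C)) j \<sigma> = prd A j \<sigma> * (prd B j \<sigma> * prd C j \<sigma>)"
    using fin disj by (simp add: prd_Un Int_Un_distrib)
  moreover have "prd A j \<sigma> = prd HA j \<sigma> * (prd LA j \<sigma> * prd RA j \<sigma>)"
    "prd B j \<sigma> = prd HB j \<sigma> * (prd LB j \<sigma> * prd RB j \<sigma>)"
    "prd C j \<sigma> = prd HC j \<sigma> * (prd LC j \<sigma> * prd RC j \<sigma>)"
    using fin_parts disj disj_parts by (simp_all add: A B C prd_Un)
  moreover have "prd (RA \<union> LB) j \<sigma> = prd RA j \<sigma> * prd LB j \<sigma>"
    "prd (RB \<union> LC) j \<sigma> = prd RB j \<sigma> * prd LC j \<sigma>" "prd (RC \<union> LA) j \<sigma> = prd RC j \<sigma> * prd LA j \<sigma>"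
    using fin_parts disj_parts by (simp_all add: prd_Un)
  ultimately show ?thesis by (simp add: mult_ac)
qed

text \<open>The pair vectors that the first stage makes from the j-th product vector, as functions
  of global configurations; \<open>\<omega>AB\<close> and its companions below are the same vectors
  with separate right and left labels.\<close>

definition "\<Omega>AB j = WAB (prd (RA \<union> LB) j)"
definition "\<Omega>BC j = WBC (prd (RB \<union> LC) j)"
definition "\<Omega>CA j = WCA (prd (RC \<union> LA) j)"

lemma \<Omega>_depends_on:
  "depends_on (RA \<union> LB) (\<Omega>AB j)" "depends_on (RB \<union> LC) (\<Omega>BC j)" "depends_on (RC \<union> LA) (\<Omega>CA j)"
  unfolding \<Omega>AB_def \<Omega>BC_def \<Omega>CA_def
  by (auto intro!: circuit_on_depends_on[OF W(1)] circuit_on_depends_on[OF W(2)]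
      circuit_on_depends_on[OF W(3)] prd_depends_on)

text \<open>Each part of the first stage acts on its own pair factor, and
  \<open>circuit_on_factor\<close> takes the others out; the sites in \<open>HA\<close>,
  \<open>HB\<close>, \<open>HC\<close> are touched by none.\<close>

lemma W_product:
  "WAB (WBC (WCA (prd (A \<union> (B \<union> C)) j)))
    = (\<lambda>\<sigma>. (prd HA j \<sigma> * prd HB j \<sigma> * prd HC j \<sigma>) * (\<Omega>AB j \<sigma> * \<Omega>BC j \<sigma> * \<Omega>CA j \<sigma>))"
proof -
  let ?H = "\<lambda>\<sigma>. prd HA j \<sigma> * prd HB j \<sigma> * prd HC j \<sigma>"
  have H: "depends_on (HA \<union> HB \<union> HC) ?H" by (intro depends_on_mult prd_depends_on)
  have 1: "depends_on (HA \<union> HB \<union> HC \<union> (RA \<union> LB) \<union> (RB \<union> LC)) (\<lambda>\<sigma>. ?H \<sigma> * prd (RA \<union> LB) j \<sigma> * prd (RB \<union> LC) j \<sigma>)"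
    and 2: "depends_on (HA \<union> HB \<union> HC \<union> (RA \<union> LB) \<union> (RC \<union> LA)) (\<lambda>\<sigma>. ?H \<sigma> * prd (RA \<union> LB) j \<sigma> * \<Omega>CA j \<sigma>)"
    and 3: "depends_on (HA \<union> HB \<union> HC \<union> (RC \<union> LA) \<union> (RB \<union> LC)) (\<lambda>\<sigma>. ?H \<sigma> * \<Omega>CA j \<sigma> * \<Omega>BC j \<sigma>)"
    by (intro depends_on_mult H prd_depends_on \<Omega>_depends_on)+
  have "WCA (prd (A \<union> (B \<union> C)) j) = (\<lambda>\<sigma>. (?H \<sigma> * prd (RA \<union> LB) j \<sigma> * prd (RB \<union> LC) j \<sigma>) * \<Omega>CA j \<sigma>)"
    unfolding \<Omega>CA_def prd_sites[abs_def]
    by (rule circuit_on_factor[OF W(3) 1]) (use disj in \<open>auto simp: A B C\<close>)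
  also have "\<dots> = (\<lambda>\<sigma>. (?H \<sigma> * prd (RA \<union> LB) j \<sigma> * \<Omega>CA j \<sigma>) * prd (RB \<union> LC) j \<sigma>)"
    by (simp add: mult_ac)
  finally have "WBC (WCA (prd (A \<union> (B \<union> C)) j)) = WBC \<dots>" by simp
  also have "\<dots> = (\<lambda>\<sigma>. (?H \<sigma> * prd (RA \<union> LB) j \<sigma> * \<Omega>CA j \<sigma>) * \<Omega>BC j \<sigma>)"
    unfolding \<Omega>BC_def by (rule circuit_on_factor[OF W(2) 2]) (use disj in \<open>auto simp: A B C\<close>)
  also have "\<dots> = (\<lambda>\<sigma>. (?H \<sigma> * \<Omega>CA j \<sigma> * \<Omega>BC j \<sigma>) * prd (RA \<union> LB) j \<sigma>)"
    by (simp add: mult_ac)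
  finally have "WAB (WBC (WCA (prd (A \<union> (B \<union> C)) j))) = WAB \<dots>" by simp
  also have "\<dots> = (\<lambda>\<sigma>. (?H \<sigma> * \<Omega>CA j \<sigma> * \<Omega>BC j \<sigma>) * \<Omega>AB j \<sigma>)"
    unfolding \<Omega>AB_def by (rule circuit_on_factor[OF W(1) 3]) (use disj in \<open>auto simp: A B C\<close>)
  finally show ?thesis by (simp add: mult_ac)
qed

definition "\<chi> = WAB (WBC (WCA \<phi>))"
definition "\<psi> = VA (VB (VC \<chi>))"
definition "glue a b c = override_on (override_on c b B) a A"

definition "\<omega>AB j r l = \<Omega>AB j (override_on l r RA)"
definition "\<omega>BC j r l = \<Omega>BC j (override_on l r RB)"
definition "\<omega>CA j r l = \<Omega>CA j (override_on l r RC)"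

lemma \<omega>_unit:
  assumes j: "j < q"
  shows "(\<Sum>r\<in>configs d RA. \<Sum>l\<in>configs d LB. cnj (\<omega>AB j r l) * \<omega>AB j r l) = 1"
    and "(\<Sum>r\<in>configs d RB. \<Sum>l\<in>configs d LC. cnj (\<omega>BC j r l) * \<omega>BC j r l) = 1"
    and "(\<Sum>r\<in>configs d RC. \<Sum>l\<in>configs d LA. cnj (\<omega>CA j r l) * \<omega>CA j r l) = 1"
proof -
  have unit': "(\<Sum>\<sigma>\<in>configs d S. cnj (F (prd S j) \<sigma>) * F (prd S j) \<sigma>) = 1"
    if "circuit_on d {S} F" "S \<subseteq> A \<union> B \<union> C" for S F
  proof -
    have finS: "finite S" using that(2) fin by (meson finite_UnI finite_subset)
    have "(\<Sum>\<sigma>\<in>configs d S. cnj (F (prd S j) \<sigma>) * F (prd S j) \<sigma>) = (\<Sum>\<sigma>\<in>configs d S. cnj (prd S j \<sigma>) * prd S j \<sigma>)"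
      by (rule circuit_on_inner[OF that(1) finS]) simp
    also have "\<dots> = (\<Prod>s\<in>S. \<Sum>i<d s. cnj (v j s i) * v j s i)"
      unfolding prd_def by (rule sum_configs_prod_inner[OF finS])
    also have "\<dots> = 1" using unit[OF j] that(2) by (intro prod.neutral) blast
    finally show ?thesis .
  qed
  show "(\<Sum>r\<in>configs d RA. \<Sum>l\<in>configs d LB. cnj (\<omega>AB j r l) * \<omega>AB j r l) = 1"
    using unit'[OF W(1)] unfolding \<omega>AB_def \<Omega>AB_def sum_configs_Un[OF disj_parts(4)] by (auto simp: A B C)
  show "(\<Sum>r\<in>configs d RB. \<Sum>l\<in>configs d LC. cnj (\<omega>BC j r l) * \<omega>BC j r l) = 1"
    using unit'[OF W(2)] unfolding \<omega>BC_def \<Omega>BC_def sum_configs_Un[OF disj_parts(5)] by (auto simp: A B C)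
  show "(\<Sum>r\<in>configs d RC. \<Sum>l\<in>configs d LA. cnj (\<omega>CA j r l) * \<omega>CA j r l) = 1"
    using unit'[OF W(3)] unfolding \<omega>CA_def \<Omega>CA_def sum_configs_Un[OF disj_parts(6)] by (auto simp: A B C)
qed

lemma \<chi>_glue:
  "\<chi> (glue \<alpha> \<beta> \<gamma>) = (\<Sum>j<q. complex_of_real (sqrt (p j)) *
      (prd HA j (restrict \<alpha> HA) * prd HB j (restrict \<beta> HB) * prd HC j (restrict \<gamma> HC) *
       (\<omega>AB j (restrict \<alpha> RA) (restrict \<beta> LB) * \<omega>BC j (restrict \<beta> RB) (restrict \<gamma> LC)
        * \<omega>CA j (restrict \<gamma> RC) (restrict \<alpha> LA))))"
proof -
  have WW: "\<chi> = (\<lambda>\<sigma>. \<Sum>j<q. complex_of_real (sqrt (p j)) * WAB (WBC (WCA (prd (A \<union> (B \<union> C)) j))) \<sigma>)"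
    unfolding \<chi>_def unfolding \<phi> prd_def[symmetric]
    by (simp only: circuit_on_linear[OF W(1)] circuit_on_linear[OF W(2)] circuit_on_linear[OF W(3)])
  let ?\<tau> = "glue \<alpha> \<beta> \<gamma>"
  have H: "prd HA j ?\<tau> = prd HA j (restrict \<alpha> HA)" "prd HB j ?\<tau> = prd HB j (restrict \<beta> HB)"
    "prd HC j ?\<tau> = prd HC j (restrict \<gamma> HC)" for j
    unfolding glue_def using disj
    by (auto intro!: depends_onD[OF prd_depends_on] simp: A B C override_on_def)
  have "\<Omega>AB j ?\<tau> = \<omega>AB j (restrict \<alpha> RA) (restrict \<beta> LB)" for j
    unfolding \<omega>AB_def glue_def using disj by (intro depends_onD[OF \<Omega>_depends_on(1)]) (auto simp: A B C override_on_def)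
  moreover have "\<Omega>BC j ?\<tau> = \<omega>BC j (restrict \<beta> RB) (restrict \<gamma> LC)" for j
    unfolding \<omega>BC_def glue_def using disj by (intro depends_onD[OF \<Omega>_depends_on(2)]) (auto simp: A B C override_on_def)
  moreover have "\<Omega>CA j ?\<tau> = \<omega>CA j (restrict \<gamma> RC) (restrict \<alpha> LA)" for j
    unfolding \<omega>CA_def glue_def using disj by (intro depends_onD[OF \<Omega>_depends_on(3)]) (auto simp: A B C override_on_def)
  ultimately show ?thesis unfolding WW W_product H by simp
qed

text \<open>The second stage becomes three matrices, into which \<open>sector_decomposition\<close>
  absorbs the vectors on \<open>HA\<close>, \<open>HB\<close>, \<open>HC\<close>; what remains is
  the product of the three pair vectors.\<close>

lemma triangle_sum_\<psi>:
  "triangle_sum q (configs d A) (configs d B) (configs d C) (\<lambda>a b c. \<psi> (glue a b c))"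
proof -
  obtain MA where MA: "unitary_on (configs d A) (configs d A) MA"
    and VA: "\<And>f \<sigma>. restrict \<sigma> A \<in> configs d A \<Longrightarrow> VA f \<sigma> = apply_gate d A MA f \<sigma>"
    using circuit_on_matrix[OF V(1) fin(1)] by blast
  obtain MB where MB: "unitary_on (configs d B) (configs d B) MB"
    and VB: "\<And>f \<sigma>. restrict \<sigma> B \<in> configs d B \<Longrightarrow> VB f \<sigma> = apply_gate d B MB f \<sigma>"
    using circuit_on_matrix[OF V(2) fin(2)] by blast
  obtain MC where MC: "unitary_on (configs d C) (configs d C) MC"
    and VC: "\<And>f \<sigma>. restrict \<sigma> C \<in> configs d C \<Longrightarrow> VC f \<sigma> = apply_gate d C MC f \<sigma>"
    using circuit_on_matrix[OF V(3) fin(3)] by blast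
  have sectors': "unitary_on (configs d HA) {..<q} (\<lambda>h j. prd HA j h)"
    "unitary_on (configs d HB) {..<q} (\<lambda>h j. prd HB j h)"
    "unitary_on (configs d HC) {..<q} (\<lambda>h j. prd HC j h)"
    unfolding prd_def by (fact sectors)+
  obtain UA where UA: "unitary_on (configs d A) ({..<q} \<times> configs d LA \<times> configs d RA) UA"
    and UA_eq: "\<forall>j<q. \<forall>a G. (\<Sum>\<alpha>\<in>configs d A. MA a \<alpha> * (prd HA j (restrict \<alpha> HA) * G (restrict \<alpha> LA) (restrict \<alpha> RA)))
       = (\<Sum>l\<in>configs d LA. \<Sum>r\<in>configs d RA. UA a (j, l, r) * G l r)"
    using sector_decomposition[OF fin_parts(1-3) disj(4-6) A MA sectors'(1)]
    by (elim exE conjE) (rule that, assumption+)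
  obtain UB where UB: "unitary_on (configs d B) ({..<q} \<times> configs d LB \<times> configs d RB) UB"
    and UB_eq: "\<forall>j<q. \<forall>a G. (\<Sum>\<alpha>\<in>configs d B. MB a \<alpha> * (prd HB j (restrict \<alpha> HB) * G (restrict \<alpha> LB) (restrict \<alpha> RB)))
       = (\<Sum>l\<in>configs d LB. \<Sum>r\<in>configs d RB. UB a (j, l, r) * G l r)"
    using sector_decomposition[OF fin_parts(4-6) disj(7-9) B MB sectors'(2)]
    by (elim exE conjE) (rule that, assumption+)
  obtain UC where UC: "unitary_on (configs d C) ({..<q} \<times> configs d LC \<times> configs d RC) UC"
    and UC_eq: "\<forall>j<q. \<forall>a G. (\<Sum>\<alpha>\<in>configs d C. MC a \<alpha> * (prd HC j (restrict \<alpha> HC) * G (restrict \<alpha> LC) (restrict \<alpha> RC)))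
       = (\<Sum>l\<in>configs d LC. \<Sum>r\<in>configs d RC. UC a (j, l, r) * G l r)"
    using sector_decomposition[OF fin_parts(7-9) disj(10-12) C MC sectors'(3)]
    by (elim exE conjE) (rule that, assumption+)
  show ?thesis
  proof (rule triangle_sumI[OF _ _ _ _ _ _ UA UB UC])
    fix a b c assume abc: "a \<in> configs d A" "b \<in> configs d B" "c \<in> configs d C"
    have ra: "restrict (glue a b c) A = a"
      using abc by (simp add: glue_def restrict_override_on_same)
    have rb: "restrict (override_on (glue a b c) \<alpha> A) B = b" for \<alpha>
      using abc disj by (simp add: glue_def restrict_override_on_same restrict_override_on_disjoint)
    have rc: "restrict (override_on (override_on (glue a b c) \<alpha> A) \<beta> B) C = c" for \<alpha> \<beta>
      using abc disj by (simp add: glue_def restrict_configs_id restrict_override_on_disjoint)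
    \<comment> \<open>Once all three parties are overwritten, only the common default
      \<open>undefined\<close> off their sites survives from the old labels.\<close>
    have g: "override_on (override_on (override_on (glue a b c) \<alpha> A) \<beta> B) \<gamma> C = glue \<alpha> \<beta> \<gamma>"
      if "\<gamma> \<in> configs d C" for \<alpha> \<beta> \<gamma>
      using abc that disj
      by (auto simp: glue_def override_on_def fun_eq_iff configs_def PiE_iff extensional_def)
    let ?w = "\<lambda>j \<alpha> \<beta> \<gamma>. \<omega>AB j (restrict \<alpha> RA) (restrict \<beta> LB) * \<omega>BC j (restrict \<beta> RB) (restrict \<gamma> LC)
        * \<omega>CA j (restrict \<gamma> RC) (restrict \<alpha> LA)"
    have "\<psi> (glue a b c) = (\<Sum>\<alpha>\<in>configs d A. MA a \<alpha> * (\<Sum>\<beta>\<in>configs d B. MB b \<beta> *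
        (\<Sum>\<gamma>\<in>configs d C. MC c \<gamma> * \<chi> (glue \<alpha> \<beta> \<gamma>))))"
      unfolding \<psi>_def using abc by (simp add: VA VB VC ra rb rc g apply_gate_def)
    also have "\<dots> = (\<Sum>\<alpha>\<in>configs d A. \<Sum>\<beta>\<in>configs d B. \<Sum>\<gamma>\<in>configs d C. \<Sum>j<q. complex_of_real (sqrt (p j)) *
        (MA a \<alpha> * (prd HA j (restrict \<alpha> HA) * (MB b \<beta> * (prd HB j (restrict \<beta> HB) *
          (MC c \<gamma> * (prd HC j (restrict \<gamma> HC) * ?w j \<alpha> \<beta> \<gamma>)))))))"
      unfolding \<chi>_glue sum_distrib_left by (simp add: mult_ac)
    also have "\<dots> = (\<Sum>j<q. \<Sum>\<alpha>\<in>configs d A. \<Sum>\<beta>\<in>configs d B. \<Sum>\<gamma>\<in>configs d C. complex_of_real (sqrt (p j)) *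
        (MA a \<alpha> * (prd HA j (restrict \<alpha> HA) * (MB b \<beta> * (prd HB j (restrict \<beta> HB) *
          (MC c \<gamma> * (prd HC j (restrict \<gamma> HC) * ?w j \<alpha> \<beta> \<gamma>)))))))"
      by (simp only: sum.swap[of _ "{..<q}"])
    also have "\<dots> = (\<Sum>j<q. complex_of_real (sqrt (p j)) *
        (\<Sum>\<alpha>\<in>configs d A. MA a \<alpha> * (prd HA j (restrict \<alpha> HA) *
          (\<Sum>\<beta>\<in>configs d B. MB b \<beta> * (prd HB j (restrict \<beta> HB) *
            (\<Sum>\<gamma>\<in>configs d C. MC c \<gamma> * (prd HC j (restrict \<gamma> HC) * ?w j \<alpha> \<beta> \<gamma>)))))))"
      by (simp only: sum_distrib_left)
    also have "\<dots> = (\<Sum>j<q. complex_of_real (sqrt (p j)) *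
          (\<Sum>lA\<in>configs d LA. \<Sum>rA\<in>configs d RA. UA a (j, lA, rA) * (\<Sum>lB\<in>configs d LB. \<Sum>rB\<in>configs d RB. UB b (j, lB, rB) *
            (\<Sum>lC\<in>configs d LC. \<Sum>rC\<in>configs d RC. UC c (j, lC, rC) * (\<omega>AB j rA lB * \<omega>BC j rB lC * \<omega>CA j rC lA)))))"
    proof (rule sum.cong[OF refl], rule arg_cong2[where f = "(*)", OF refl])
      fix j assume "j \<in> {..<q}"
      then have j: "j < q" by simp
      \<comment> \<open>Rewriting from the inside out: C, then B, then A, each time with the
        expression obtained so far in the role of \<open>G\<close>.\<close>
      have "(\<Sum>\<gamma>\<in>configs d C. MC c \<gamma> * (prd HC j (restrict \<gamma> HC) * ?w j \<alpha> \<beta> \<gamma>))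
         = (\<Sum>lC\<in>configs d LC. \<Sum>rC\<in>configs d RC. UC c (j, lC, rC) * (\<omega>AB j (restrict \<alpha> RA) (restrict \<beta> LB)
              * \<omega>BC j (restrict \<beta> RB) lC * \<omega>CA j rC (restrict \<alpha> LA)))" for \<alpha> \<beta>
        using UC_eq[rule_format, OF j, of c "\<lambda>l r. \<omega>AB j (restrict \<alpha> RA) (restrict \<beta> LB) * \<omega>BC j (restrict \<beta> RB) l * \<omega>CA j r (restrict \<alpha> LA)"] .
      moreover have "(\<Sum>\<beta>\<in>configs d B. MB b \<beta> * (prd HB j (restrict \<beta> HB) *
           (\<Sum>lC\<in>configs d LC. \<Sum>rC\<in>configs d RC. UC c (j, lC, rC) * (\<omega>AB j (restrict \<alpha> RA) (restrict \<beta> LB)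
              * \<omega>BC j (restrict \<beta> RB) lC * \<omega>CA j rC (restrict \<alpha> LA)))))
         = (\<Sum>lB\<in>configs d LB. \<Sum>rB\<in>configs d RB. UB b (j, lB, rB) *
           (\<Sum>lC\<in>configs d LC. \<Sum>rC\<in>configs d RC. UC c (j, lC, rC) * (\<omega>AB j (restrict \<alpha> RA) lB
              * \<omega>BC j rB lC * \<omega>CA j rC (restrict \<alpha> LA))))" for \<alpha>
        using UB_eq[rule_format, OF j, of b "\<lambda>l r. (\<Sum>lC\<in>configs d LC. \<Sum>rC\<in>configs d RC. UC c (j, lC, rC) * (\<omega>AB j (restrict \<alpha> RA) l
              * \<omega>BC j r lC * \<omega>CA j rC (restrict \<alpha> LA)))"] .
      moreover have "(\<Sum>\<alpha>\<in>configs d A. MA a \<alpha> * (prd HA j (restrict \<alpha> HA) *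
           (\<Sum>lB\<in>configs d LB. \<Sum>rB\<in>configs d RB. UB b (j, lB, rB) *
           (\<Sum>lC\<in>configs d LC. \<Sum>rC\<in>configs d RC. UC c (j, lC, rC) * (\<omega>AB j (restrict \<alpha> RA) lB
              * \<omega>BC j rB lC * \<omega>CA j rC (restrict \<alpha> LA))))))
         = (\<Sum>lA\<in>configs d LA. \<Sum>rA\<in>configs d RA. UA a (j, lA, rA) * (\<Sum>lB\<in>configs d LB. \<Sum>rB\<in>configs d RB. UB b (j, lB, rB) *
            (\<Sum>lC\<in>configs d LC. \<Sum>rC\<in>configs d RC. UC c (j, lC, rC) * (\<omega>AB j rA lB * \<omega>BC j rB lC * \<omega>CA j rC lA))))"
        using UA_eq[rule_format, OF j, of a "\<lambda>l r. (\<Sum>lB\<in>configs d LB. \<Sum>rB\<in>configs d RB. UB b (j, lB, rB) *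
           (\<Sum>lC\<in>configs d LC. \<Sum>rC\<in>configs d RC. UC c (j, lC, rC) * (\<omega>AB j r lB
              * \<omega>BC j rB lC * \<omega>CA j rC l)))"] .
      ultimately show "(\<Sum>\<alpha>\<in>configs d A. MA a \<alpha> * (prd HA j (restrict \<alpha> HA) *
          (\<Sum>\<beta>\<in>configs d B. MB b \<beta> * (prd HB j (restrict \<beta> HB) *
            (\<Sum>\<gamma>\<in>configs d C. MC c \<gamma> * (prd HC j (restrict \<gamma> HC) * ?w j \<alpha> \<beta> \<gamma>))))))
        = (\<Sum>lA\<in>configs d LA. \<Sum>rA\<in>configs d RA. UA a (j, lA, rA) * (\<Sum>lB\<in>configs d LB. \<Sum>rB\<in>configs d RB. UB b (j, lB, rB) *
            (\<Sum>lC\<in>configs d LC. \<Sum>rC\<in>configs d RC. UC c (j, lC, rC) * (\<omega>AB j rA lB * \<omega>BC j rB lC * \<omega>CA j rC lA))))"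
        by (simp only:)
    qed
    finally show "\<psi> (glue a b c) = (\<Sum>j<q. complex_of_real (sqrt (p j)) *
          (\<Sum>lA\<in>configs d LA. \<Sum>rA\<in>configs d RA. UA a (j, lA, rA) * (\<Sum>lB\<in>configs d LB. \<Sum>rB\<in>configs d RB. UB b (j, lB, rB) *
            (\<Sum>lC\<in>configs d LC. \<Sum>rC\<in>configs d RC. UC c (j, lC, rC) * (\<omega>AB j rA lB * \<omega>BC j rB lC * \<omega>CA j rC lA)))))" .
  qed (simp_all add: p \<omega>_unit fin_parts)
qed

text \<open>All stages are unitary, so the norm is that of the input. Its product vectors are
  orthonormal, since for different \<open>j\<close> they are orthogonal already on
  \<open>HA\<close>.\<close>

lemma tripartite_state_\<psi>:
  "tripartite_state (configs d A) (configs d B) (configs d C) (\<lambda>a b c. \<psi> (glue a b c))"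
proof -
  let ?T = "A \<union> (B \<union> C)"
  have finT: "finite ?T" using fin by simp
  note inner = circuit_on_inner[where T = ?T]
  have "(\<Sum>\<sigma>\<in>configs d ?T. cnj (\<psi> \<sigma>) * \<psi> \<sigma>) = (\<Sum>\<sigma>\<in>configs d ?T. cnj (\<phi> \<sigma>) * \<phi> \<sigma>)"
    unfolding \<psi>_def \<chi>_def
    by (subst inner[OF V(1) finT], force, subst inner[OF V(2) finT], force, subst inner[OF V(3) finT], force,
        subst inner[OF W(1) finT], force simp: A B C, subst inner[OF W(2) finT], force simp: A B C,
        subst inner[OF W(3) finT], force simp: A B C, rule refl)
  also have "\<dots> = (\<Sum>\<sigma>\<in>configs d ?T. \<Sum>j<q. \<Sum>j'<q.
       complex_of_real (sqrt (p j) * sqrt (p j')) * (cnj (prd ?T j \<sigma>) * prd ?T j' \<sigma>))"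
    unfolding \<phi> prd_def cnj_sum sum_product by (simp add: mult_ac)
  also have "\<dots> = (\<Sum>j<q. \<Sum>j'<q. complex_of_real (sqrt (p j) * sqrt (p j')) *
       (\<Sum>\<sigma>\<in>configs d ?T. cnj (prd ?T j \<sigma>) * prd ?T j' \<sigma>))"
    by (simp only: sum.swap[of _ "{..<q}" "configs d ?T"] sum_distrib_left)
  also have "\<dots> = (\<Sum>j<q. \<Sum>j'<q. if j = j' then complex_of_real (p j) else 0)"
  proof (intro sum.cong refl)
    fix j j' assume "j \<in> {..<q}" "j' \<in> {..<q}"
    then have j: "j < q" "j' < q" by auto
    have "(\<Sum>\<sigma>\<in>configs d ?T. cnj (prd ?T j \<sigma>) * prd ?T j' \<sigma>) = (\<Prod>s\<in>?T. \<Sum>i<d s. cnj (v j s i) * v j' s i)"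
      unfolding prd_def by (rule sum_configs_prod_inner[OF finT])
    also have "\<dots> = (if j = j' then 1 else 0)"
    proof (cases "j = j'")
      case True
      then show ?thesis using unit[OF j(1)] by (auto intro: prod.neutral)
    next
      case False
      have "(\<Prod>s\<in>HA. \<Sum>i<d s. cnj (v j s i) * v j' s i) = (\<Sum>h\<in>configs d HA. cnj (\<Prod>s\<in>HA. v j s (h s)) * (\<Prod>s\<in>HA. v j' s (h s)))"
        by (rule sum_configs_prod_inner[OF fin_parts(1), symmetric])
      also have "\<dots> = 0" using False isometry_onD[OF unitary_on_isometry[OF sectors(1)], of j j'] j by simp
      \<comment> \<open>The inner product on \<open>HA\<close> is a product over sites, so it
        vanishes through a single site, and that site annihilates the product over all sites as
        well.\<close>
      finally obtain s where "s \<in> HA" "(\<Sum>i<d s. cnj (v j s i) * v j' s i) = 0"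
        using fin_parts(1) by auto
      then show ?thesis using False finT by (auto simp: A)
    qed
    finally show "complex_of_real (sqrt (p j) * sqrt (p j')) * (\<Sum>\<sigma>\<in>configs d ?T. cnj (prd ?T j \<sigma>) * prd ?T j' \<sigma>)
      = (if j = j' then complex_of_real (p j) else 0)"
      using p(1)[OF j(1)] by (auto simp: of_real_mult[symmetric] simp del: of_real_mult)
  qed
  also have "\<dots> = complex_of_real (\<Sum>j<q. p j)" by simp
  finally have "(\<Sum>\<sigma>\<in>configs d ?T. cnj (\<psi> \<sigma>) * \<psi> \<sigma>) = 1" using p(2) by simp
  moreover have "A \<inter> (B \<union> C) = {}" using disj by auto
  ultimately show ?thesis
    unfolding tripartite_state_def unit_vector_iff glue_def
    by (simp add: sum.cartesian_product' sum_configs_Un disj)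
qed

end

section \<open>Light cones in the brick-wall circuit\<close>

text \<open>Gates of one layer are disjoint, so their order is free and those fitting into
  \<open>\<V>\<close> can be moved to the end. \<open>fold\<close> applies the head first; to move
  that gate past \<open>W\<close>, the supports in \<open>W\<close> must be known to come from the
  tail, which is why the third conjunct is carried along.\<close>

lemma layer_factorization:
  assumes "\<And>x y. x \<in> set xs \<Longrightarrow> y \<in> set xs \<Longrightarrow> x \<noteq> y \<Longrightarrow> g x \<inter> g y = {}" "distinct xs"
    and "\<And>x. x \<in> set xs \<Longrightarrow> (\<exists>S\<in>\<V>. g x \<subseteq> S) \<or> (\<exists>S\<in>\<W>. g x \<subseteq> S)"
    and "\<And>x. x \<in> set xs \<Longrightarrow> unitary_on (configs d (g x)) (configs d (g x)) (U x)"
  shows "\<exists>V W. circuit_on d \<V> V \<and> circuit_on d \<W> W \<and> circuit_on d (g ` set xs) W \<and>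
    (\<forall>\<psi>. fold (\<lambda>x. apply_gate d (g x) (U x)) xs \<psi> = V (W \<psi>))"
  using assms
proof (induction xs)
  case Nil
  then show ?case by (intro exI[of _ "\<lambda>\<psi>. \<psi>"]) (auto intro: circuit_on_id)
next
  case (Cons x xs)
  have "\<exists>V W. circuit_on d \<V> V \<and> circuit_on d \<W> W \<and> circuit_on d (g ` set xs) W \<and>
    (\<forall>\<psi>. fold (\<lambda>x. apply_gate d (g x) (U x)) xs \<psi> = V (W \<psi>))"
    using Cons.prems by (intro Cons.IH) auto
  then obtain V W where V: "circuit_on d \<V> V" and W: "circuit_on d \<W> W" "circuit_on d (g ` set xs) W"
    and eq: "\<And>\<psi>. fold (\<lambda>x. apply_gate d (g x) (U x)) xs \<psi> = V (W \<psi>)" by blast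
  let ?F = "apply_gate d (g x) (U x)"
  have U: "unitary_on (configs d (g x)) (configs d (g x)) (U x)" using Cons.prems(4) by simp
  have W': "circuit_on d (g ` set (x # xs)) W" by (rule circuit_on_mono[OF W(2)]) auto
  consider S where "S \<in> \<V>" "g x \<subseteq> S" | S where "S \<in> \<W>" "g x \<subseteq> S"
    using Cons.prems(3)[of x] by auto
  then show ?case
  proof cases
    case 1
    have "?F (W \<psi>) = W (?F \<psi>)" for \<psi>
    proof (rule apply_gate_circuit_on_commute[OF W(2)])
      fix S assume "S \<in> g ` set xs"
      then show "g x \<inter> S = {}" using Cons.prems(1)[of x] Cons.prems(2) by auto
    qed
    moreover have "circuit_on d \<V> (\<lambda>\<psi>. V (?F \<psi>))"
      using 1 U by (intro circuit_on_comp[OF V] circuit_on_single)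
    ultimately show ?thesis using W(1) W' by (intro exI[of _ "\<lambda>\<psi>. V (?F \<psi>)"] exI[of _ W]) (simp add: eq)
  next
    case 2
    have "circuit_on d \<W> (\<lambda>\<psi>. W (?F \<psi>))"
      using 2 U by (intro circuit_on_comp[OF W(1)] circuit_on_single)
    moreover have "circuit_on d (g ` set (x # xs)) (\<lambda>\<psi>. W (?F \<psi>))"
      using U by (intro circuit_on_comp[OF W'] circuit_on_single[of "g x"]) auto
    ultimately show ?thesis using V by (intro exI[of _ V] exI[of _ "\<lambda>\<psi>. W (?F \<psi>)"]) (simp add: eq)
  qed
qed

text \<open>For even \<open>Lx\<close> the step to the next column flips the parity even across the
  seam, so a right column never meets a left column of the same layer.\<close>

lemma gate_sites_disjoint:
  assumes "even Lx" "x \<in> set (gate_columns Lx t)" "y \<in> set (gate_columns Lx t)" "x \<noteq> y"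
  shows "gate_sites Lx t x \<inter> gate_sites Lx t y = {}"
proof -
  have xy: "x < Lx" "y < Lx" "even x = even y" using assms by (auto simp: gate_columns_def)
  have "even ((z + 1) mod Lx) \<noteq> even z" for z
    using assms(1) by (simp add: dvd_mod_iff)
  moreover have "(x + 1) mod Lx \<noteq> (y + 1) mod Lx"
    using xy assms(4) by (auto simp: mod_Suc split: if_splits)
  ultimately have "{x, (x + 1) mod Lx} \<inter> {y, (y + 1) mod Lx} = {}" using xy assms(4) by auto
  then show ?thesis unfolding gate_sites_def by blast
qed

section \<open>Cyclic geometry of the three regions\<close>

locale brickwork =
  fixes Lx Ly x0 n :: nat
  assumes Lx: "Lx = 3 * n" "even Lx" and Ly: "2 * Ly < n"
begin

text \<open>The cyclic distance from \<open>x0\<close> to \<open>c\<close>; adding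
  \<open>Lx - x0 mod Lx\<close> stands for subtracting \<open>x0\<close> in the natural
  numbers.\<close>

definition position :: "nat \<Rightarrow> nat" where
  "position c = (c + (Lx - x0 mod Lx)) mod Lx"

definition "block c = position c div n"
definition "offset c = position c mod n"

lemma pos: "n > 0" "Lx > 0" using Ly Lx by auto

lemma position_less: "position c < Lx" using pos by (simp add: position_def)

lemma add_complement_mod: "(x0 + (c + (Lx - x0 mod Lx))) mod Lx = c mod Lx"
proof -
  have "x0 + (c + (Lx - x0 mod Lx)) = c + Lx + (x0 - x0 mod Lx)"
    using mod_less_divisor[OF pos(2), of x0] mod_less_eq_dividend[of x0 Lx] by linarith
  also have "x0 - x0 mod Lx = Lx * (x0 div Lx)" by (rule minus_mod_eq_mult_div)
  finally have eq: "x0 + (c + (Lx - x0 mod Lx)) = c + Lx + Lx * (x0 div Lx)" .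
  show ?thesis unfolding eq by simp
qed

lemma add_position: "c < Lx \<Longrightarrow> (x0 + position c) mod Lx = c"
  using add_complement_mod[of c] by (simp add: position_def mod_add_right_eq)

lemma position_add: "i < Lx \<Longrightarrow> position ((x0 + i) mod Lx) = i"
  unfolding position_def mod_add_left_eq add.assoc add_complement_mod by simp

lemma position_Suc: "position ((c + 1) mod Lx) = (position c + 1) mod Lx"
  unfolding position_def by (simp add: mod_simps)

lemma block_less: "block c < 3"
proof -
  have "position c < 3 * n" using position_less[of c] by (simp only: Lx(1)[symmetric])
  then show ?thesis unfolding block_def by (rule less_mult_imp_div_less)
qed

lemma offset_less: "offset c < n" using pos by (simp add: offset_def)

text \<open>A case rule for neighbouring columns. Blocks count modulo 3, so the seam between the
  last and the first block is a cut like the other two.\<close>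

lemma Suc_cases:
  obtains (inner) "offset c + 1 < n" "block ((c + 1) mod Lx) = block c" "offset ((c + 1) mod Lx) = offset c + 1"
  | (cut) "offset c + 1 = n" "block ((c + 1) mod Lx) = (block c + 1) mod 3" "offset ((c + 1) mod Lx) = 0"
proof -
  define b where "b = block c"
  define o' where "o' = offset c"
  have i: "position c = b * n + o'" by (simp add: b_def o'_def block_def offset_def)
  have b: "b < 3" and o': "o' < n" using block_less offset_less by (auto simp: b_def o'_def)
  show thesis
  proof (cases "o' + 1 < n")
    case True
    have "b * n + o' + 1 < Lx"
    proof -
      have "b * n \<le> 2 * n" using b by (intro mult_right_mono) auto
      then show ?thesis using True Lx by linarith
    qed
    then have "position ((c + 1) mod Lx) = b * n + (o' + 1)" unfolding position_Suc i by simp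
    then have "block ((c + 1) mod Lx) = b" "offset ((c + 1) mod Lx) = o' + 1"
      using True pos unfolding block_def offset_def by (simp_all del: add_Suc_right)
    then show ?thesis using inner True by (simp add: b_def o'_def)
  next
    case False
    then have n: "o' + 1 = n" using o' by simp
    then have "position ((c + 1) mod Lx) = ((b + 1) * n) mod (3 * n)"
    proof -
      have "b * n + o' + 1 = (b + 1) * n" using n by simp
      then show ?thesis unfolding position_Suc i by (simp only: Lx(1)[symmetric])
    qed
    also have "\<dots> = ((b + 1) mod 3) * n" by (rule mod_mult_mult2)
    finally have "block ((c + 1) mod Lx) = (b + 1) mod 3" "offset ((c + 1) mod Lx) = 0"
      using pos unfolding block_def offset_def by simp_all
    then show ?thesis using cut n by (simp add: b_def o'_def)
  qed
qed

lemma region_eq: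
  assumes k: "k < 3"
  shows "region Lx Ly x0 k = {(c, y). c < Lx \<and> block c = k \<and> 1 \<le> y \<and> y \<le> Ly + 1}"
proof -
  have n: "Lx div 3 = n" using Lx by simp
  have "(\<lambda>i. (x0 + i) mod Lx) ` {k * n..<(k + 1) * n} = {c. c < Lx \<and> block c = k}"
  proof (intro equalityI subsetI)
    fix c assume "c \<in> (\<lambda>i. (x0 + i) mod Lx) ` {k * n..<(k + 1) * n}"
    then obtain i where i: "k * n \<le> i" "i < (k + 1) * n" "c = (x0 + i) mod Lx" by auto
    have "(k + 1) * n \<le> 3 * n" using k by (intro mult_right_mono) auto
    then have "i < Lx" using i(2) Lx(1) by (metis order.strict_trans2)
    then have "position c = i" using i(3) position_add by simp
    moreover have "i div n = k" using i by (intro div_nat_eqI) (auto simp: mult.commute)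
    ultimately show "c \<in> {c. c < Lx \<and> block c = k}" using i(3) pos by (simp add: block_def)
  next
    fix c assume c: "c \<in> {c. c < Lx \<and> block c = k}"
    have "position c = k * n + offset c" using c by (auto simp: block_def offset_def)
    then have "position c \<in> {k * n..<(k + 1) * n}" using offset_less[of c] by simp
    then show "c \<in> (\<lambda>i. (x0 + i) mod Lx) ` {k * n..<(k + 1) * n}"
      using c add_position[of c] by (intro image_eqI[of _ _ "position c"]) auto
  qed
  then show ?thesis unfolding region_def n by auto
qed

section \<open>Strips around the cuts\<close>

text \<open>At equal \<open>r\<close> the \<open>far\<close> and \<open>near\<close> strips are
  complementary. In use, \<open>r\<close> counts the layers still to be applied, so the strips at
  the cuts narrow as the circuit proceeds.\<close>

definition far :: "nat \<Rightarrow> nat \<Rightarrow> site set" where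
  "far r k = {(c, y) \<in> sites Lx Ly. block c = k \<and> r \<le> offset c \<and> offset c < n - r}"

definition near :: "nat \<Rightarrow> nat \<Rightarrow> site set" where
  "near r k = {(c, y) \<in> sites Lx Ly. (block c = k \<and> n - r \<le> offset c) \<or> (block c = (k + 1) mod 3 \<and> offset c < r)}"

text \<open>\<open>near r\<close> and \<open>far (r - 1)\<close> overlap in the columns at offsets r
  - 1 and n - r. A gate covers two adjacent columns, so an overlap of one column at each end
  suffices for it to fit into one of the strips.\<close>

lemma near_or_far:
  assumes c: "c < Lx" and r: "1 \<le> r" "2 * r < n" and t: "1 \<le> t" "t \<le> Ly"
  shows "(\<exists>S\<in>far (r - 1) ` {..<3}. gate_sites Lx t c \<subseteq> S) \<or> (\<exists>S\<in>near r ` {..<3}. gate_sites Lx t c \<subseteq> S)"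
proof -
  let ?c' = "(c + 1) mod Lx"
  have gate: "gate_sites Lx t c \<subseteq> {s \<in> sites Lx Ly. P (fst s)}" if "P c" "P ?c'" for P
    using c t pos that by (auto simp: gate_sites_def sites_def)
  have near_eq: "near r k = {s \<in> sites Lx Ly. (block (fst s) = k \<and> n - r \<le> offset (fst s)) \<or>
      (block (fst s) = (k + 1) mod 3 \<and> offset (fst s) < r)}" for k by (auto simp: near_def)
  have far_eq: "far (r - 1) k = {s \<in> sites Lx Ly. block (fst s) = k \<and> r - 1 \<le> offset (fst s) \<and> offset (fst s) < n - (r - 1)}" for k
    by (auto simp: far_def)
  show ?thesis
  proof (cases c rule: Suc_cases)
    case inner
    consider "offset c + 1 < r" | "offset c \<ge> n - r" | "r \<le> offset c + 1" "offset c < n - r" by linarith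
    then show ?thesis
    proof cases
      case 1
      obtain k where k: "k < 3" "block c = (k + 1) mod 3"
      proof -
        have "block c = 0 \<or> block c = 1 \<or> block c = 2" using block_less[of c] by auto
        then show thesis using that[of 0] that[of 1] that[of 2] by auto
      qed
      have "gate_sites Lx t c \<subseteq> near r k" unfolding near_eq
        using 1 inner k by (intro gate) auto
      then show ?thesis using k by blast
    next
      case 2
      have "gate_sites Lx t c \<subseteq> near r (block c)" unfolding near_eq
        using 2 inner by (intro gate) auto
      then show ?thesis using block_less by blast
    next
      case 3
      have "gate_sites Lx t c \<subseteq> far (r - 1) (block c)" unfolding far_eq
        using 3 inner r by (intro gate) auto
      then show ?thesis using block_less by blast
    qed
  next
    case cut
    have "gate_sites Lx t c \<subseteq> near r (block c)" unfolding near_eq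
      using cut r by (intro gate) auto
    then show ?thesis using block_less by blast
  qed
qed

text \<open>Invariant: after \<open>t\<close> layers the part local to the regions avoids the r = Ly
  - t columns on either side of each cut. The gates of the next layer in \<open>near r\<close> are
  disjoint from \<open>far r\<close> and pass the collected \<open>V\<close>; the others extend it
  to \<open>far (r - 1)\<close>. Early layers get the widest strips, which reproduces the backward
  light cone.\<close>

lemma run_circuit_factorization:
  assumes G: "\<forall>t\<in>{1..Ly}. \<forall>x\<in>set (gate_columns Lx t).
      unitary_on (configs d (gate_sites Lx t x)) (configs d (gate_sites Lx t x)) (G t x)"
    and "t \<le> Ly"
  shows "\<exists>V W. circuit_on d (far (Ly - t) ` {..<3}) V \<and> circuit_on d (near Ly ` {..<3}) W \<and>
     (\<forall>\<phi>. run_circuit Lx d G t \<phi> = V (W \<phi>))"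
  using assms(2)
proof (induction t)
  case 0
  then show ?case by (intro exI[of _ "\<lambda>\<psi>. \<psi>"]) (auto intro: circuit_on_id)
next
  case (Suc t)
  then obtain V W where V: "circuit_on d (far (Ly - t) ` {..<3}) V" and W: "circuit_on d (near Ly ` {..<3}) W"
    and eq: "\<And>\<phi>. run_circuit Lx d G t \<phi> = V (W \<phi>)" by auto
  define r where "r = Ly - t"
  have r: "1 \<le> r" "2 * r < n" "r \<le> Ly" "r - 1 = Ly - Suc t" using Suc.prems Ly by (auto simp: r_def)
  have "\<exists>V W. circuit_on d (far (r - 1) ` {..<3}) V \<and> circuit_on d (near r ` {..<3}) W \<and>
      circuit_on d (gate_sites Lx (Suc t) ` set (gate_columns Lx (Suc t))) W \<and>
      (\<forall>\<psi>. fold (\<lambda>x. apply_gate d (gate_sites Lx (Suc t) x) (G (Suc t) x)) (gate_columns Lx (Suc t)) \<psi> = V (W \<psi>))"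
  proof (rule layer_factorization)
    show "gate_sites Lx (Suc t) x \<inter> gate_sites Lx (Suc t) y = {}"
      if "x \<in> set (gate_columns Lx (Suc t))" "y \<in> set (gate_columns Lx (Suc t))" "x \<noteq> y" for x y
      by (rule gate_sites_disjoint[OF Lx(2) that])
  next
    fix x assume x: "x \<in> set (gate_columns Lx (Suc t))"
    then have "x < Lx" by (simp add: gate_columns_def)
    then show "(\<exists>S\<in>far (r - 1) ` {..<3}. gate_sites Lx (Suc t) x \<subseteq> S) \<or> (\<exists>S\<in>near r ` {..<3}. gate_sites Lx (Suc t) x \<subseteq> S)"
      using r Suc.prems by (intro near_or_far) auto
    show "unitary_on (configs d (gate_sites Lx (Suc t) x)) (configs d (gate_sites Lx (Suc t) x)) (G (Suc t) x)"
      using G x Suc.prems by simp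
  qed (simp add: gate_columns_def)
  then obtain V' W' where V': "circuit_on d (far (r - 1) ` {..<3}) V'" and W': "circuit_on d (near r ` {..<3}) W'"
    and eq': "\<And>\<psi>. apply_layer Lx d G (Suc t) \<psi> = V' (W' \<psi>)"
    unfolding apply_layer_def by blast
  have comm: "W' (V \<psi>) = V (W' \<psi>)" for \<psi>
  proof (rule circuit_on_commute[OF W' V])
    fix S T assume "S \<in> near r ` {..<3}" "T \<in> far (Ly - t) ` {..<3}"
    then show "S \<inter> T = {}" using r by (auto simp: near_def far_def r_def)
  qed
  have "circuit_on d (far (r - 1) ` {..<3}) V"
    by (rule circuit_on_mono[OF V]) (force simp: far_def r_def)
  then have 1: "circuit_on d (far (r - 1) ` {..<3}) (\<lambda>\<psi>. V' (V \<psi>))" by (rule circuit_on_comp[OF V'])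
  have "circuit_on d (near Ly ` {..<3}) W'"
    by (rule circuit_on_mono[OF W']) (use r in \<open>force simp: near_def\<close>)
  then have 2: "circuit_on d (near Ly ` {..<3}) (\<lambda>\<psi>. W' (W \<psi>))" using W by (rule circuit_on_comp)
  have 3: "\<forall>\<phi>. run_circuit Lx d G (Suc t) \<phi> = V' (V (W' (W \<phi>)))" by (simp add: eq eq' comm)
  show ?case
    unfolding r(4)[symmetric]
    by (rule exI[of _ "\<lambda>\<psi>. V' (V \<psi>)"], rule exI[of _ "\<lambda>\<psi>. W' (W \<psi>)"]) (intro conjI 1 2 3)
qed

context
  fixes d :: "site \<Rightarrow> nat" and H :: "nat \<Rightarrow> site set"
    and q :: nat and p :: "nat \<Rightarrow> real" and v :: "nat \<Rightarrow> site \<Rightarrow> nat \<Rightarrow> complex"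
    and \<phi> :: "config \<Rightarrow> complex"
  assumes H: "\<And>k. k < 3 \<Longrightarrow> H k \<subseteq> {s \<in> region Lx Ly x0 k. offset (fst s) = Ly}"
    and sectors: "\<And>k. k < 3 \<Longrightarrow> unitary_on (configs d (H k)) {..<q} (\<lambda>h j. \<Prod>s\<in>H k. v j s (h s))"
    and p: "\<And>j. j < q \<Longrightarrow> p j \<ge> 0" "(\<Sum>j<q. p j) = 1"
    and unit: "\<And>j s. j < q \<Longrightarrow> s \<in> sites Lx Ly \<Longrightarrow> (\<Sum>i<d s. cnj (v j s i) * v j s i) = 1"
    and \<phi>: "\<phi> = (\<lambda>\<sigma>. \<Sum>j<q. complex_of_real (sqrt (p j)) * (\<Prod>s\<in>sites Lx Ly. v j s (\<sigma> s)))"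
begin

text \<open>The marker sites \<open>H k\<close> lie in the column at offset \<open>Ly\<close> of
  their block. The strip at the left end takes the offsets below \<open>Ly\<close> and the one at
  the right end starts at n - Ly > Ly, so the first stage misses them.\<close>

lemma triangle_sum_sequential_circuit:
  assumes "sequential_circuit Lx Ly d \<phi> \<psi>"
  shows "triangle_sum q (region_labels Lx Ly d x0 0) (region_labels Lx Ly d x0 1)
           (region_labels Lx Ly d x0 2) (tripartition Lx Ly x0 \<psi>)"
    and "tripartite_state (region_labels Lx Ly d x0 0) (region_labels Lx Ly d x0 1)
           (region_labels Lx Ly d x0 2) (tripartition Lx Ly x0 \<psi>)"
proof -
  obtain G where G: "\<forall>t\<in>{1..Ly}. \<forall>x\<in>set (gate_columns Lx t).
      unitary_on (configs d (gate_sites Lx t x)) (configs d (gate_sites Lx t x)) (G t x)"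
    and \<psi>: "\<psi> = run_circuit Lx d G Ly \<phi>"
    using assms unfolding sequential_circuit_def by blast
  define Q where "Q k = region Lx Ly x0 k" for k
  have Q_eq: "Q k = {s \<in> sites Lx Ly. block (fst s) = k}" if "k < 3" for k
    unfolding Q_def region_eq[OF that] by (auto simp: sites_def)
  have disjQ: "Q k \<inter> Q l = {}" if "k < 3" "l < 3" "k \<noteq> l" for k l
    using that by (auto simp: Q_eq)
  define L where "L k = {s \<in> Q k. offset (fst s) < Ly}" for k
  \<comment> \<open>\<open>R k\<close> takes everything else, in particular the right strip; columns
    that the first stage leaves alone may be counted here without harm.\<close>
  define R where "R k = Q k - H k - L k" for k
  have H': "H k \<subseteq> Q k" "\<And>s. s \<in> H k \<Longrightarrow> offset (fst s) = Ly" if "k < 3" for k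
    using H[OF that] by (auto simp: Q_def)
  have parts: "Q k = H k \<union> (L k \<union> R k)" "H k \<inter> L k = {}" "H k \<inter> R k = {}" "L k \<inter> R k = {}" if "k < 3" for k
    using H'[OF that] by (auto simp: L_def R_def)
  have three: "{..<3} = {0, 1, 2 :: nat}" by auto
  obtain V W where V: "circuit_on d (far 0 ` {..<3}) V" and W: "circuit_on d (near Ly ` {..<3}) W"
    and eq: "\<And>\<phi>. run_circuit Lx d G Ly \<phi> = V (W \<phi>)"
    using run_circuit_factorization[OF G order_refl] by auto
  \<comment> \<open>After the last layer no distance from the cuts is required any more, so
    \<open>V\<close> acts on whole regions.\<close>
  have "far 0 k = Q k" if "k < 3" for k
    using offset_less by (auto simp: far_def Q_eq[OF that])
  then have "far 0 ` {..<3} = {Q 0, Q 1, Q 2}" by (simp add: three)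
  then have "circuit_on d {Q 0, Q 1, Q 2} V" using V by simp
  then obtain VA VB VC where V': "circuit_on d {Q 0} VA" "circuit_on d {Q 1} VB" "circuit_on d {Q 2} VC"
    and V_eq: "V = (\<lambda>\<psi>. VA (VB (VC \<psi>)))"
    using circuit_on_triple_split[of d "Q 0" "Q 1" "Q 2" V] disjQ by auto
  have near: "near Ly k \<subseteq> R k \<union> L ((k + 1) mod 3)" if k: "k < 3" for k
  proof
    fix s assume s: "s \<in> near Ly k"
    then consider "s \<in> sites Lx Ly" "block (fst s) = k" "n - Ly \<le> offset (fst s)"
      | "s \<in> sites Lx Ly" "block (fst s) = (k + 1) mod 3" "offset (fst s) < Ly"
      by (auto simp: near_def)
    then show "s \<in> R k \<union> L ((k + 1) mod 3)"
    proof cases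
      case 1
      then have "s \<in> Q k" "offset (fst s) > Ly" using Ly by (auto simp: Q_eq[OF k])
      then show ?thesis using H'(2)[OF k, of s] by (auto simp: R_def L_def)
    next
      case 2
      then show ?thesis by (simp add: L_def Q_eq)
    qed
  qed
  have near012: "near Ly 0 \<subseteq> R 0 \<union> L 1" "near Ly 1 \<subseteq> R 1 \<union> L 2" "near Ly 2 \<subseteq> R 2 \<union> L 0"
  proof -
    have m: "(0 + 1) mod 3 = (1::nat)" "(1 + 1) mod 3 = (2::nat)" "(2 + 1) mod 3 = (0::nat)" by simp_all
    show "near Ly 0 \<subseteq> R 0 \<union> L 1" by (rule near[of 0, unfolded m]) simp
    show "near Ly 1 \<subseteq> R 1 \<union> L 2" by (rule near[of 1, unfolded m]) simp
    show "near Ly 2 \<subseteq> R 2 \<union> L 0" by (rule near[of 2, unfolded m]) simp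
  qed
  have cW: "circuit_on d {R 0 \<union> L 1, R 1 \<union> L 2, R 2 \<union> L 0} W"
  proof (rule circuit_on_mono[OF W])
    fix S assume "S \<in> near Ly ` {..<3}"
    then consider "S = near Ly 0" | "S = near Ly 1" | "S = near Ly 2" by (auto simp: three)
    then show "\<exists>S'\<in>{R 0 \<union> L 1, R 1 \<union> L 2, R 2 \<union> L 0}. S \<subseteq> S'"
      using near012 by cases simp_all
  qed
  have sub: "L k \<subseteq> Q k" "R k \<subseteq> Q k" for k by (auto simp: L_def R_def)
  have Q01: "Q 0 \<inter> Q 1 = {}" and Q02: "Q 0 \<inter> Q 2 = {}" and Q12: "Q 1 \<inter> Q 2 = {}"
    by (rule disjQ; simp)+
  have LR: "L 0 \<inter> R 0 = {}" "L 1 \<inter> R 1 = {}" "L 2 \<inter> R 2 = {}"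
    by (rule parts(4); simp)+
  have disjW: "(R 0 \<union> L 1) \<inter> (R 1 \<union> L 2) = {}" "(R 0 \<union> L 1) \<inter> (R 2 \<union> L 0) = {}" "(R 1 \<union> L 2) \<inter> (R 2 \<union> L 0) = {}"
    using sub[of 0] sub[of 1] sub[of 2] Q01 Q02 Q12 LR by blast+
  obtain WAB WBC WCA where
    W': "circuit_on d {R 0 \<union> L 1} WAB" "circuit_on d {R 1 \<union> L 2} WBC" "circuit_on d {R 2 \<union> L 0} WCA"
    and W_eq: "W = (\<lambda>\<psi>. WAB (WBC (WCA \<psi>)))"
    using circuit_on_triple_split[OF cW disjW] by (elim exE conjE) (rule that)
  have sites_Q: "sites Lx Ly = Q 0 \<union> (Q 1 \<union> Q 2)"
  proof
    show "sites Lx Ly \<subseteq> Q 0 \<union> (Q 1 \<union> Q 2)"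
    proof
      fix s assume "s \<in> sites Lx Ly"
      moreover have "block (fst s) = 0 \<or> block (fst s) = 1 \<or> block (fst s) = 2"
        using block_less[of "fst s"] by linarith
      ultimately show "s \<in> Q 0 \<union> (Q 1 \<union> Q 2)" by (auto simp: Q_eq)
    qed
  qed (auto simp: Q_eq)
  have finQ: "finite (Q k)" if "k < 3" for k using that by (auto simp: Q_eq sites_def)
  interpret fc: factorized_circuit d "Q 0" "Q 1" "Q 2" "H 0" "L 0" "R 0" "H 1" "L 1" "R 1" "H 2" "L 2" "R 2"
    VA VB VC WAB WBC WCA q p v \<phi>
  proof
    show "Q 0 = H 0 \<union> (L 0 \<union> R 0)" "Q 1 = H 1 \<union> (L 1 \<union> R 1)" "Q 2 = H 2 \<union> (L 2 \<union> R 2)"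
      by (rule parts(1); simp)+
    show "\<phi> = (\<lambda>\<sigma>. \<Sum>j<q. complex_of_real (sqrt (p j)) * (\<Prod>s\<in>Q 0 \<union> (Q 1 \<union> Q 2). v j s (\<sigma> s)))"
      using \<phi> by (simp only: sites_Q)
    show "(\<Sum>i<d s. cnj (v j s i) * v j s i) = 1" if "j < q" "s \<in> Q 0 \<union> Q 1 \<union> Q 2" for j s
      using unit[OF that(1)] that(2) by (simp add: sites_Q Un_assoc)
  qed (use V' W' p in \<open>simp_all add: finQ disjQ parts(2-4) sectors\<close>)
  have lab: "region_labels Lx Ly d x0 k = configs d (Q k)" for k by (simp add: region_labels_def Q_def)
  have tri: "tripartition Lx Ly x0 \<psi> = (\<lambda>a b c. fc.\<psi> (fc.glue a b c))"
    unfolding fc.glue_def fc.\<psi>_def fc.\<chi>_def fun_eq_iff tripartition_def \<psi> eq V_eq W_eq by (simp add: Q_def)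
  show "triangle_sum q (region_labels Lx Ly d x0 0) (region_labels Lx Ly d x0 1)
           (region_labels Lx Ly d x0 2) (tripartition Lx Ly x0 \<psi>)"
    unfolding lab tri by (rule fc.triangle_sum_\<psi>)
  show "tripartite_state (region_labels Lx Ly d x0 0) (region_labels Lx Ly d x0 1)
           (region_labels Lx Ly d x0 2) (tripartition Lx Ly x0 \<psi>)"
    unfolding lab tri by (rule fc.tripartite_state_\<psi>)
qed

end

end

section \<open>The two initial states\<close>

lemma brickwork_intro:
  assumes "cylinder Lx Ly d" "real Ly < real Lx / 6"
  shows "brickwork Lx Ly (Lx div 3)"
proof
  have L: "3 dvd Lx" "even Lx" using assms(1) by (auto simp: cylinder_def)
  show "Lx = 3 * (Lx div 3)" using L(1) by simp
  show "even Lx" by (rule L(2))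
  have "6 * Ly < Lx" using assms(2) by (simp add: field_simps)
  then show "2 * Ly < Lx div 3" using \<open>Lx = 3 * (Lx div 3)\<close> by linarith
qed

lemma sites_split:
  "sites Lx Ly = bottom_row Lx \<union> (sites Lx Ly - bottom_row Lx)" "finite (bottom_row Lx)" "finite (sites Lx Ly)"
  by (auto simp: sites_def bottom_row_def)

text \<open>One term of weight 1 with empty marker sets: \<open>configs d {}\<close> has a single
  element and the empty product is 1, which is a unitary with column set
  \<open>{..<1}\<close>.\<close>

lemma triangle_sum_trivial:
  assumes "cylinder Lx Ly d" "real Ly < real Lx / 6"
    and "trivial_initial_state Lx Ly d \<phi>" and circ: "sequential_circuit Lx Ly d \<phi> \<psi>"
  shows "triangle_sum 1 (region_labels Lx Ly d x0 0) (region_labels Lx Ly d x0 1)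
           (region_labels Lx Ly d x0 2) (tripartition Lx Ly x0 \<psi>)"
    and "tripartite_state (region_labels Lx Ly d x0 0) (region_labels Lx Ly d x0 1)
           (region_labels Lx Ly d x0 2) (tripartition Lx Ly x0 \<psi>)"
proof -
  interpret brickwork Lx Ly x0 "Lx div 3" by (rule brickwork_intro[OF assms(1,2)])
  obtain v1 v2 where v1: "\<And>s. s \<in> bottom_row Lx \<Longrightarrow> unit_vector {..<d s} (v1 s)"
    and v2: "\<And>s. s \<in> sites Lx Ly - bottom_row Lx \<Longrightarrow> unit_vector {..<d s} (v2 s)"
    and \<phi>: "\<phi> = (\<lambda>\<sigma>. (\<Prod>s\<in>bottom_row Lx. v1 s (\<sigma> s)) * (\<Prod>s\<in>sites Lx Ly - bottom_row Lx. v2 s (\<sigma> s)))"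
    using assms(3) unfolding trivial_initial_state_def product_state_def by blast
  define v where "v j s = (if s \<in> bottom_row Lx then v1 s else v2 s)" for j :: nat and s
  have "\<phi> = (\<lambda>\<sigma>. \<Sum>j<1. complex_of_real (sqrt 1) * (\<Prod>s\<in>sites Lx Ly. v j s (\<sigma> s)))"
    unfolding \<phi> by (subst sites_split(1), subst prod.union_disjoint) (auto simp: v_def sites_split(2,3) fun_eq_iff)
  moreover have "(\<Sum>i<d s. cnj (v j s i) * v j s i) = 1" if "s \<in> sites Lx Ly" for j s
    using v1[of s] v2[of s] that by (auto simp: v_def unit_vector_iff)
  moreover have "unitary_on (configs d {}) {..<1::nat} (\<lambda>h j. \<Prod>s\<in>{}. v j s (h s))"
    by (simp add: configs_def unitary_on_def)
  ultimately show "triangle_sum 1 (region_labels Lx Ly d x0 0) (region_labels Lx Ly d x0 1)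
           (region_labels Lx Ly d x0 2) (tripartition Lx Ly x0 \<psi>)"
    and "tripartite_state (region_labels Lx Ly d x0 0) (region_labels Lx Ly d x0 1)
           (region_labels Lx Ly d x0 2) (tripartition Lx Ly x0 \<psi>)"
    using triangle_sum_sequential_circuit[where H = "\<lambda>_. {}" and q = 1 and p = "\<lambda>_. 1" and v = v and \<phi> = \<phi> and \<psi> = \<psi> and d = d]
      circ by auto
qed

text \<open>The marker of each region is a bottom-row qudit in an untouched column. In the i-th term
  it carries the i-th basis vector, so the terms are orthogonal in every region separately, with
  sector weights 1 / q.\<close>

lemma triangle_sum_cat:
  assumes cyl: "cylinder Lx Ly d" and "real Ly < real Lx / 6"
    and "cat_initial_state Lx Ly d \<phi>" and circ: "sequential_circuit Lx Ly d \<phi> \<psi>"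
  shows "\<exists>q. triangle_sum q (region_labels Lx Ly d x0 0) (region_labels Lx Ly d x0 1)
           (region_labels Lx Ly d x0 2) (tripartition Lx Ly x0 \<psi>)"
    and "tripartite_state (region_labels Lx Ly d x0 0) (region_labels Lx Ly d x0 1)
           (region_labels Lx Ly d x0 2) (tripartition Lx Ly x0 \<psi>)"
proof -
  interpret brickwork Lx Ly x0 "Lx div 3" by (rule brickwork_intro[OF assms(1,2)])
  obtain q b v2 where dq: "\<And>x. x < Lx \<Longrightarrow> d (x, 1) = q" and b: "unitary_on {..<q} {..<q} b"
    and v2: "\<And>s. s \<in> sites Lx Ly - bottom_row Lx \<Longrightarrow> unit_vector {..<d s} (v2 s)"
    and \<phi>: "\<phi> = (\<lambda>\<sigma>. complex_of_real (1 / sqrt (real q)) * (\<Sum>i<q. \<Prod>x<Lx. b (\<sigma> (x, 1)) i)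
               * (\<Prod>s\<in>sites Lx Ly - bottom_row Lx. v2 s (\<sigma> s)))"
    using assms(3) unfolding cat_initial_state_def cat_state_def product_state_def by blast
  note isob = isometry_onD[OF unitary_on_isometry[OF b]]
  \<comment> \<open>Positive local dimensions are what makes the weights 1 / q sum to 1.\<close>
  have q: "q > 0" using cyl dq[OF pos(2)] pos(2) by (force simp: cylinder_def sites_def)
  define v where "v j s = (if s \<in> bottom_row Lx then \<lambda>i. b i j else v2 s)" for j :: nat and s
  \<comment> \<open>Offset \<open>Ly\<close> is the first column beyond the left strip of block
    \<open>k\<close>; row 1 carries the cat state.\<close>
  define H where "H k = {((x0 + (k * (Lx div 3) + Ly)) mod Lx, 1 :: nat)}" for k
  have row: "(\<Prod>x<Lx. b (\<sigma> (x, 1)) i) = (\<Prod>s\<in>bottom_row Lx. v i s (\<sigma> s))" for \<sigma> :: config and i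
    unfolding bottom_row_def prod.cartesian_product'[symmetric]
    by (rule prod.reindex_bij_witness[where i = fst and j = "\<lambda>x. (x, 1)"]) (auto simp: v_def bottom_row_def)
  have \<phi>': "\<phi> = (\<lambda>\<sigma>. \<Sum>j<q. complex_of_real (sqrt (1 / real q)) * (\<Prod>s\<in>sites Lx Ly. v j s (\<sigma> s)))"
  proof
    fix \<sigma>
    have "(\<Prod>s\<in>sites Lx Ly. v j s (\<sigma> s)) = (\<Prod>x<Lx. b (\<sigma> (x, 1)) j) * (\<Prod>s\<in>sites Lx Ly - bottom_row Lx. v2 s (\<sigma> s))" for j
      unfolding row by (subst sites_split(1), subst prod.union_disjoint) (auto simp: v_def sites_split(2,3))
    then show "\<phi> \<sigma> = (\<Sum>j<q. complex_of_real (sqrt (1 / real q)) * (\<Prod>s\<in>sites Lx Ly. v j s (\<sigma> s)))"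
      by (simp add: \<phi> real_sqrt_divide sum_distrib_left sum_distrib_right mult.assoc)
  qed
  have unit: "(\<Sum>i<d s. cnj (v j s i) * v j s i) = 1" if "s \<in> sites Lx Ly" "j < q" for j s
    using v2[of s] that isob[of j j] dq by (cases "s \<in> bottom_row Lx") (auto simp: v_def unit_vector_iff bottom_row_def)
  have H: "H k \<subseteq> {s \<in> region Lx Ly x0 k. offset (fst s) = Ly}" if k: "k < 3" for k
  proof -
    let ?i = "k * (Lx div 3) + Ly"
    have "k * (Lx div 3) \<le> 2 * (Lx div 3)" using k by (intro mult_right_mono) auto
    then have i: "?i < Lx" using Ly Lx(1) by linarith
    have "position ((x0 + ?i) mod Lx) = ?i" by (rule position_add[OF i])
    then have "block ((x0 + ?i) mod Lx) = k" "offset ((x0 + ?i) mod Lx) = Ly"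
      using Ly by (simp_all add: block_def offset_def)
    then show ?thesis using pos by (simp add: H_def region_eq[OF k])
  qed
  have sectors: "unitary_on (configs d (H k)) {..<q} (\<lambda>h j. \<Prod>s\<in>H k. v j s (h s))" for k
  proof -
    obtain s where s: "H k = {s}" "s \<in> bottom_row Lx" using pos by (auto simp: H_def bottom_row_def)
    then have ds: "d s = q" using dq by (auto simp: bottom_row_def)
    have "isometry_on (configs d (H k)) {..<q} (\<lambda>h j. \<Prod>s\<in>H k. v j s (h s))"
      unfolding isometry_on_def s(1)
      using s(2) ds isob by (subst sum_configs_prod_inner) (auto simp: v_def)
    moreover have "card (configs d (H k)) = card {..<q}"
      by (simp add: s(1) configs_def card_PiE ds)
    ultimately show ?thesis by (intro isometry_on_unitary) (auto simp: s(1))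
  qed
  have p: "(\<Sum>j<q. 1 / real q) = 1" using q by simp
  note result = triangle_sum_sequential_circuit[where H = H and q = q and p = "\<lambda>_. 1 / real q" and v = v and \<phi> = \<phi> and d = d,
      OF H sectors _ p unit \<phi>' circ]
  show "\<exists>q. triangle_sum q (region_labels Lx Ly d x0 0) (region_labels Lx Ly d x0 1)
           (region_labels Lx Ly d x0 2) (tripartition Lx Ly x0 \<psi>)"
    by (rule exI, rule result(1)) simp_all
  show "tripartite_state (region_labels Lx Ly d x0 0) (region_labels Lx Ly d x0 1)
           (region_labels Lx Ly d x0 2) (tripartition Lx Ly x0 \<psi>)"
    by (rule result(2)) simp_all
qed

text \<open>A product input yields a sum with a single triangle, so one Markov gap computation
  covers both inputs.\<close>

lemma markov_gap_sequential_circuit: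
  assumes "cylinder Lx Ly d" "real Ly < real Lx / 6"
    and "trivial_initial_state Lx Ly d \<phi> \<or> cat_initial_state Lx Ly d \<phi>" "sequential_circuit Lx Ly d \<phi> \<psi>"
  shows "markov_gap (region_labels Lx Ly d x0 0) (region_labels Lx Ly d x0 1)
           (region_labels Lx Ly d x0 2) (tripartition Lx Ly x0 \<psi>) = 0"
proof (rule markov_gap_sum_of_triangle_states)
  show "sum_of_triangle_states (region_labels Lx Ly d x0 0) (region_labels Lx Ly d x0 1)
           (region_labels Lx Ly d x0 2) (tripartition Lx Ly x0 \<psi>)"
    unfolding sum_of_triangle_states_iff
    using assms(3) triangle_sum_trivial[OF assms(1,2) _ assms(4)] triangle_sum_cat[OF assms(1,2) _ assms(4)] by blast
qed (simp_all add: region_labels_def region_def)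

theorem theorem4p3:
  "(\<forall>Lx Ly d x0 \<phi> \<psi>.
      cylinder Lx Ly d \<and> real Ly < real Lx / 6 \<and>
      trivial_initial_state Lx Ly d \<phi> \<and> sequential_circuit Lx Ly d \<phi> \<psi> \<longrightarrow>
      triangle_state (region_labels Lx Ly d x0 0) (region_labels Lx Ly d x0 1)
        (region_labels Lx Ly d x0 2) (tripartition Lx Ly x0 \<psi>)) \<and>
   (\<forall>Lx Ly d x0 \<phi> \<psi>.
      cylinder Lx Ly d \<and> real Ly < real Lx / 6 \<and>
      cat_initial_state Lx Ly d \<phi> \<and> sequential_circuit Lx Ly d \<phi> \<psi> \<longrightarrow>
      sum_of_triangle_states (region_labels Lx Ly d x0 0) (region_labels Lx Ly d x0 1)
        (region_labels Lx Ly d x0 2) (tripartition Lx Ly x0 \<psi>)) \<and>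
   (\<forall>Lx Ly d x0 \<phi> \<psi>.
      (\<forall>n::nat. cylinder (Lx n) (Ly n) (d n) \<and> real (Ly n) < real (Lx n) / 6 \<and>
         (trivial_initial_state (Lx n) (Ly n) (d n) (\<phi> n) \<or>
          cat_initial_state (Lx n) (Ly n) (d n) (\<phi> n)) \<and>
         sequential_circuit (Lx n) (Ly n) (d n) (\<phi> n) (\<psi> n)) \<longrightarrow>
      \<not> ungappable_edge (\<lambda>n. region_labels (Lx n) (Ly n) (d n) (x0 n) 0)
          (\<lambda>n. region_labels (Lx n) (Ly n) (d n) (x0 n) 1)
          (\<lambda>n. region_labels (Lx n) (Ly n) (d n) (x0 n) 2)
          (\<lambda>n. tripartition (Lx n) (Ly n) (x0 n) (\<psi> n)))"
proof (intro conjI allI impI)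
  fix Lx Ly d x0 \<phi> \<psi>
  assume "cylinder Lx Ly d \<and> real Ly < real Lx / 6 \<and>
      trivial_initial_state Lx Ly d \<phi> \<and> sequential_circuit Lx Ly d \<phi> \<psi>"
  then show "triangle_state (region_labels Lx Ly d x0 0) (region_labels Lx Ly d x0 1)
        (region_labels Lx Ly d x0 2) (tripartition Lx Ly x0 \<psi>)"
    by (intro triangle_state_if_triangle_sum triangle_sum_trivial) auto
next
  fix Lx Ly d x0 \<phi> \<psi>
  assume "cylinder Lx Ly d \<and> real Ly < real Lx / 6 \<and>
      cat_initial_state Lx Ly d \<phi> \<and> sequential_circuit Lx Ly d \<phi> \<psi>"
  then show "sum_of_triangle_states (region_labels Lx Ly d x0 0) (region_labels Lx Ly d x0 1)
        (region_labels Lx Ly d x0 2) (tripartition Lx Ly x0 \<psi>)"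
    unfolding sum_of_triangle_states_iff by (intro conjI triangle_sum_cat) auto
next
  fix Lx Ly :: "nat \<Rightarrow> nat" and d x0 \<phi> \<psi>
  assume *: "\<forall>n::nat. cylinder (Lx n) (Ly n) (d n) \<and> real (Ly n) < real (Lx n) / 6 \<and>
         (trivial_initial_state (Lx n) (Ly n) (d n) (\<phi> n) \<or>
          cat_initial_state (Lx n) (Ly n) (d n) (\<phi> n)) \<and>
         sequential_circuit (Lx n) (Ly n) (d n) (\<phi> n) (\<psi> n)"
  have gap: "markov_gap (region_labels (Lx n) (Ly n) (d n) (x0 n) 0) (region_labels (Lx n) (Ly n) (d n) (x0 n) 1)
      (region_labels (Lx n) (Ly n) (d n) (x0 n) 2) (tripartition (Lx n) (Ly n) (x0 n) (\<psi> n)) = 0" for n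
    using * by (intro markov_gap_sequential_circuit) auto
  show "\<not> ungappable_edge (\<lambda>n. region_labels (Lx n) (Ly n) (d n) (x0 n) 0)
          (\<lambda>n. region_labels (Lx n) (Ly n) (d n) (x0 n) 1)
          (\<lambda>n. region_labels (Lx n) (Ly n) (d n) (x0 n) 2)
          (\<lambda>n. tripartition (Lx n) (Ly n) (x0 n) (\<psi> n))"
    unfolding ungappable_edge_def gap
  proof (intro notI, elim exE conjE)
    fix c :: real assume "c > 0" "(\<lambda>n::nat. 0) \<longlonglongrightarrow> c / 3 * ln 2"
    then show False by (simp add: LIMSEQ_const_iff)
  qed
qed

end
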